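(* Suppose that $S[\omega]$ and $S[\mu]$ are integrally closed and that $fg^i\notin S^{p\wedge p^2}$ for all $1\leq i\leq p-1$. Then $R$ is a free $S$-module. Further, in this case, $P^{(p-1)}$ is the conductor of $R$ to $A$ (that is, $P^{(p-1)}=\{x\in K: xR\subseteq A\}$), where $P$ is the unique height one prime of $A$ containing $p$ and $P^{(p-1)}$ denotes the $(p-1)$-th symbolic power of $P$.
   Context: Setting. $p\geq 3$ is a prime number. $S$ is a Noetherian integrally closed domain of dimension $d$ with fraction field $L$ of characteristic $0$, such that $p\in S$ is a prime element (generating a nonzero prime ideal $pS$) and $S/pS$ is an integrally closed domain. $S^p$ denotes the subring of $S$ that is the preimage in $S$ of the image of the Frobenius map on $S/pS$, i.e. $S^p=\{x^p+yp: x,y\in S\}$. $S^{p\wedge p^2}$ denotes the set of elements of $S$ expressible as $x^p+yp^2$ with $x,y\in S$. An element $c\in S$ is square free if for every height one prime $P\subset S$ containing $c$ one has $PS_P=cS_P$. The elements $f,g\in S^p$ are either square free non-units such that no height one prime of $S$ contains both of them, or units of $S$ that are not $p$-th powers in $S$. $\omega,\mu$ are elements of an algebraic closure of $L$ with $\omega^p=f$, $\mu^p=g$, $K:=L(\omega,\mu)$, and it is assumed that $[K:L]=p^2$. $A:=S[\omega,\mu]$, and $R$ is the integral closure of $S$ (equivalently of $A$) in $K$. A domain is integrally closed if it is integrally closed in its field of fractions. Writing $f=h_1^p+ap$, $g=h_2^p+bp$ with $h_1,h_2,a,b\in S$, the ring $A$ has a unique height one prime containing $p$, namely $P=(p,\omega-h_1,\mu-h_2)A$.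 *)

theory Defs
  imports
    "HOL-Algebra.Algebra"
    "HOL-Algebra.Algebraic_Closure_Type"
    "HOL-Library.Extended_Nat"
begin

section \<open>Subrings of a field type\<close>

text \<open>
  A domain and all of its overrings are regarded as subsets of one ambient field type; the
  operations of the type are packaged by the library's \<^const>\<open>ring_1_class.ring_of_type_algebra\<close>,
  so that the notions of HOL-Algebra (ideals, primes, generated subrings, ...) apply to them.
\<close>

abbreviation ambient :: "'k::field ring"
  where "ambient \<equiv> ring_of_type_algebra"

abbreviation ring_on :: "'k::field set \<Rightarrow> 'k ring"
  where "ring_on S \<equiv> ring_of_type_algebra\<lparr>carrier := S\<rparr>"

definition module_on :: "'k::field set \<Rightarrow> ('k, 'k) module"
  where "module_on M =
    \<lparr>carrier = M, monoid.mult = (*), one = 1, ring.zero = 0, ring.add = (+), module.smult = (*)\<rparr>"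

definition adjoin :: "'k::field set \<Rightarrow> 'k set \<Rightarrow> 'k set"
  where "adjoin S T = generate_ring ambient (S \<union> T)"

definition adjoin_field :: "'k::field set \<Rightarrow> 'k set \<Rightarrow> 'k set"
  where "adjoin_field L T = generate_field ambient (L \<union> T)"

definition quotients :: "'k::field set \<Rightarrow> 'k set"
  where "quotients S = {a / b | a b. a \<in> S \<and> b \<in> S \<and> b \<noteq> 0}"

text \<open>The localization of S at the prime P, which for a domain is a subring of the ambient field.\<close>

definition localization_at :: "'k::field set \<Rightarrow> 'k set \<Rightarrow> 'k set"
  where "localization_at S P = {a / s | a s. a \<in> S \<and> s \<in> S - P}"


section \<open>Height and dimension\<close>

definition prime_chain :: "('a, 'b) ring_scheme \<Rightarrow> nat \<Rightarrow> (nat \<Rightarrow> 'a set) \<Rightarrow> bool"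
  where "prime_chain R n C \<longleftrightarrow>
    (\<forall>i\<le>n. primeideal (C i) R) \<and> (\<forall>i<n. C i \<subset> C (Suc i))"

definition krull_dim :: "('a, 'b) ring_scheme \<Rightarrow> enat"
  where "krull_dim R = Sup {enat n | n. \<exists>C. prime_chain R n C}"

definition height :: "('a, 'b) ring_scheme \<Rightarrow> 'a set \<Rightarrow> enat"
  where "height R P = Sup {enat n | n. \<exists>C. prime_chain R n C \<and> C n = P}"

definition height_one_prime :: "('a, 'b) ring_scheme \<Rightarrow> 'a set \<Rightarrow> bool"
  where "height_one_prime R P \<longleftrightarrow> primeideal P R \<and> height R P = 1"


section \<open>The field of fractions of a domain\<close>

text \<open>
  The class of all pairs (c, d) with c / d = a / b. The abstract construction is needed for
  quotient rings, which do not live inside the ambient field.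
\<close>

definition fraction_class :: "('a, 'b) ring_scheme \<Rightarrow> 'a \<Rightarrow> 'a \<Rightarrow> ('a \<times> 'a) set"
  where "fraction_class D a b =
    {(c, d). c \<in> carrier D \<and> d \<in> carrier D - {\<zero>\<^bsub>D\<^esub>} \<and> c \<otimes>\<^bsub>D\<^esub> b = a \<otimes>\<^bsub>D\<^esub> d}"

definition fraction_field :: "('a, 'b) ring_scheme \<Rightarrow> ('a \<times> 'a) set ring"
  where "fraction_field D =
    \<lparr>carrier = {fraction_class D a b | a b. a \<in> carrier D \<and> b \<in> carrier D - {\<zero>\<^bsub>D\<^esub>}},
     monoid.mult = (\<lambda>U V. \<Union>(a, b)\<in>U. \<Union>(c, d)\<in>V. fraction_class D (a \<otimes>\<^bsub>D\<^esub> c) (b \<otimes>\<^bsub>D\<^esub> d)),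
     one = fraction_class D \<one>\<^bsub>D\<^esub> \<one>\<^bsub>D\<^esub>,
     ring.zero = fraction_class D \<zero>\<^bsub>D\<^esub> \<one>\<^bsub>D\<^esub>,
     ring.add = (\<lambda>U V. \<Union>(a, b)\<in>U. \<Union>(c, d)\<in>V.
              fraction_class D ((a \<otimes>\<^bsub>D\<^esub> d) \<oplus>\<^bsub>D\<^esub> (c \<otimes>\<^bsub>D\<^esub> b)) (b \<otimes>\<^bsub>D\<^esub> d))\<rparr>"

context domain
begin

lemma frac_eq_iff:
  assumes "a \<in> carrier R" "b \<in> carrier R - {\<zero>}" "c \<in> carrier R" "d \<in> carrier R - {\<zero>}"
  shows "fraction_class R a b = fraction_class R c d \<longleftrightarrow> a \<otimes> d = c \<otimes> b"
proof
  assume "fraction_class R a b = fraction_class R c d"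
  moreover have "(a, b) \<in> fraction_class R a b"
    using assms by (auto simp: fraction_class_def)
  ultimately have "(a, b) \<in> fraction_class R c d" by simp
  thus "a \<otimes> d = c \<otimes> b" by (simp add: fraction_class_def)
next
  have sub: "fraction_class R a b \<subseteq> fraction_class R c d"
    if h: "a \<in> carrier R" "b \<in> carrier R - {\<zero>}" "c \<in> carrier R" "d \<in> carrier R - {\<zero>}"
      and e: "a \<otimes> d = c \<otimes> b" for a b c d
  proof safe
    fix x y assume "(x, y) \<in> fraction_class R a b"
    hence xy: "x \<in> carrier R" "y \<in> carrier R - {\<zero>}" "x \<otimes> b = a \<otimes> y"
      by (auto simp: fraction_class_def)
    have "b \<otimes> (x \<otimes> d) = (x \<otimes> b) \<otimes> d"
      using h xy(1,2) by (simp add: m_ac)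
    also have "\<dots> = (a \<otimes> d) \<otimes> y"
      using h xy by (simp add: m_ac)
    also have "\<dots> = b \<otimes> (c \<otimes> y)"
      using h e xy(1,2) by (simp add: m_ac)
    finally have "x \<otimes> d = c \<otimes> y"
      using h xy(1,2) m_lcancel[of b "x \<otimes> d" "c \<otimes> y"] by auto
    thus "(x, y) \<in> fraction_class R c d" using xy by (simp add: fraction_class_def)
  qed
  assume "a \<otimes> d = c \<otimes> b"
  thus "fraction_class R a b = fraction_class R c d"
    using sub[of a b c d] sub[of c d a b] assms by (intro equalityI) simp_all
qed

lemma frac_UN:
  assumes "a \<in> carrier R" "b \<in> carrier R - {\<zero>}" "c \<in> carrier R" "d \<in> carrier R - {\<zero>}"
    and "\<And>a' b' c' d'. (a', b') \<in> fraction_class R a b \<Longrightarrow> (c', d') \<in> fraction_class R c d \<Longrightarrow> h a' b' c' d' = h a b c d"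
  shows "(\<Union>(a', b')\<in>fraction_class R a b. \<Union>(c', d')\<in>fraction_class R c d. h a' b' c' d') = h a b c d"
proof -
  have "(a, b) \<in> fraction_class R a b" "(c, d) \<in> fraction_class R c d"
    using assms by (auto simp: fraction_class_def)
  thus ?thesis using assms(5) by blast
qed

lemma nonzero_mult:
  assumes "b \<in> carrier R - {\<zero>}" "d \<in> carrier R - {\<zero>}"
  shows "b \<otimes> d \<in> carrier R - {\<zero>}"
  using assms integral_iff by auto

lemma frac_mult:
  assumes "a \<in> carrier R" "b \<in> carrier R - {\<zero>}" "c \<in> carrier R" "d \<in> carrier R - {\<zero>}"
  shows "fraction_class R a b \<otimes>\<^bsub>fraction_field R\<^esub> fraction_class R c d = fraction_class R (a \<otimes> c) (b \<otimes> d)"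
proof -
  have "fraction_class R (a' \<otimes> c') (b' \<otimes> d') = fraction_class R (a \<otimes> c) (b \<otimes> d)"
    if "(a', b') \<in> fraction_class R a b" "(c', d') \<in> fraction_class R c d" for a' b' c' d'
  proof -
    have h: "a' \<in> carrier R" "b' \<in> carrier R - {\<zero>}" "c' \<in> carrier R" "d' \<in> carrier R - {\<zero>}"
      "a' \<otimes> b = a \<otimes> b'" "c' \<otimes> d = c \<otimes> d'"
      using that by (auto simp: fraction_class_def)
    have "(a' \<otimes> c') \<otimes> (b \<otimes> d) = (a' \<otimes> b) \<otimes> (c' \<otimes> d)"
      using h(1-4) assms by (simp add: m_ac)
    also have "\<dots> = (a \<otimes> c) \<otimes> (b' \<otimes> d')"
      unfolding h(5,6) using h(1-4) assms by (simp add: m_ac)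
    finally show ?thesis
      using h assms nonzero_mult by (subst frac_eq_iff) auto
  qed
  thus ?thesis
    unfolding fraction_field_def
    using frac_UN[OF assms, of "\<lambda>a b c d. fraction_class R (a \<otimes> c) (b \<otimes> d)"] by simp
qed

lemma frac_add:
  assumes "a \<in> carrier R" "b \<in> carrier R - {\<zero>}" "c \<in> carrier R" "d \<in> carrier R - {\<zero>}"
  shows "fraction_class R a b \<oplus>\<^bsub>fraction_field R\<^esub> fraction_class R c d
    = fraction_class R ((a \<otimes> d) \<oplus> (c \<otimes> b)) (b \<otimes> d)"
proof -
  have "fraction_class R ((a' \<otimes> d') \<oplus> (c' \<otimes> b')) (b' \<otimes> d') = fraction_class R ((a \<otimes> d) \<oplus> (c \<otimes> b)) (b \<otimes> d)"
    if "(a', b') \<in> fraction_class R a b" "(c', d') \<in> fraction_class R c d" for a' b' c' d'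
  proof -
    have h: "a' \<in> carrier R" "b' \<in> carrier R - {\<zero>}" "c' \<in> carrier R" "d' \<in> carrier R - {\<zero>}"
      "a' \<otimes> b = a \<otimes> b'" "c' \<otimes> d = c \<otimes> d'"
      using that by (auto simp: fraction_class_def)
    have "((a' \<otimes> d') \<oplus> (c' \<otimes> b')) \<otimes> (b \<otimes> d)
        = (a' \<otimes> b) \<otimes> (d \<otimes> d') \<oplus> (c' \<otimes> d) \<otimes> (b \<otimes> b')"
      using h(1-4) assms by (simp add: m_ac l_distr r_distr)
    also have "\<dots> = ((a \<otimes> d) \<oplus> (c \<otimes> b)) \<otimes> (b' \<otimes> d')"
      unfolding h(5,6) using h(1-4) assms by (simp add: m_ac l_distr r_distr)
    finally show ?thesis
      using h assms nonzero_mult by (subst frac_eq_iff) auto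
  qed
  thus ?thesis
    unfolding fraction_field_def
    using frac_UN[OF assms, of "\<lambda>a b c d. fraction_class R ((a \<otimes> d) \<oplus> (c \<otimes> b)) (b \<otimes> d)"] by simp
qed

lemma frac_closed [simp]:
  "a \<in> carrier R \<Longrightarrow> b \<in> carrier R - {\<zero>} \<Longrightarrow> fraction_class R a b \<in> carrier (fraction_field R)"
  by (auto simp: fraction_field_def)

lemma fraction_fieldE:
  assumes "x \<in> carrier (fraction_field R)"
  obtains a b where "a \<in> carrier R" "b \<in> carrier R - {\<zero>}" "x = fraction_class R a b"
  using assms by (auto simp: fraction_field_def)

lemma fraction_field_one: "\<one>\<^bsub>fraction_field R\<^esub> = fraction_class R \<one> \<one>"
  and fraction_field_zero: "\<zero>\<^bsub>fraction_field R\<^esub> = fraction_class R \<zero> \<one>"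
  by (simp_all add: fraction_field_def)

lemmas frac_simps = frac_mult frac_add fraction_field_one fraction_field_zero

lemma one_nonzero: "\<one> \<in> carrier R - {\<zero>}"
  by simp

lemma field_fraction_field: "field (fraction_field R)"
proof -
  let ?F = "fraction_field R"
  note nz = nonzero_mult one_nonzero
  have group: "abelian_group ?F"
  proof (rule abelian_groupI)
    fix x y assume "x \<in> carrier ?F" "y \<in> carrier ?F"
    then obtain a b c d where *: "a \<in> carrier R" "b \<in> carrier R - {\<zero>}" "x = fraction_class R a b"
      "c \<in> carrier R" "d \<in> carrier R - {\<zero>}" "y = fraction_class R c d"
      by (metis fraction_fieldE)
    show "x \<oplus>\<^bsub>?F\<^esub> y \<in> carrier ?F"
      unfolding *(3,6) frac_add[OF *(1,2,4,5)] using * nz(1)[OF *(2,5)] by (intro frac_closed) auto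
    show "x \<oplus>\<^bsub>?F\<^esub> y = y \<oplus>\<^bsub>?F\<^esub> x"
      unfolding *(3,6) frac_add[OF *(1,2,4,5)] frac_add[OF *(4,5,1,2)]
      using * by (simp add: m_comm a_comm)
  next
    fix x y z assume "x \<in> carrier ?F" "y \<in> carrier ?F" "z \<in> carrier ?F"
    then obtain a b c d e f where *: "a \<in> carrier R" "b \<in> carrier R - {\<zero>}" "x = fraction_class R a b"
      "c \<in> carrier R" "d \<in> carrier R - {\<zero>}" "y = fraction_class R c d"
      "e \<in> carrier R" "f \<in> carrier R - {\<zero>}" "z = fraction_class R e f"
      by (metis fraction_fieldE)
    show "(x \<oplus>\<^bsub>?F\<^esub> y) \<oplus>\<^bsub>?F\<^esub> z = x \<oplus>\<^bsub>?F\<^esub> (y \<oplus>\<^bsub>?F\<^esub> z)"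
      unfolding *(3,6,9)
      using * nz(1)[OF *(2,5)] nz(1)[OF *(5,8)]
      by (simp add: frac_add l_distr r_distr m_ac a_ac)
  next
    show "\<zero>\<^bsub>?F\<^esub> \<in> carrier ?F"
      unfolding fraction_field_zero by (rule frac_closed) auto
  next
    fix x assume "x \<in> carrier ?F"
    then obtain a b where *: "a \<in> carrier R" "b \<in> carrier R - {\<zero>}" "x = fraction_class R a b"
      by (metis fraction_fieldE)
    show "\<zero>\<^bsub>?F\<^esub> \<oplus>\<^bsub>?F\<^esub> x = x"
      unfolding fraction_field_zero *(3) using * by (simp add: frac_add)
    have "fraction_class R (\<ominus> a) b \<oplus>\<^bsub>?F\<^esub> x = fraction_class R \<zero> (b \<otimes> b)"
      unfolding *(3) using * by (simp add: frac_add l_minus l_neg)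
    also have "\<dots> = \<zero>\<^bsub>?F\<^esub>"
      unfolding fraction_field_zero using * nz(1)[OF *(2,2)] by (subst frac_eq_iff) auto
    finally show "\<exists>y\<in>carrier ?F. y \<oplus>\<^bsub>?F\<^esub> x = \<zero>\<^bsub>?F\<^esub>"
      using * by (intro bexI[of _ "fraction_class R (\<ominus> a) b"]) auto
  qed
  have monoid: "comm_monoid ?F"
  proof (rule comm_monoidI)
    fix x y assume "x \<in> carrier ?F" "y \<in> carrier ?F"
    then obtain a b c d where *: "a \<in> carrier R" "b \<in> carrier R - {\<zero>}" "x = fraction_class R a b"
      "c \<in> carrier R" "d \<in> carrier R - {\<zero>}" "y = fraction_class R c d"
      by (metis fraction_fieldE)
    show "x \<otimes>\<^bsub>?F\<^esub> y \<in> carrier ?F"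
      unfolding *(3,6) frac_mult[OF *(1,2,4,5)] using * nz(1)[OF *(2,5)] by (intro frac_closed) auto
    show "x \<otimes>\<^bsub>?F\<^esub> y = y \<otimes>\<^bsub>?F\<^esub> x"
      unfolding *(3,6) frac_mult[OF *(1,2,4,5)] frac_mult[OF *(4,5,1,2)]
      using * by (simp add: m_comm)
  next
    fix x y z assume "x \<in> carrier ?F" "y \<in> carrier ?F" "z \<in> carrier ?F"
    then obtain a b c d e f where *: "a \<in> carrier R" "b \<in> carrier R - {\<zero>}" "x = fraction_class R a b"
      "c \<in> carrier R" "d \<in> carrier R - {\<zero>}" "y = fraction_class R c d"
      "e \<in> carrier R" "f \<in> carrier R - {\<zero>}" "z = fraction_class R e f"
      by (metis fraction_fieldE)
    show "(x \<otimes>\<^bsub>?F\<^esub> y) \<otimes>\<^bsub>?F\<^esub> z = x \<otimes>\<^bsub>?F\<^esub> (y \<otimes>\<^bsub>?F\<^esub> z)"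
      unfolding *(3,6,9)
      using * nz(1)[OF *(2,5)] nz(1)[OF *(5,8)]
      by (simp add: frac_mult m_ac)
  next
    show "\<one>\<^bsub>?F\<^esub> \<in> carrier ?F"
      unfolding fraction_field_one by (rule frac_closed) auto
  next
    fix x assume "x \<in> carrier ?F"
    then obtain a b where *: "a \<in> carrier R" "b \<in> carrier R - {\<zero>}" "x = fraction_class R a b"
      by (metis fraction_fieldE)
    show "\<one>\<^bsub>?F\<^esub> \<otimes>\<^bsub>?F\<^esub> x = x"
      unfolding fraction_field_one *(3) using * by (simp add: frac_mult)
  qed
  have cring: "cring ?F"
  proof (rule cringI[OF group monoid])
    fix x y z assume "x \<in> carrier ?F" "y \<in> carrier ?F" "z \<in> carrier ?F"
    then obtain a b c d e f where *: "a \<in> carrier R" "b \<in> carrier R - {\<zero>}" "x = fraction_class R a b"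
      "c \<in> carrier R" "d \<in> carrier R - {\<zero>}" "y = fraction_class R c d"
      "e \<in> carrier R" "f \<in> carrier R - {\<zero>}" "z = fraction_class R e f"
      by (metis fraction_fieldE)
    show "(x \<oplus>\<^bsub>?F\<^esub> y) \<otimes>\<^bsub>?F\<^esub> z = x \<otimes>\<^bsub>?F\<^esub> z \<oplus>\<^bsub>?F\<^esub> y \<otimes>\<^bsub>?F\<^esub> z"
      unfolding *(3,6,9)
      using * nz(1)[OF *(2,5)] nz(1)[OF *(5,8)] nz(1)[OF *(2,8)]
        nz(1)[OF nz(1)[OF *(2,5)] *(8)] nz(1)[OF nz(1)[OF *(2,8)] nz(1)[OF *(5,8)]]
      by (simp add: frac_mult frac_add) (subst frac_eq_iff; simp add: l_distr r_distr m_ac)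
  qed
  show ?thesis
  proof (rule cring.cring_fieldI2[OF cring])
    show "\<zero>\<^bsub>?F\<^esub> \<noteq> \<one>\<^bsub>?F\<^esub>"
      unfolding fraction_field_one fraction_field_zero by (subst frac_eq_iff) auto
  next
    fix x assume "x \<in> carrier ?F" and x: "x \<noteq> \<zero>\<^bsub>?F\<^esub>"
    then obtain a b where *: "a \<in> carrier R" "b \<in> carrier R - {\<zero>}" "x = fraction_class R a b"
      by (metis fraction_fieldE)
    have a: "a \<in> carrier R - {\<zero>}"
    proof -
      have "a \<noteq> \<zero>"
      proof
        assume "a = \<zero>"
        hence "x = \<zero>\<^bsub>?F\<^esub>"
          unfolding *(3) fraction_field_zero using * by (subst frac_eq_iff) auto
        with x show False ..
      qed
      with * show ?thesis by simp
    qed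
    have "x \<otimes>\<^bsub>?F\<^esub> fraction_class R b a = \<one>\<^bsub>?F\<^esub>"
      unfolding *(3) fraction_field_one using * a nz(1)[OF *(2) a]
      by (simp add: frac_mult) (subst frac_eq_iff; simp add: m_comm)
    thus "\<exists>y\<in>carrier ?F. x \<otimes>\<^bsub>?F\<^esub> y = \<one>\<^bsub>?F\<^esub>"
      using * a by (intro bexI[of _ "fraction_class R b a"]) auto
  qed
qed

lemma frac_hom: "(\<lambda>a. fraction_class R a \<one>) \<in> ring_hom R (fraction_field R)"
  by (rule ring_hom_memI) (simp_all add: frac_mult frac_add fraction_field_one)

lemma frac_inj: "inj_on (\<lambda>a. fraction_class R a \<one>) (carrier R)"
  by (rule inj_onI) (simp add: frac_eq_iff)

end


section \<open>Integral elements\<close>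

text \<open>
  A polynomial of HOL-Algebra is the list of its coefficients, the leading one first; so q below
  is monic.
\<close>

definition integral_over :: "('a, 'b) ring_scheme \<Rightarrow> 'a set \<Rightarrow> 'a \<Rightarrow> bool"
  where "integral_over F D x \<longleftrightarrow>
    (\<exists>q \<in> carrier (univ_poly F D). q \<noteq> [] \<and> hd q = \<one>\<^bsub>F\<^esub> \<and> ring.eval F q x = \<zero>\<^bsub>F\<^esub>)"

definition integral_closure_in :: "'k::field set \<Rightarrow> 'k set \<Rightarrow> 'k set"
  where "integral_closure_in S K = {x \<in> K. integral_over ambient S x}"

definition integrally_closed_domain :: "('a, 'b) ring_scheme \<Rightarrow> bool"
  where "integrally_closed_domain D \<longleftrightarrow> domain D \<and>
    (\<forall>x \<in> carrier (fraction_field D).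
       integral_over (fraction_field D) ((\<lambda>a. fraction_class D a \<one>\<^bsub>D\<^esub>) ` carrier D) x \<longrightarrow>
       x \<in> (\<lambda>a. fraction_class D a \<one>\<^bsub>D\<^esub>) ` carrier D)"


section \<open>Square-free elements and the subsets of p-th powers modulo p and its square\<close>

definition square_free :: "'k::field set \<Rightarrow> 'k \<Rightarrow> bool"
  where "square_free S c \<longleftrightarrow> c \<in> S \<and>
    (\<forall>P. height_one_prime (ring_on S) P \<and> c \<in> P \<longrightarrow>
       genideal (ring_on (localization_at S P)) P
         = cgenideal (ring_on (localization_at S P)) c)"

definition pow_mod_p :: "nat \<Rightarrow> 'k::field set \<Rightarrow> 'k set"
  where "pow_mod_p p S = {x ^ p + y * of_nat p | x y. x \<in> S \<and> y \<in> S}"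

definition pow_mod_p2 :: "nat \<Rightarrow> 'k::field set \<Rightarrow> 'k set"
  where "pow_mod_p2 p S = {x ^ p + y * of_nat p ^ 2 | x y. x \<in> S \<and> y \<in> S}"


section \<open>Free modules, symbolic powers, conductor\<close>

definition free_module :: "('a, 'b) ring_scheme \<Rightarrow> ('a, 'c, 'd) module_scheme \<Rightarrow> bool"
  where "free_module R M \<longleftrightarrow> module R M \<and>
    (\<exists>B \<subseteq> carrier M. \<forall>x \<in> carrier M. \<exists>!c.
       (\<forall>b. c b \<in> carrier R) \<and> finite {b. c b \<noteq> \<zero>\<^bsub>R\<^esub>} \<and> {b. c b \<noteq> \<zero>\<^bsub>R\<^esub>} \<subseteq> B \<and>
       x = (\<Oplus>\<^bsub>M\<^esub>b \<in> {b. c b \<noteq> \<zero>\<^bsub>R\<^esub>}. c b \<odot>\<^bsub>M\<^esub> b))"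

text \<open>The contraction to A of the extension of the n-th power of P to the localization at P.\<close>

definition symbolic_power :: "'k::field set \<Rightarrow> 'k set \<Rightarrow> nat \<Rightarrow> 'k set"
  where "symbolic_power A P n =
    A \<inter> genideal (ring_on (localization_at A P)) (P [^]\<^bsub>ideals_set (ring_on A)\<^esub> n)"

definition conductor :: "'k::field set \<Rightarrow> 'k set \<Rightarrow> 'k set \<Rightarrow> 'k set"
  where "conductor K R A = {x \<in> K. \<forall>r \<in> R. x * r \<in> A}"

end

theory Submission
  imports Defs "HOL-Number_Theory.Residues" "Jordan_Normal_Form.Char_Poly"
begin

text \<open>
  Put \<alpha> = \<omega> - h1 and \<beta> = \<mu> - h2, where f = h1^p + p a and g = h2^p + p b. As p is a prime number,
  expanding (\<alpha> + h1)^p shows \<alpha>^p = p e1 with e1 congruent to a modulo \<alpha>, and likewise \<beta>^p = p e2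
  with e2 congruent to b modulo \<beta>. The ring A has the S-basis \<alpha>^i \<beta>^j with i, j < p. Let M be the
  free S-module on these monomials, where those with i + j \<ge> p are divided by p. The relations
  just stated make M a ring, so that M consists of integral elements, and the theorem amounts to
  R = M together with a computation in this basis.

  Away from p this is a matter of square-free elements: averaging the conjugates of an integral
  element over the p-th roots of unity isolates p^2 u \<omega>^i \<mu>^j for each of its coefficients u
  (homogeneous_component_integral), and the p-th power of such a term lies in S. At a prime of
  height one f and g have valuation at most one, and not both of them one, which forces p^2 u into
  S (mem_of_radical_multiple_mem). Hence p^2 R is contained in A, and so in M.

  It remains to see that M is normal at (p). Let V be the localization of S at (p), with residue
  field k, and B that of M. Normality of S[\<omega>] and S[\<mu>] says that p divides neither a nor b
  (constant_term_nondiv), so e2 is a unit of B and p is a unit times \<beta>^p. With T = \<alpha> / \<beta> and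
  c = a / b one finds that B modulo \<beta> is k[T] / (T^p - c). If c is not a p-th power in k, this is a
  field (radical_of_pure_equation), so B is a discrete valuation ring with uniformizer \<beta>. If
  c = \<gamma>^p in k, then \<theta> = T - \<gamma> satisfies \<theta>^p = \<beta> \<delta> up to a unit and terms of higher order, where
  \<delta> = \<gamma> ((\<gamma> h2)^(p-1) - h1^(p-1)). The conditions on the products f g^i make \<delta> a unit: they
  say that neither h2 nor any a h2^p + i b h1^p with 0 < i < p vanishes modulo p, and since
  T^(p-1) - 1 has only the roots 1, ..., p-1 in k, the vanishing of \<delta> would entail that of one of
  these. Then B is a discrete valuation ring with uniformizer \<theta>. In
  both cases an element of B that is divisible by \<beta> after normalization is divisible by \<beta> in B
  (over_\<beta>_B_of_N), and p times applied this descends to M (div_M_of_integral).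

  The prime over p is P = (p, \<alpha>, \<beta>). Near P the element p is a unit times \<alpha>^p, so the
  (p-1)-st symbolic power has the S-basis consisting of the monomials with i + j \<ge> p - 1 and of p
  times the others (symbolic_power_eq). Multiplying by the basis of M shows that the conductor has
  the same description (conductor_eq): a coefficient of smaller degree could be moved into the
  corner \<alpha>^(p-1) \<beta>^(p-1) / p, which does not lie in A.
\<close>

section \<open>Subrings of a field\<close>

lemma ambient_simps [simp]:
  "carrier (ambient :: 'k::field ring) = UNIV"
  "x \<otimes>\<^bsub>(ambient :: 'k ring)\<^esub> y = x * y"
  "x \<oplus>\<^bsub>(ambient :: 'k ring)\<^esub> y = x + y"
  "\<one>\<^bsub>(ambient :: 'k ring)\<^esub> = 1"
  "\<zero>\<^bsub>(ambient :: 'k ring)\<^esub> = 0"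
  by (simp_all add: ring_of_type_algebra_def)

lemma ambient_field: "field (ambient :: 'k::field ring)"
  by (rule field_from_type_algebra)

lemma ambient_a_inv [simp]: "\<ominus>\<^bsub>(ambient :: 'k::field ring)\<^esub> x = - x"
proof -
  interpret field "ambient :: 'k ring" by (rule ambient_field)
  have "- x \<oplus>\<^bsub>(ambient :: 'k ring)\<^esub> x = \<zero>\<^bsub>(ambient :: 'k ring)\<^esub>" by simp
  then show ?thesis using minus_equality[of "- x" x] by simp
qed

locale field_subring =
  fixes S :: "'k::field set"
  assumes subring_ambient: "subring S ambient"
begin

lemma zero_mem [simp, intro]: "0 \<in> S"
  using subringE(2)[OF subring_ambient] by simp

lemma one_mem [simp, intro]: "1 \<in> S"
  using subringE(3)[OF subring_ambient] by simp

lemma uminus_mem [intro]: "x \<in> S \<Longrightarrow> - x \<in> S"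
  using subringE(5)[OF subring_ambient] by simp

lemma add_mem [intro]: "x \<in> S \<Longrightarrow> y \<in> S \<Longrightarrow> x + y \<in> S"
  using subringE(7)[OF subring_ambient] by simp

lemma mult_mem [intro]: "x \<in> S \<Longrightarrow> y \<in> S \<Longrightarrow> x * y \<in> S"
  using subringE(6)[OF subring_ambient] by simp

lemma diff_mem [intro]: "x \<in> S \<Longrightarrow> y \<in> S \<Longrightarrow> x - y \<in> S"
  using add_mem[OF _ uminus_mem, of x y] by simp

lemma uminus_mem_iff [simp]: "- x \<in> S \<longleftrightarrow> x \<in> S"
  using uminus_mem[of x] uminus_mem[of "- x"] by auto

lemma power_mem [intro]: "x \<in> S \<Longrightarrow> x ^ n \<in> S"
  by (induction n) auto

lemma of_nat_mem [simp, intro]: "of_nat n \<in> S"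
  by (induction n) auto

lemma sum_mem [intro]: "(\<And>i. i \<in> I \<Longrightarrow> h i \<in> S) \<Longrightarrow> sum h I \<in> S"
  by (induction I rule: infinite_finite_induct) auto

end

lemma field_subringI:
  fixes S :: "'k::field set"
  assumes "1 \<in> S" "\<And>x y. x \<in> S \<Longrightarrow> y \<in> S \<Longrightarrow> x - y \<in> S" "\<And>x y. x \<in> S \<Longrightarrow> y \<in> S \<Longrightarrow> x * y \<in> S"
  shows "field_subring S"
proof (rule field_subring.intro)
  interpret field "ambient :: 'k ring" by (rule ambient_field)
  have z: "0 \<in> S" using assms(2)[OF assms(1,1)] by simp
  have m: "- x \<in> S" if "x \<in> S" for x using assms(2)[OF z that] by simp
  have a: "x + y \<in> S" if "x \<in> S" "y \<in> S" for x y using assms(2)[OF that(1) m[OF that(2)]] by simp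
  show "subring S ambient"
    by (rule subringI) (use assms m a in auto)
qed

lemma (in field_subring) adjoin_subring:
  "field_subring (adjoin S Y)" "S \<subseteq> adjoin S Y" "Y \<subseteq> adjoin S Y"
proof -
  interpret F: field "ambient :: 'k ring" by (rule ambient_field)
  show "field_subring (adjoin S Y)"
    unfolding adjoin_def by (intro field_subring.intro F.generate_ring_is_subring) simp
  show "S \<subseteq> adjoin S Y" "Y \<subseteq> adjoin S Y" unfolding adjoin_def by (auto intro: generate_ring.incl)
qed

lemma (in field_subring) adjoin_least:
  assumes "field_subring E" "S \<subseteq> E" "Y \<subseteq> E"
  shows "adjoin S Y \<subseteq> E"
proof -
  interpret F: field "ambient :: 'k ring" by (rule ambient_field)
  show ?thesis unfolding adjoin_def
    by (rule F.generate_ring_min_subring1) (use assms field_subring.subring_ambient[OF assms(1)] in auto)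
qed

section \<open>Spans of finite families\<close>

definition fspan :: "'k::field set \<Rightarrow> 'i set \<Rightarrow> ('i \<Rightarrow> 'k) \<Rightarrow> 'k set"
  where "fspan S I v = {\<Sum>i\<in>I. c i * v i | c. \<forall>i. c i \<in> S}"

lemma fspanE:
  assumes "x \<in> fspan S I v"
  obtains c where "\<And>i. c i \<in> S" "x = (\<Sum>i\<in>I. c i * v i)"
  using assms by (auto simp: fspan_def)

context field_subring
begin

lemma fspanI: "(\<And>i. i \<in> I \<Longrightarrow> c i \<in> S) \<Longrightarrow> x = (\<Sum>i\<in>I. c i * v i) \<Longrightarrow> x \<in> fspan S I v"
  unfolding fspan_def
  by (auto intro!: exI[of _ "\<lambda>i. if i \<in> I then c i else 0"] sum.cong)

lemma fspan_base: "finite I \<Longrightarrow> i \<in> I \<Longrightarrow> v i \<in> fspan S I v"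
  by (rule fspanI[of _ "\<lambda>j. if j = i then 1 else 0"]) (auto simp: if_distrib[of "\<lambda>x. x * _"] cong: if_cong)

lemma fspan_scale:
  assumes "s \<in> S" "x \<in> fspan S I v"
  shows "s * x \<in> fspan S I v"
proof -
  obtain c where "\<And>i. c i \<in> S" "x = (\<Sum>i\<in>I. c i * v i)" using assms(2) by (elim fspanE) blast
  then show ?thesis
    using assms(1) by (intro fspanI[of _ "\<lambda>i. s * c i"]) (auto simp: sum_distrib_left mult.assoc)
qed

lemma fspan_add:
  assumes "x \<in> fspan S I v" "y \<in> fspan S I v"
  shows "x + y \<in> fspan S I v"
proof -
  obtain c where c: "\<And>i. c i \<in> S" "x = (\<Sum>i\<in>I. c i * v i)" using assms(1) by (elim fspanE) blast
  obtain d where d: "\<And>i. d i \<in> S" "y = (\<Sum>i\<in>I. d i * v i)" using assms(2) by (elim fspanE) blast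
  show ?thesis
    using c d by (intro fspanI[of _ "\<lambda>i. c i + d i"]) (auto simp: sum.distrib distrib_right)
qed

lemma fspan_zero: "0 \<in> fspan S I v"
  by (rule fspanI[of _ "\<lambda>_. 0"]) auto

lemma fspan_uminus: "x \<in> fspan S I v \<Longrightarrow> - x \<in> fspan S I v"
  using fspan_scale[of "-1" x I v] by auto

lemma fspan_diff: "x \<in> fspan S I v \<Longrightarrow> y \<in> fspan S I v \<Longrightarrow> x - y \<in> fspan S I v"
  using fspan_add[OF _ fspan_uminus, of x I v y] by simp

lemma fspan_sum: "(\<And>j. j \<in> J \<Longrightarrow> h j \<in> fspan S I v) \<Longrightarrow> sum h J \<in> fspan S I v"
  by (induction J rule: infinite_finite_induct) (auto intro: fspan_zero fspan_add)

lemma fspan_least: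
  assumes "\<And>i. i \<in> I \<Longrightarrow> v i \<in> W" "0 \<in> W" "\<And>x y. x \<in> W \<Longrightarrow> y \<in> W \<Longrightarrow> x + y \<in> W"
    "\<And>s x. s \<in> S \<Longrightarrow> x \<in> W \<Longrightarrow> s * x \<in> W"
  shows "fspan S I v \<subseteq> W"
proof
  fix x assume "x \<in> fspan S I v"
  then obtain c where c: "\<And>i. c i \<in> S" "x = (\<Sum>i\<in>I. c i * v i)" by (elim fspanE) blast
  have "(\<Sum>i\<in>J. c i * v i) \<in> W" if "J \<subseteq> I" for J
    using that by (induction J rule: infinite_finite_induct) (auto intro!: assms c)
  then show "x \<in> W" using c by auto
qed

lemma fspan_subset:
  assumes "\<And>i. i \<in> I \<Longrightarrow> v i \<in> fspan S J w"
  shows "fspan S I v \<subseteq> fspan S J w"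
  by (rule fspan_least[OF assms fspan_zero fspan_add fspan_scale])

lemma fspan_mult:
  assumes "\<And>i j. i \<in> I \<Longrightarrow> j \<in> J \<Longrightarrow> v i * w j \<in> fspan S H u"
    and "x \<in> fspan S I v" "y \<in> fspan S J w"
  shows "x * y \<in> fspan S H u"
proof -
  obtain c where c: "\<And>i. c i \<in> S" "x = (\<Sum>i\<in>I. c i * v i)" using assms(2) by (elim fspanE) blast
  obtain d where d: "\<And>i. d i \<in> S" "y = (\<Sum>j\<in>J. d j * w j)" using assms(3) by (elim fspanE) blast
  have "x * y = (\<Sum>i\<in>I. \<Sum>j\<in>J. (c i * d j) * (v i * w j))"
    unfolding c(2) d(2) by (simp add: sum_product mult_ac)
  also have "\<dots> \<in> fspan S H u"
    by (intro fspan_sum fspan_scale mult_mem c d assms(1))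
  finally show ?thesis .
qed

lemma fspan_subring:
  assumes "\<And>i j. i \<in> I \<Longrightarrow> j \<in> I \<Longrightarrow> v i * v j \<in> fspan S I v" "1 \<in> fspan S I v"
  shows "field_subring (fspan S I v)"
  by (rule field_subringI) (use assms fspan_diff fspan_mult in blast)+

text \<open>A monic relation of degree n lets every power be rewritten in terms of the first n.\<close>

lemma power_in_fspan:
  assumes "x ^ n = (\<Sum>i<n. r i * x ^ i)" "\<And>i. r i \<in> S"
  shows "x ^ k \<in> fspan S {..<n} (\<lambda>i. x ^ i)"
proof (induction k rule: less_induct)
  case (less k)
  show ?case
  proof (cases "k < n")
    case True
    then show ?thesis by (intro fspan_base[of "{..<n}" k "\<lambda>i. x ^ i"]) auto
  next
    case False
    then have "x ^ k = x ^ (k - n) * x ^ n" by (simp flip: power_add)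
    also have "\<dots> = (\<Sum>i<n. r i * x ^ (k - n + i))"
      unfolding assms(1) by (simp add: sum_distrib_left power_add mult_ac)
    also have "\<dots> \<in> fspan S {..<n} (\<lambda>i. x ^ i)"
      using False by (intro fspan_sum fspan_scale assms less) auto
    finally show ?thesis .
  qed
qed

lemma monomial_in_fspan:
  assumes "x ^ n = (\<Sum>i<n. r i * x ^ i)" "\<And>i. r i \<in> S"
    and "y ^ m = (\<Sum>i<m. t i * y ^ i)" "\<And>i. t i \<in> S"
  shows "x ^ k * y ^ l \<in> fspan S ({..<n} \<times> {..<m}) (\<lambda>(i, j). x ^ i * y ^ j)"
proof (rule fspan_mult[OF _ power_in_fspan[OF assms(1,2)] power_in_fspan[OF assms(3,4)]])
  fix i j assume "i \<in> {..<n}" "j \<in> {..<m}"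
  then show "x ^ i * y ^ j \<in> fspan S ({..<n} \<times> {..<m}) (\<lambda>(i, j). x ^ i * y ^ j)"
    using fspan_base[of "{..<n} \<times> {..<m}" "(i, j)" "\<lambda>(i, j). x ^ i * y ^ j"] by auto
qed

lemma monomial_fspan_mult:
  assumes "x ^ n = (\<Sum>i<n. r i * x ^ i)" "\<And>i. r i \<in> S"
    and "y ^ m = (\<Sum>i<m. t i * y ^ i)" "\<And>i. t i \<in> S"
    and "u \<in> fspan S ({..<n} \<times> {..<m}) (\<lambda>(i, j). x ^ i * y ^ j)"
      "v \<in> fspan S ({..<n} \<times> {..<m}) (\<lambda>(i, j). x ^ i * y ^ j)"
  shows "u * v \<in> fspan S ({..<n} \<times> {..<m}) (\<lambda>(i, j). x ^ i * y ^ j)"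
proof (rule fspan_mult[OF _ assms(5,6)], clarify)
  fix i j k l
  have "(x ^ i * y ^ j) * (x ^ k * y ^ l) = x ^ (i + k) * y ^ (j + l)"
    by (simp add: power_add mult_ac)
  then show "(x ^ i * y ^ j) * (x ^ k * y ^ l) \<in> fspan S ({..<n} \<times> {..<m}) (\<lambda>(i, j). x ^ i * y ^ j)"
    using monomial_in_fspan[OF assms(1-4)] by simp
qed

lemma monomial_fspan_subring:
  assumes "x ^ n = (\<Sum>i<n. r i * x ^ i)" "\<And>i. r i \<in> S"
    and "y ^ m = (\<Sum>i<m. t i * y ^ i)" "\<And>i. t i \<in> S"
  shows "field_subring (fspan S ({..<n} \<times> {..<m}) (\<lambda>(i, j). x ^ i * y ^ j))"
  by (rule field_subringI)
    (use fspan_diff monomial_fspan_mult[OF assms] monomial_in_fspan[OF assms, of 0 0] in auto)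

end

section \<open>Integral elements\<close>

text \<open>
  Integrality over a subset of the ambient field, with the coefficients of the monic equation given
  by a function instead of a list.
\<close>

definition integral_elem :: "'k::field set \<Rightarrow> 'k \<Rightarrow> bool"
  where "integral_elem S x \<longleftrightarrow> (\<exists>n c. (\<forall>i. c i \<in> S) \<and> x ^ n = (\<Sum>i<n. c i * x ^ i))"

lemma monic_root_integral:
  fixes q :: "'k::field Polynomial.poly"
  assumes "field_subring S" "poly q z = 0" "lead_coeff q = 1" "\<And>i. coeff q i \<in> S"
  shows "integral_elem S z"
proof -
  interpret field_subring S by fact
  have "0 = (\<Sum>i\<le>degree q. coeff q i * z ^ i)" using assms(2) by (simp add: poly_altdef)
  also have "{..degree q} = insert (degree q) {..<degree q}" by auto
  also have "(\<Sum>i\<in>\<dots>. coeff q i * z ^ i) = z ^ degree q + (\<Sum>i<degree q. coeff q i * z ^ i)"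
    using assms(3) by simp
  finally have "z ^ degree q = (\<Sum>i<degree q. (- coeff q i) * z ^ i)"
    by (simp add: sum_negf eq_neg_iff_add_eq_0)
  then show ?thesis unfolding integral_elem_def using assms(4)
    by (intro exI[of _ "degree q"] exI[of _ "\<lambda>i. - coeff q i"]) auto
qed

context field_subring
begin

lemma coeff_mult_mem:
  "(\<And>i. coeff q i \<in> S) \<Longrightarrow> (\<And>i. coeff r i \<in> S) \<Longrightarrow> coeff (q * r) i \<in> S"
  by (auto simp: coeff_mult)

lemma coeff_det_mem:
  assumes "M \<in> carrier_mat n n" "\<And>i j k. i < n \<Longrightarrow> j < n \<Longrightarrow> coeff (M $$ (i, j)) k \<in> S"
  shows "coeff (Determinant.det M) k \<in> S"
proof -
  have prod: "coeff (prod h I) k \<in> S" if "\<And>i k. i \<in> I \<Longrightarrow> coeff (h i) k \<in> S"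
    for h :: "nat \<Rightarrow> 'k Polynomial.poly" and I k
    using that by (induction I arbitrary: k rule: infinite_finite_induct)
      (auto intro!: coeff_mult_mem simp: coeff_1)
  have "coeff (signof \<pi> * (\<Prod>i = 0..<n. M $$ (i, \<pi> i))) k \<in> S"
    if "\<pi> permutes {0..<n}" for \<pi>
  proof (intro coeff_mult_mem prod assms)
    show "coeff (signof \<pi> :: 'k Polynomial.poly) i \<in> S" for i
      by (auto simp: sign_def coeff_1)
  qed (use that permutes_in_image[OF that] in auto)
  then show ?thesis
    unfolding det_def'[OF assms(1)] by (auto simp: coeff_sum)
qed

text \<open>
  The determinant trick: z is an eigenvalue of the matrix that describes multiplication by z on
  the module spanned by the family, hence a root of its monic characteristic polynomial.
\<close>

lemma integral_if_stable_fspan: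
  assumes "finite I" "\<exists>i\<in>I. v i \<noteq> 0" and stable: "\<And>i. i \<in> I \<Longrightarrow> z * v i \<in> fspan S I v"
  shows "integral_elem S z"
proof -
  obtain e where e: "bij_betw e {..<card I} I"
    using \<open>finite I\<close> ex_bij_betw_nat_finite atLeast0LessThan by metis
  define n where "n = card I"
  have "\<forall>i. \<exists>c. i \<in> I \<longrightarrow> (\<forall>j. c j \<in> S) \<and> z * v i = (\<Sum>j\<in>I. c j * v j)"
    using stable by (metis fspanE)
  then obtain c where c: "\<And>i j. i \<in> I \<Longrightarrow> c i j \<in> S" "\<And>i. i \<in> I \<Longrightarrow> z * v i = (\<Sum>j\<in>I. c i j * v j)"
    by metis
  have eI: "e i \<in> I" if "i < n" for i
    using bij_betwE[OF e] that by (auto simp: n_def)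
  define M where "M = Matrix.mat n n (\<lambda>(i, j). c (e i) (e j))"
  have M: "M \<in> carrier_mat n n" by (simp add: M_def)
  define w where "w = Matrix.vec n (\<lambda>i. v (e i))"
  have "M *\<^sub>v w = z \<cdot>\<^sub>v w"
  proof (rule eq_vecI)
    fix i assume "i < dim_vec (z \<cdot>\<^sub>v w)"
    then have i: "i < n" by (simp add: w_def)
    have "(M *\<^sub>v w) $ i = (\<Sum>j = 0..<n. c (e i) (e j) * v (e j))"
      using i by (simp add: M_def w_def scalar_prod_def)
    also have "\<dots> = (\<Sum>j\<in>I. c (e i) j * v j)"
      using sum.reindex_bij_betw[OF e, of "\<lambda>j. c (e i) j * v j"]
      by (simp add: n_def atLeast0LessThan)
    also have "\<dots> = (z \<cdot>\<^sub>v w) $ i"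
      using i c(2)[OF eI[OF i]] by (simp add: w_def)
    finally show "(M *\<^sub>v w) $ i = (z \<cdot>\<^sub>v w) $ i" .
  qed (simp add: w_def M_def)
  moreover have "w \<noteq> 0\<^sub>v n"
  proof -
    obtain i where "i \<in> I" "v i \<noteq> 0" using assms(2) by blast
    then obtain k where "k < n" "e k = i" using e unfolding n_def bij_betw_def by (metis imageE lessThan_iff)
    then have "w $ k \<noteq> (0\<^sub>v n) $ k" using \<open>v i \<noteq> 0\<close> by (simp add: w_def)
    then show ?thesis by metis
  qed
  ultimately have "eigenvalue M z"
    unfolding eigenvalue_def eigenvector_def by (intro exI[of _ w]) (auto simp: w_def M_def)
  then have root: "poly (char_poly M) z = 0" using eigenvalue_root_char_poly[OF M] by simp
  have "coeff (char_poly M) k \<in> S" for k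
    unfolding char_poly_def
  proof (rule coeff_det_mem)
    show "char_poly_matrix M \<in> carrier_mat n n" using M by simp
    fix i j k assume "i < n" "j < n"
    then have "char_poly_matrix M $$ (i, j) = (if i = j then [:0, 1:] else 0) + [:- c (e i) (e j):]"
      by (simp add: char_poly_matrix_def M_def)
    then show "coeff (char_poly_matrix M $$ (i, j)) k \<in> S"
      using c(1)[OF eI] \<open>i < n\<close> by (auto simp: coeff_pCons split: nat.splits)
  qed
  moreover have "lead_coeff (char_poly M) = 1" using degree_monic_char_poly[OF M] by auto
  ultimately show ?thesis using monic_root_integral[OF field_subring_axioms root] by blast
qed

lemma integral_self: "x \<in> S \<Longrightarrow> integral_elem S x"
  unfolding integral_elem_def by (rule exI[of _ 1], rule exI[of _ "\<lambda>_. x"]) simp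

lemma integral_in_subring_fspan:
  assumes "finite I" "field_subring (fspan S I v)" "z \<in> fspan S I v"
  shows "integral_elem S z"
proof (rule integral_if_stable_fspan[OF assms(1)])
  interpret E: field_subring "fspan S I v" by fact
  show "\<exists>i\<in>I. v i \<noteq> 0"
  proof (rule ccontr)
    assume "\<not> (\<exists>i\<in>I. v i \<noteq> 0)"
    moreover obtain c where "1 = (\<Sum>i\<in>I. c i * v i)" using E.one_mem by (elim fspanE) blast
    ultimately show False by simp
  qed
  show "z * v i \<in> fspan S I v" if "i \<in> I" for i
    using fspan_base[OF assms(1) that, of v] assms(3) by blast
qed

text \<open>
  The products of powers of x and y below the degrees of their equations span a subring that is a
  finite module, and every element of such a ring is integral.
\<close>

lemma integral_add_mult:
  assumes "integral_elem S x" "integral_elem S y"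
  shows integral_add: "integral_elem S (x + y)" and integral_mult: "integral_elem S (x * y)"
proof -
  obtain n r where x: "\<And>i. r i \<in> S" "x ^ n = (\<Sum>i<n. r i * x ^ i)"
    using assms(1) unfolding integral_elem_def by blast
  obtain m t where y: "\<And>i. t i \<in> S" "y ^ m = (\<Sum>i<m. t i * y ^ i)"
    using assms(2) unfolding integral_elem_def by blast
  let ?E = "fspan S ({..<n} \<times> {..<m}) (\<lambda>(i, j). x ^ i * y ^ j)"
  note mono = monomial_in_fspan[OF x(2,1) y(2,1)]
  have sub: "field_subring ?E" by (rule monomial_fspan_subring[OF x(2,1) y(2,1)])
  have "x \<in> ?E" "y \<in> ?E" using mono[of 1 0] mono[of 0 1] by auto
  then have "x + y \<in> ?E" "x * y \<in> ?E"
    using field_subring.add_mem[OF sub] field_subring.mult_mem[OF sub] by auto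
  then show "integral_elem S (x + y)" "integral_elem S (x * y)"
    using integral_in_subring_fspan[OF _ sub] by auto
qed

lemma integral_diff: "integral_elem S x \<Longrightarrow> integral_elem S y \<Longrightarrow> integral_elem S (x - y)"
  using integral_add[OF _ integral_mult[OF integral_self[of "-1"]], of x y] by simp

lemma integral_power: "integral_elem S x \<Longrightarrow> integral_elem S (x ^ n)"
  by (induction n) (auto intro: integral_self integral_mult)

lemma integral_sum: "(\<And>i. i \<in> I \<Longrightarrow> integral_elem S (h i)) \<Longrightarrow> integral_elem S (sum h I)"
  by (induction I rule: infinite_finite_induct) (auto intro: integral_self integral_add)

end

section \<open>Integrally closed domains\<close>

lemma ambient_pow [simp]: "x [^]\<^bsub>(ambient :: 'k::field ring)\<^esub> (n::nat) = x ^ n"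
proof -
  interpret field "ambient :: 'k ring" by (rule ambient_field)
  show ?thesis by (induction n) (simp_all add: mult.commute)
qed

lemma ambient_eval:
  "ring.eval (ambient :: 'k::field ring) cs x = (\<Sum>i<length cs. rev cs ! i * x ^ i)"
proof -
  interpret field "ambient :: 'k ring" by (rule ambient_field)
  show ?thesis
    by (induction cs) (auto simp: nth_append intro!: sum.cong)
qed

lemma monic_list_sum:
  "(\<Sum>i<length (1 # cs). rev (1 # cs) ! i * x ^ i)
    = x ^ length cs + (\<Sum>i<length cs. rev cs ! i * (x :: 'k::field) ^ i)"
  by (auto simp: nth_append intro!: sum.cong)

lemma integral_over_iff:
  assumes "field_subring S"
  shows "integral_over ambient S x \<longleftrightarrow> integral_elem S x"
proof
  interpret field_subring S by fact
  assume "integral_over ambient S x"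
  then obtain q where q: "q \<in> carrier (univ_poly ambient S)" "q \<noteq> []" "hd q = 1"
    "ring.eval ambient q x = 0"
    unfolding integral_over_def by auto
  then obtain cs where cs: "q = 1 # cs" by (cases q) auto
  have "set cs \<subseteq> S" using q(1) cs unfolding univ_poly_carrier[symmetric] polynomial_def by auto
  then have mem: "i < length cs \<Longrightarrow> rev cs ! i \<in> S" for i using nth_mem[of i "rev cs"] by auto
  have "x ^ length cs + (\<Sum>i<length cs. rev cs ! i * x ^ i) = 0"
    using q(4) unfolding ambient_eval cs monic_list_sum .
  then have "x ^ length cs = (\<Sum>i<length cs. (if i < length cs then - (rev cs ! i) else 0) * x ^ i)"
    by (simp add: sum_negf eq_neg_iff_add_eq_0)
  then show "integral_elem S x" unfolding integral_elem_def using mem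
    by (intro exI[of _ "length cs"] exI[of _ "\<lambda>i. if i < length cs then - (rev cs ! i) else 0"]) auto
next
  interpret field_subring S by fact
  assume "integral_elem S x"
  then obtain n c where c: "\<And>i. c i \<in> S" "x ^ n = (\<Sum>i<n. c i * x ^ i)"
    unfolding integral_elem_def by blast
  define cs where "cs = rev (map (\<lambda>i. - c i) [0..<n])"
  have "ring.eval ambient (1 # cs) x = x ^ n + (\<Sum>i<n. - c i * x ^ i)"
    unfolding ambient_eval monic_list_sum by (simp add: cs_def)
  also have "\<dots> = 0" by (simp add: sum_negf c(2))
  finally have "ring.eval ambient (1 # cs) x = 0" .
  moreover have "1 # cs \<in> carrier (univ_poly ambient S)"
    unfolding univ_poly_carrier[symmetric] polynomial_def by (auto simp: cs_def c)
  ultimately show "integral_over ambient S x"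
    unfolding integral_over_def by (intro bexI[of _ "1 # cs"]) auto
qed

lemma ring_on_simps [simp]:
  "carrier (ring_on (S :: 'k::field set)) = S"
  "x \<otimes>\<^bsub>ring_on S\<^esub> y = x * y"
  "x \<oplus>\<^bsub>ring_on S\<^esub> y = x + y"
  "\<one>\<^bsub>ring_on S\<^esub> = 1"
  "\<zero>\<^bsub>ring_on S\<^esub> = 0"
  by (simp_all add: ring_of_type_algebra_def)

context domain
begin

lemma fraction_class_pow:
  assumes "a \<in> carrier R" "b \<in> carrier R - {\<zero>}"
  shows "fraction_class R a b [^]\<^bsub>fraction_field R\<^esub> (n::nat) = fraction_class R (a [^] n) (b [^] n)
    \<and> b [^] n \<in> carrier R - {\<zero>}"
proof (induction n)
  case (Suc n)
  then show ?case
    using assms nonzero_mult[of "b [^] n" b] by (simp add: frac_mult)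
qed (simp add: fraction_field_one)

end

text \<open>
  Clearing denominators identifies evaluation at a class of the abstract fraction field with
  evaluation at the corresponding quotient in the ambient field.
\<close>

lemma fraction_class_eval:
  fixes D :: "'k::field set"
  assumes "domain (ring_on D)" "u \<in> D" "v \<in> D" "v \<noteq> 0" "set cs \<subseteq> D"
  shows "\<exists>N\<in>D. ring.eval (fraction_field (ring_on D))
        (map (\<lambda>a. fraction_class (ring_on D) a 1) cs) (fraction_class (ring_on D) u v)
      = fraction_class (ring_on D) N (v ^ length cs)
    \<and> N / v ^ length cs = ring.eval ambient cs (u / v)"
  using assms(5)
proof (induction cs)
  interpret D: domain "ring_on D" by fact
  interpret F: field "fraction_field (ring_on D)" by (rule D.field_fraction_field)
  interpret A: field "ambient :: 'k ring" by (rule ambient_field)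
  note cl = D.m_closed[simplified] D.a_closed[simplified] D.one_closed[simplified] D.zero_closed[simplified]
  have pow: "x ^ n \<in> D" if "x \<in> D" for x and n :: nat
    by (induction n) (use cl that in auto)
  have ppow: "x [^]\<^bsub>ring_on D\<^esub> (n::nat) = x ^ n" for x n
    by (induction n) (auto simp: mult.commute)
  {
    case Nil
    then show ?case using cl by (intro bexI[of _ 0]) (auto simp: D.fraction_field_zero)
  next
    case (Cons a cs)
    let ?c = "fraction_class (ring_on D)"
    obtain N where N: "N \<in> D" "F.eval (map (\<lambda>a. ?c a 1) cs) (?c u v) = ?c N (v ^ length cs)"
      "N / v ^ length cs = A.eval cs (u / v)"
      using Cons by auto
    let ?n = "length cs"
    have p: "?c u v [^]\<^bsub>fraction_field (ring_on D)\<^esub> ?n = ?c (u ^ ?n) (v ^ ?n)"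
      using D.fraction_class_pow[of u v ?n] assms by (simp add: ppow)
    have "F.eval (map (\<lambda>a. ?c a 1) (a # cs)) (?c u v)
        = ?c (a * u ^ ?n * v ^ ?n + N * v ^ ?n) (v ^ ?n * v ^ ?n)"
      using Cons.prems N p assms pow[of u ?n] pow[of v ?n] cl
      by (simp add: D.frac_mult D.frac_add)
    also have "\<dots> = ?c ((a * u ^ ?n + N) * v) (v ^ length (a # cs))"
      using Cons.prems N assms pow[of u ?n] pow[of v ?n] pow[of v "Suc ?n"] cl
      by (subst D.frac_eq_iff) (auto simp: algebra_simps)
    finally have *: "F.eval (map (\<lambda>a. ?c a 1) (a # cs)) (?c u v)
        = ?c ((a * u ^ ?n + N) * v) (v ^ length (a # cs))" .
    have "(a * u ^ ?n + N) * v / v ^ length (a # cs) = A.eval (a # cs) (u / v)"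
      using N(3)[symmetric] assms by (simp add: power_divide add_divide_distrib)
    moreover have "(a * u ^ ?n + N) * v \<in> D"
      using Cons.prems N assms pow[of u ?n] cl by auto
    ultimately show ?case using * by blast
  }
qed

lemma integrally_closed_domainD:
  fixes D :: "'k::field set"
  assumes sub: "field_subring D" and closed: "integrally_closed_domain (ring_on D)"
    and uv: "u \<in> D" "v \<in> D" "v \<noteq> 0" and int: "integral_elem D (u / v)"
  shows "u / v \<in> D"
proof -
  interpret field_subring D by fact
  interpret D: domain "ring_on D" using closed by (simp add: integrally_closed_domain_def)
  interpret F: field "fraction_field (ring_on D)" by (rule D.field_fraction_field)
  let ?c = "fraction_class (ring_on D)" and ?F = "fraction_field (ring_on D)"
  obtain q where q: "q \<in> carrier (univ_poly ambient D)" "q \<noteq> []" "hd q = 1"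
    "ring.eval ambient q (u / v) = 0"
    using int unfolding integral_over_iff[OF sub, symmetric] integral_over_def by auto
  have qD: "set q \<subseteq> D" using q(1) unfolding univ_poly_carrier[symmetric] polynomial_def by auto
  obtain N where N: "N \<in> D" "F.eval (map (\<lambda>a. ?c a 1) q) (?c u v) = ?c N (v ^ length q)"
    "N / v ^ length q = 0"
    using fraction_class_eval[OF D.domain_axioms uv qD] q(4) by auto
  have "N = 0" using N(3) uv by auto
  then have ev: "F.eval (map (\<lambda>a. ?c a 1) q) (?c u v) = \<zero>\<^bsub>?F\<^esub>"
    using N(2) uv power_mem[of v "length q"]
    by (simp add: D.fraction_field_zero D.frac_eq_iff)
  have one: "?c 1 1 = \<one>\<^bsub>?F\<^esub>" by (simp add: D.fraction_field_one)
  have "map (\<lambda>a. ?c a 1) q \<in> carrier (univ_poly ?F ((\<lambda>a. ?c a 1) ` D))"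
    unfolding univ_poly_carrier[symmetric] polynomial_def
    using qD q(2,3) one by (auto simp: hd_map)
  then have "integral_over ?F ((\<lambda>a. ?c a 1) ` D) (?c u v)"
    unfolding integral_over_def using q(2,3) ev one by (intro bexI) (auto simp: hd_map)
  moreover have "?c u v \<in> carrier ?F" using uv by (intro D.frac_closed) auto
  ultimately have "?c u v \<in> (\<lambda>a. ?c a 1) ` D"
    using closed unfolding integrally_closed_domain_def by auto
  then obtain a where "a \<in> D" "?c u v = ?c a 1" by auto
  then show ?thesis using uv D.frac_eq_iff[of u v a 1] by (auto simp: field_simps)
qed

section \<open>Prime ideals and height one\<close>

context field_subring
begin

lemma cring_ring_on: "cring (ring_on S)"
proof (rule cringI)
  show "abelian_group (ring_on S)"
    by (rule abelian_groupI) (auto simp: algebra_simps intro!: bexI[of _ "- _"])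
  show "Group.comm_monoid (ring_on S)"
    by (rule comm_monoidI) (auto simp: algebra_simps)
qed (auto simp: algebra_simps)

lemma ideal_ring_on_iff:
  "ideal I (ring_on S) \<longleftrightarrow> I \<subseteq> S \<and> 0 \<in> I \<and> (\<forall>x\<in>I. \<forall>y\<in>I. x + y \<in> I) \<and> (\<forall>s\<in>S. \<forall>x\<in>I. s * x \<in> I)"
proof
  assume "ideal I (ring_on S)"
  then interpret I: ideal I "ring_on S" .
  show "I \<subseteq> S \<and> 0 \<in> I \<and> (\<forall>x\<in>I. \<forall>y\<in>I. x + y \<in> I) \<and> (\<forall>s\<in>S. \<forall>x\<in>I. s * x \<in> I)"
    using I.Icarr I.additive_subgroup_axioms additive_subgroup.zero_closed[of I "ring_on S"]
      additive_subgroup.a_closed[of I "ring_on S"] I.I_l_closed by auto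
next
  interpret R: cring "ring_on S" by (rule cring_ring_on)
  assume I: "I \<subseteq> S \<and> 0 \<in> I \<and> (\<forall>x\<in>I. \<forall>y\<in>I. x + y \<in> I) \<and> (\<forall>s\<in>S. \<forall>x\<in>I. s * x \<in> I)"
  have neg: "\<ominus>\<^bsub>ring_on S\<^esub> x = - x" if "x \<in> S" for x
    using R.minus_equality[of "- x" x] that by simp
  show "ideal I (ring_on S)"
  proof (rule idealI)
    show "subgroup I (add_monoid (ring_on S))"
    proof (rule R.add.subgroupI)
      fix a assume a: "a \<in> I"
      have "(-1) * a \<in> I" using I a by (metis uminus_mem one_mem)
      then show "\<ominus>\<^bsub>ring_on S\<^esub> a \<in> I" using neg a I by auto
    qed (use I in auto)
    fix a x assume "a \<in> I" "x \<in> carrier (ring_on S)"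
    then have "x * a \<in> I" using I by simp
    then show "x \<otimes>\<^bsub>ring_on S\<^esub> a \<in> I" "a \<otimes>\<^bsub>ring_on S\<^esub> x \<in> I" by (simp_all add: mult.commute)
  qed (use R.ring_axioms in auto)
qed

definition prime_in :: "'k set \<Rightarrow> bool"
  where "prime_in Q \<longleftrightarrow> Q \<subseteq> S \<and> 0 \<in> Q \<and> (\<forall>x\<in>Q. \<forall>y\<in>Q. x + y \<in> Q) \<and> (\<forall>s\<in>S. \<forall>x\<in>Q. s * x \<in> Q)
    \<and> 1 \<notin> Q \<and> (\<forall>x\<in>S. \<forall>y\<in>S. x * y \<in> Q \<longrightarrow> x \<in> Q \<or> y \<in> Q)"

lemma primeideal_iff: "primeideal Q (ring_on S) \<longleftrightarrow> prime_in Q"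
proof
  assume "primeideal Q (ring_on S)"
  then interpret Q: primeideal Q "ring_on S" .
  show "prime_in Q"
    using Q.ideal_axioms Q.I_prime Q.I_notcarr
    unfolding prime_in_def ideal_ring_on_iff by (metis mult.right_neutral ring_on_simps(1,2) subset_antisym subsetI)
next
  assume Q: "prime_in Q"
  show "primeideal Q (ring_on S)"
    by (rule primeidealI) (use Q cring_ring_on in \<open>auto simp: prime_in_def ideal_ring_on_iff\<close>)
qed

lemma prime_inD:
  assumes "prime_in Q"
  shows "x \<in> Q \<Longrightarrow> x \<in> S" "0 \<in> Q" "x \<in> Q \<Longrightarrow> y \<in> Q \<Longrightarrow> x + y \<in> Q"
    "s \<in> S \<Longrightarrow> x \<in> Q \<Longrightarrow> s * x \<in> Q" "s \<in> S \<Longrightarrow> x \<in> Q \<Longrightarrow> x * s \<in> Q" "1 \<notin> Q"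
    "x \<in> S \<Longrightarrow> y \<in> S \<Longrightarrow> x * y \<in> Q \<Longrightarrow> x \<in> Q \<or> y \<in> Q"
  using assms unfolding prime_in_def by (auto simp: mult.commute)

lemma prime_in_power: "prime_in Q \<Longrightarrow> x \<in> S \<Longrightarrow> x ^ n \<in> Q \<Longrightarrow> x \<in> Q"
  by (induction n) (auto dest: prime_inD(6,7))

lemma prime_in_zero: "prime_in {0}"
  by (auto simp: prime_in_def)

text \<open>
  In a domain the zero ideal is a prime, so that height one means being minimal among the nonzero
  primes.
\<close>

lemma height_one_primeI:
  assumes "prime_in Q" "Q \<noteq> {0}" "\<And>Q'. prime_in Q' \<Longrightarrow> Q' \<noteq> {0} \<Longrightarrow> Q' \<subseteq> Q \<Longrightarrow> Q' = Q"
  shows "height_one_prime (ring_on S) Q"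
proof -
  let ?N = "{enat n | n. \<exists>C. prime_chain (ring_on S) n C \<and> C n = Q}"
  have "prime_chain (ring_on S) 1 (\<lambda>i. if i = 0 then {0} else Q)"
    using assms(1,2) prime_in_zero prime_inD(2)[OF assms(1)]
    by (auto simp: prime_chain_def primeideal_iff)
  then have "\<exists>C. prime_chain (ring_on S) 1 C \<and> C 1 = Q"
    by (intro exI[of _ "\<lambda>i. if i = 0 then {0} else Q"]) auto
  then have 1: "1 \<in> ?N" unfolding one_enat_def by blast
  have le: "n \<le> 1" if C: "prime_chain (ring_on S) n C" "C n = Q" for n C
  proof (rule ccontr)
    assume "\<not> n \<le> 1"
    then obtain k where k: "n = Suc (Suc k)" by (metis One_nat_def Suc_leI le_SucE not0_implies_Suc not_less_eq_eq zero_less_Suc)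
    have ch: "prime_in (C k)" "prime_in (C (Suc k))" "C k \<subset> C (Suc k)" "C (Suc k) \<subset> Q"
      using C unfolding prime_chain_def primeideal_iff k by auto
    have "C (Suc k) \<noteq> {0}" using ch(3) prime_inD(2)[OF ch(1)] by auto
    then show False using assms(3)[OF ch(2)] ch(4) by auto
  qed
  have "Sup ?N = 1"
  proof (rule antisym)
    show "Sup ?N \<le> 1" by (rule Sup_least) (auto simp: one_enat_def dest: le)
    show "1 \<le> Sup ?N" by (rule Sup_upper[OF 1])
  qed
  then show ?thesis using assms(1) by (simp add: height_one_prime_def height_def primeideal_iff)
qed

lemma height_one_primeD:
  assumes "height_one_prime (ring_on S) Q"
  shows "prime_in Q" "prime_in Q' \<Longrightarrow> Q' \<noteq> {0} \<Longrightarrow> Q' \<subseteq> Q \<Longrightarrow> Q' = Q"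
proof -
  show Q: "prime_in Q" using assms by (simp add: height_one_prime_def primeideal_iff)
  assume Q': "prime_in Q'" "Q' \<noteq> {0}" "Q' \<subseteq> Q"
  show "Q' = Q"
  proof (rule ccontr)
    assume "Q' \<noteq> Q"
    then have "prime_chain (ring_on S) 2 (\<lambda>i. if i = 0 then {0} else if i = 1 then Q' else Q)"
      using Q Q' prime_in_zero prime_inD(2)[OF Q'(1)]
      by (auto simp: prime_chain_def primeideal_iff)
    then have "\<exists>C. prime_chain (ring_on S) 2 C \<and> C 2 = Q"
      by (intro exI[of _ "\<lambda>i. if i = 0 then {0} else if i = 1 then Q' else Q"]) auto
    then have "enat 2 \<le> height (ring_on S) Q" unfolding height_def by (intro Sup_upper) blast
    then show False using assms by (simp add: height_one_prime_def one_enat_def)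
  qed
qed

end

lemma (in field_subring) height_one_prime_no_units:
  assumes "height_one_prime (ring_on S) Q" "x \<in> Q"
  shows "x \<notin> Units (ring_on S)"
proof
  note D = prime_inD[OF height_one_primeD(1)[OF assms(1)]]
  assume "x \<in> Units (ring_on S)"
  then obtain y where "y \<in> S" "y * x = 1" unfolding Units_def by auto
  then show False using D(4)[OF _ assms(2), of y] D(6) by simp
qed

section \<open>Noetherian normal domains\<close>

locale normal_noetherian_subring = field_subring +
  assumes noetherian: "noetherian_domain (ring_on S)"
    and normal: "integrally_closed_domain (ring_on S)"
begin

lemma finitely_generated:
  assumes "ideal I (ring_on S)"
  obtains G where "finite G" "I = fspan S G (\<lambda>x. x)"
proof -
  interpret N: noetherian_domain "ring_on S" by (rule noetherian)
  obtain G where G: "G \<subseteq> S" "finite G" "I = Idl\<^bsub>ring_on S\<^esub> G"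
    using N.finetely_gen[OF assms] by auto
  have "fspan S G (\<lambda>x. x) \<subseteq> S"
    by (rule fspan_least) (use G(1) in auto)
  then have "ideal (fspan S G (\<lambda>x. x)) (ring_on S)"
    unfolding ideal_ring_on_iff by (auto intro: fspan_zero fspan_add fspan_scale)
  moreover have "G \<subseteq> fspan S G (\<lambda>x. x)" using fspan_base[OF G(2), of _ "\<lambda>x. x"] by auto
  ultimately have 1: "I \<subseteq> fspan S G (\<lambda>x. x)" unfolding G(3) genideal_def by blast
  have "G \<subseteq> I" unfolding G(3) genideal_def by blast
  then have "fspan S G (\<lambda>x. x) \<subseteq> I"
    using assms unfolding ideal_ring_on_iff by (intro fspan_least) auto
  with 1 G(2) that show thesis by blast
qed

lemma maximal_ideal_in_family:
  assumes "F \<noteq> {}" "\<And>I. I \<in> F \<Longrightarrow> ideal I (ring_on S)"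
  obtains I where "I \<in> F" "\<And>J. J \<in> F \<Longrightarrow> I \<subseteq> J \<Longrightarrow> J = I"
proof -
  interpret N: noetherian_domain "ring_on S" by (rule noetherian)
  have "\<exists>M\<in>F. \<forall>J\<in>F. M \<subseteq> J \<longrightarrow> J = M"
  proof (rule subset_Zorn_nonempty[OF assms(1)])
    fix C assume C: "C \<noteq> {}" "subset.chain F C"
    then have "subset.chain {I. ideal I (ring_on S)} C"
      using assms(2) by (auto simp: subset_chain_def)
    then have "\<Union>C \<in> C" by (rule N.ideal_chain_is_trivial[OF C(1)])
    moreover have "C \<subseteq> F" using C(2) unfolding subset_chain_def by (rule conjunct1)
    ultimately show "\<Union>C \<in> F" by (rule rev_subsetD)
  qed
  then obtain M where "M \<in> F" "\<forall>J\<in>F. M \<subseteq> J \<longrightarrow> J = M" by (rule bexE)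
  then show thesis by (intro that[of M]) simp_all
qed

text \<open>A nonzero ideal of a Noetherian ring is a finite faithful module.\<close>

lemma stable_ideal_integral:
  assumes "ideal I (ring_on S)" "I \<noteq> {0}" "\<And>x. x \<in> I \<Longrightarrow> c * x \<in> I"
  shows "integral_elem S c"
proof -
  obtain G where G: "finite G" "I = fspan S G (\<lambda>x. x)"
    using finitely_generated[OF assms(1)] .
  have "0 \<in> I" using assms(1) by (simp add: ideal_ring_on_iff)
  then obtain x where "x \<in> I" "x \<noteq> 0" using assms(2) by blast
  then have "\<exists>i\<in>G. i \<noteq> 0" unfolding G(2) by (elim fspanE) (metis mult_zero_right sum.neutral)
  then show ?thesis
    using integral_if_stable_fspan[OF G(1), of "\<lambda>x. x" c] assms(3) fspan_base[OF G(1), of _ "\<lambda>x. x"]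
    unfolding G(2) by blast
qed

lemma integral_quotient: "c \<in> quotients S \<Longrightarrow> integral_elem S c \<Longrightarrow> c \<in> S"
  unfolding quotients_def using integrally_closed_domainD[OF field_subring_axioms normal] by blast

lemma prime_in_ideal: "prime_in Q \<Longrightarrow> ideal Q (ring_on S)"
  by (simp add: prime_in_def ideal_ring_on_iff)

text \<open>
  The ideals of denominators of the multiples of c outside S have a maximal member, which is
  prime. It cannot be stable under multiplication by the corresponding multiple of c, and the
  same holds for every nonzero prime below it; this is what makes it a prime of height one.
\<close>

lemma height_one_denominator:
  assumes "c \<in> quotients S" "c \<notin> S"
  obtains s Q t where "s \<in> S" "height_one_prime (ring_on S) Q" "t \<in> Q" "t * (s * c) \<in> S" "t * (s * c) \<notin> Q"
proof -
  define den where "den c' = {x \<in> S. x * c' \<in> S}" for c'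
  have den_ideal: "ideal (den c') (ring_on S)" for c'
    unfolding ideal_ring_on_iff den_def by (auto simp: distrib_right mult.assoc)
  define F where "F = {den (s * c) | s. s \<in> S \<and> s * c \<notin> S}"
  have "den (1 * c) \<in> F" unfolding F_def using assms(2) by force
  then have "F \<noteq> {}" by blast
  moreover have "ideal I (ring_on S)" if "I \<in> F" for I using that den_ideal by (auto simp: F_def)
  ultimately obtain Q where Q: "Q \<in> F" "\<And>J. J \<in> F \<Longrightarrow> Q \<subseteq> J \<Longrightarrow> J = Q"
    by (rule maximal_ideal_in_family) blast+
  then obtain s where s: "s \<in> S" "s * c \<notin> S" "Q = den (s * c)" unfolding F_def by blast
  define e where "e = s * c"
  have e: "e \<notin> S" "Q = den e" using s by (simp_all add: e_def)
  obtain a b where ab: "a \<in> S" "b \<in> S" "b \<noteq> 0" "c = a / b" using assms(1) by (auto simp: quotients_def)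
  have "e = s * a / b" "s * a \<in> S" using ab s(1) by (auto simp: e_def)
  then have eq: "e \<in> quotients S" unfolding quotients_def using ab(2,3)
    by (intro CollectI exI[of _ "s * a"] exI[of _ b]) simp
  have bQ: "b \<in> Q" using ab s unfolding e(2) den_def e_def by auto
  have prime: "prime_in Q"
    unfolding prime_in_def
  proof (intro conjI ballI impI)
    show "1 \<notin> Q" using e unfolding den_def by auto
    fix x y assume xy: "x \<in> S" "y \<in> S" "x * y \<in> Q"
    show "x \<in> Q \<or> y \<in> Q"
    proof (rule ccontr)
      assume n: "\<not> (x \<in> Q \<or> y \<in> Q)"
      then have ye: "y * e \<notin> S" using xy(2) unfolding e(2) den_def by auto
      then have "den (y * s * c) \<in> F" unfolding F_def e_def using xy(2) s(1)
        by (intro CollectI exI[of _ "y * s"]) (auto simp: mult.assoc)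
      moreover have "Q \<subseteq> den (y * s * c)"
        using xy(2) unfolding e(2) den_def e_def by (auto simp: mult_ac) (metis mult.assoc mult.left_commute mult_mem)
      ultimately have "den (y * s * c) = Q" by (rule Q(2))
      moreover have "x \<in> den (y * s * c)"
        using xy unfolding e(2) den_def e_def by (auto simp: mult_ac)
      ultimately show False using n by blast
    qed
  qed (use den_ideal[of e] in \<open>auto simp: ideal_ring_on_iff e(2)\<close>)
  have unstable: "\<exists>x\<in>Q'. x * e \<notin> Q'" if "prime_in Q'" "Q' \<noteq> {0}" for Q'
    using stable_ideal_integral[OF prime_in_ideal[OF that(1)] that(2), of e]
      integral_quotient[OF eq] e(1) by (metis mult.commute)
  have Qne: "Q \<noteq> {0}" using bQ ab(3) by auto
  obtain t where t: "t \<in> Q" "t * e \<notin> Q" using unstable[OF prime Qne] by blast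
  have QS: "x * e \<in> S" "x \<in> S" if "x \<in> Q" for x using that unfolding e(2) den_def by auto
  have "height_one_prime (ring_on S) Q"
  proof (rule height_one_primeI[OF prime Qne])
    fix Q' assume Q': "prime_in Q'" "Q' \<noteq> {0}" "Q' \<subseteq> Q"
    have "t \<in> Q'"
    proof (rule ccontr)
      assume tn: "t \<notin> Q'"
      obtain x where x: "x \<in> Q'" "x * e \<notin> Q'" using unstable[OF Q'(1,2)] by blast
      have "(t * e) * x \<in> Q'" using prime_inD(4)[OF Q'(1) QS(1)[OF t(1)] x(1)] .
      then have "t * (x * e) \<in> Q'" by (simp add: mult_ac)
      then show False
        using prime_inD(7)[OF Q'(1) QS(2)[OF t(1)], of "x * e"] QS(1)[of x] x Q'(3) tn by blast
    qed
    show "Q' = Q"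
    proof (rule antisym[OF Q'(3)], rule subsetI)
      fix x assume x: "x \<in> Q"
      have "(x * e) * t \<in> Q'" using prime_inD(4)[OF Q'(1) QS(1)[OF x] \<open>t \<in> Q'\<close>] .
      then have "(t * e) * x \<in> Q'" by (simp add: mult_ac)
      then show "x \<in> Q'"
        using prime_inD(7)[OF Q'(1) QS(1)[OF t(1)] QS(2)[OF x]] t(2) Q'(3) by blast
    qed
  qed
  then show thesis using that[OF s(1) _ t(1)] t(2) QS[OF t(1)] unfolding e_def by blast
qed

end

lemma square_freeD:
  assumes "square_free S c" "height_one_prime (ring_on S) Q" "c \<in> Q" "t \<in> Q" "field_subring S"
  obtains r s where "r \<in> S" "s \<in> S - Q" "t * s = c * r"
proof -
  interpret field_subring S by fact
  have Q: "prime_in Q" using height_one_primeD(1)[OF assms(2)] .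
  let ?L = "localization_at S Q"
  have eq: "genideal (ring_on ?L) Q = cgenideal (ring_on ?L) c"
    using assms unfolding square_free_def by blast
  have "t \<in> genideal (ring_on ?L) Q" using assms(4) by (auto simp: genideal_def)
  then obtain y where y: "y \<in> ?L" "t = y * c" unfolding eq by (auto simp: cgenideal_def)
  then obtain r s where rs: "r \<in> S" "s \<in> S - Q" "y = r / s" by (auto simp: localization_at_def)
  have "s \<noteq> 0" using rs(2) prime_inD(2)[OF Q] by auto
  then have "t * s = c * r" using y rs by simp
  then show thesis using that rs by blast
qed

text \<open>
  At a height one prime the square-free elements f and g have valuation at most one, and not both
  of them one. A denominator of c would contribute at least p to the valuation of the denominator
  of the p-th power of c.
\<close>

lemma (in normal_noetherian_subring) mem_of_radical_multiple_mem:
  assumes c: "c \<in> quotients S"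
    and f: "f \<in> S" "\<And>Q. height_one_prime (ring_on S) Q \<Longrightarrow> f \<in> Q \<Longrightarrow> square_free S f"
    and g: "g \<in> S" "\<And>Q. height_one_prime (ring_on S) Q \<Longrightarrow> g \<in> Q \<Longrightarrow> square_free S g"
    and no_common: "\<nexists>Q. height_one_prime (ring_on S) Q \<and> f \<in> Q \<and> g \<in> Q"
    and ij: "i < p" "j < p" and mem: "c ^ p * f ^ i * g ^ j \<in> S"
  shows "c \<in> S"
proof (rule ccontr)
  assume "c \<notin> S"
  then obtain s Q t where Q: "s \<in> S" "height_one_prime (ring_on S) Q" "t \<in> Q"
    "t * (s * c) \<in> S" "t * (s * c) \<notin> Q"
    using height_one_denominator[OF c] by metis
  note P = height_one_primeD(1)[OF Q(2)]
  note D = prime_inD[OF P]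
  define w where "w = t * (s * c)"
  define k where "k = c ^ p * f ^ i * g ^ j"
  have w: "w \<in> S" "w \<notin> Q" using Q by (simp_all add: w_def)
  have eq: "w ^ p * f ^ i * g ^ j = t ^ p * (s ^ p * k)"
    by (simp add: w_def k_def power_mult_distrib mult_ac)
  have kS: "s ^ p * k \<in> S" using mem Q(1) by (auto simp: k_def)
  have tS: "t \<in> S" using D(1) Q(3) .
  \<comment> \<open>The element of the prime is f or g; the other one, h', is a unit at Q.\<close>
  have aux: False if h: "h \<in> S" "h \<in> Q" "square_free S h" and h': "h' \<in> S" "h' \<notin> Q" and l: "l < p"
    and e: "w ^ p * h ^ l * h' ^ m = t ^ p * (s ^ p * k)" for h h' l m
  proof -
    obtain r u where ru: "r \<in> S" "u \<in> S - Q" "t * u = h * r"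
      using square_freeD[OF h(3) Q(2) h(2) Q(3) field_subring_axioms] by metis
    have hp: "h ^ (p - l) = h * h ^ (p - l - 1)" using l by (cases "p - l") auto
    have h0: "h \<noteq> 0"
    proof
      assume "h = 0"
      then have "t * u = 0" using ru by simp
      then have "t = 0" using ru(2) D(2) by auto
      then have "w = 0" by (simp add: w_def)
      then show False using w(2) D(2) by simp
    qed
    have "(w * u) ^ p * h' ^ m * h ^ l = u ^ p * (w ^ p * h ^ l * h' ^ m)"
      by (simp add: power_mult_distrib mult_ac)
    also have "\<dots> = (t * u) ^ p * (s ^ p * k)"
      unfolding e by (simp add: power_mult_distrib mult_ac)
    also have "\<dots> = h ^ p * r ^ p * (s ^ p * k)" unfolding ru(3) by (simp add: power_mult_distrib)
    also have "h ^ p = h ^ (p - l) * h ^ l" using l by (simp flip: power_add)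
    finally have "(w * u) ^ p * h' ^ m = h ^ (p - l) * (r ^ p * (s ^ p * k))"
      using h0 by (simp add: mult_ac)
    also have "h ^ (p - l) = h * h ^ (p - l - 1)" by (rule hp)
    also have "h * h ^ (p - l - 1) * (r ^ p * (s ^ p * k)) = (h ^ (p - l - 1) * (r ^ p * (s ^ p * k))) * h"
      by (simp add: mult_ac)
    also have "\<dots> \<in> Q" by (intro D(4)[OF _ h(2)] mult_mem power_mem h(1) ru(1) kS)
    finally have "(w * u) ^ p * h' ^ m \<in> Q" .
    moreover have uS: "u \<in> S" "u \<notin> Q" using ru(2) by auto
    moreover note wu = mult_mem[OF w(1) uS(1)]
    ultimately have "(w * u) ^ p \<in> Q \<or> h' ^ m \<in> Q"
      using D(7)[OF power_mem[OF wu] power_mem[OF h'(1)]] by simp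
    then have "w * u \<in> Q" using prime_in_power[OF P wu] prime_in_power[OF P h'(1)] h'(2) by auto
    then show False using D(7)[OF w(1) uS(1)] w(2) uS(2) by simp
  qed
  consider "f \<in> Q" "g \<notin> Q" | "f \<notin> Q" "g \<in> Q" | "f \<notin> Q" "g \<notin> Q"
    using no_common Q(2) by blast
  then show False
  proof cases
    case 1
    then show False using aux[OF f(1) _ f(2)[OF Q(2)] g(1) _ ij(1) eq] by blast
  next
    case 2
    have "w ^ p * g ^ j * f ^ i = t ^ p * (s ^ p * k)" using eq by (simp add: mult_ac)
    then show False using aux[OF g(1) _ g(2)[OF Q(2)] f(1) _ ij(2)] 2 by blast
  next
    case 3
    have "p \<noteq> 0" using ij by simp
    then have "t ^ p * (s ^ p * k) = (t ^ (p - 1) * (s ^ p * k)) * t"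
      by (cases p) (simp_all add: mult_ac)
    also have "\<dots> \<in> Q" by (intro D(4)[OF _ Q(3)] mult_mem power_mem tS kS)
    finally have "w ^ p * f ^ i * g ^ j \<in> Q" using eq by simp
    note pw = power_mem[OF w(1)] power_mem[OF f(1)] power_mem[OF g(1)]
    then have "w ^ p \<in> Q \<or> f ^ i \<in> Q \<or> g ^ j \<in> Q"
      using D(7)[OF mult_mem[OF pw(1,2)] pw(3)] D(7)[OF pw(1,2)] \<open>w ^ p * f ^ i * g ^ j \<in> Q\<close> by blast
    then show False
      using prime_in_power[OF P w(1)] prime_in_power[OF P f(1)] prime_in_power[OF P g(1)] w(2) 3 by blast
  qed
qed

section \<open>Subfields and bases\<close>

lemma ambient_inv: "x \<noteq> 0 \<Longrightarrow> inv\<^bsub>(ambient :: 'k::field ring)\<^esub> x = inverse x"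
proof -
  interpret field "ambient :: 'k ring" by (rule ambient_field)
  assume "x \<noteq> 0"
  then show ?thesis using comm_inv_char[of x "inverse x"] by simp
qed

locale field_subfield = field_subring L for L :: "'k::field set" +
  assumes inverse_mem: "x \<in> L \<Longrightarrow> inverse x \<in> L"
begin

lemma subfield_ambient: "subfield L ambient"
proof -
  interpret field "ambient :: 'k ring" by (rule ambient_field)
  show ?thesis
    by (rule subfieldI'[OF subring_ambient]) (auto simp: ambient_inv inverse_mem)
qed

lemma divide_mem [intro]: "x \<in> L \<Longrightarrow> y \<in> L \<Longrightarrow> x / y \<in> L"
  using mult_mem[OF _ inverse_mem] by (simp add: divide_inverse)

end

lemma subfield_ambientD:
  assumes "subfield L (ambient :: 'k::field ring)"
  shows "field_subfield L"
proof -
  interpret field "ambient :: 'k ring" by (rule ambient_field)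
  interpret field_subring L by (rule field_subring.intro[OF subfieldE(1)[OF assms]])
  show ?thesis
  proof
    fix x assume "x \<in> L"
    then show "inverse x \<in> L"
      using subfield_m_inv(1)[OF assms, of x] by (cases "x = 0") (auto simp: ambient_inv)
  qed
qed

lemma (in field_subring) quotients_subfield: "field_subfield (quotients S)"
proof -
  have I: "a / b \<in> quotients S" if "a \<in> S" "b \<in> S" "b \<noteq> 0" for a b
    unfolding quotients_def using that by blast
  have E: "\<exists>a b. a \<in> S \<and> b \<in> S \<and> b \<noteq> 0 \<and> x = a / b" if "x \<in> quotients S" for x
    using that unfolding quotients_def by blast
  interpret Q: field_subring "quotients S"
  proof (rule field_subringI)
    show "1 \<in> quotients S" using I[of 1 1] by simp
    fix x y assume "x \<in> quotients S" "y \<in> quotients S"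
    then obtain a b c d where *: "a \<in> S" "b \<in> S" "b \<noteq> 0" "x = a / b" "c \<in> S" "d \<in> S" "d \<noteq> 0" "y = c / d"
      using E by metis
    have "x - y = (a * d - c * b) / (b * d)" "x * y = (a * c) / (b * d)"
      using * by (simp_all add: field_simps)
    then show "x - y \<in> quotients S" "x * y \<in> quotients S"
      using I[of "a * d - c * b" "b * d"] I[of "a * c" "b * d"] * by auto
  qed
  show ?thesis
  proof
    fix x assume "x \<in> quotients S"
    then obtain a b where *: "a \<in> S" "b \<in> S" "b \<noteq> 0" "x = a / b" using E by metis
    then show "inverse x \<in> quotients S" using I[of b a] Q.zero_mem by (cases "a = 0") auto
  qed
qed

lemma (in field_subring) subset_quotients: "S \<subseteq> quotients S"
proof
  fix x assume "x \<in> S"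
  then show "x \<in> quotients S"
    unfolding quotients_def by (intro CollectI exI[of _ x] exI[of _ 1]) simp
qed

lemma (in field_subring) fspan_coord:
  assumes indep: "\<And>c. (\<And>i. c i \<in> quotients S) \<Longrightarrow> (\<Sum>i\<in>I. c i * v i) = 0 \<Longrightarrow> \<forall>i\<in>I. c i = 0"
    and c: "\<And>i. c i \<in> quotients S" and mem: "(\<Sum>i\<in>I. c i * v i) \<in> fspan S I v" and i: "i \<in> I"
  shows "c i \<in> S"
proof -
  interpret Q: field_subfield "quotients S" by (rule quotients_subfield)
  obtain d where d: "\<And>i. d i \<in> S" "(\<Sum>i\<in>I. c i * v i) = (\<Sum>i\<in>I. d i * v i)"
    using mem by (elim fspanE) blast
  have "\<forall>i\<in>I. c i - d i = 0"
  proof (rule indep)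
    show "c i - d i \<in> quotients S" for i using c d(1) subset_quotients by blast
    show "(\<Sum>i\<in>I. (c i - d i) * v i) = 0" using d(2) by (simp add: left_diff_distrib sum_subtractf)
  qed
  then have "c i - d i = 0" using i by (rule bspec)
  then show ?thesis using d(1)[of i] by simp
qed

context field_subfield
begin

text \<open>The monic equation of an integral element, divided by its lowest nonzero coefficient.\<close>

lemma inverse_mem_of_integral:
  assumes E: "field_subring E" "L \<subseteq> E" and z: "z \<in> E" "z \<noteq> 0"
    and "z ^ n = (\<Sum>i<n. c i * z ^ i)" "\<And>i. c i \<in> L"
  shows "inverse z \<in> E"
  using assms(5,6)
proof (induction n arbitrary: c)
  case 0
  then show ?case by simp
next
  case (Suc n)
  interpret E: field_subring E by fact
  have eq: "z * z ^ n = c 0 + z * (\<Sum>i<n. c (Suc i) * z ^ i)"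
    using Suc.prems(1) unfolding sum.lessThan_Suc_shift by (simp add: sum_distrib_left mult_ac)
  show ?case
  proof (cases "c 0 = 0")
    case True
    then have "z ^ n = (\<Sum>i<n. c (Suc i) * z ^ i)" using eq z(2) by simp
    then show ?thesis using Suc.IH[of "\<lambda>i. c (Suc i)"] Suc.prems(2) by blast
  next
    case False
    have "z * (z ^ n - (\<Sum>i<n. c (Suc i) * z ^ i)) = c 0" using eq by (simp add: algebra_simps)
    then have "inverse z = (z ^ n - (\<Sum>i<n. c (Suc i) * z ^ i)) * inverse (c 0)"
      using z(2) False by (simp add: field_simps)
    moreover have "\<dots> \<in> E"
      by (intro E.mult_mem E.diff_mem E.power_mem E.sum_mem)
        (use z E(2) Suc.prems(2) inverse_mem in auto)
    ultimately show ?thesis by simp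
  qed
qed

lemma fspan_subring_is_subfield:
  assumes "finite I" "field_subring (fspan L I v)"
  shows "field_subfield (fspan L I v)"
proof -
  interpret E: field_subring "fspan L I v" by fact
  have "L \<subseteq> fspan L I v" using fspan_scale[OF _ E.one_mem] by auto
  show ?thesis
  proof
    fix x assume x: "x \<in> fspan L I v"
    obtain n c where "\<And>i. c i \<in> L" "x ^ n = (\<Sum>i<n. c i * x ^ i)"
      using integral_in_subring_fspan[OF assms x] unfolding integral_elem_def by blast
    then show "inverse x \<in> fspan L I v"
      using inverse_mem_of_integral[OF assms(2) \<open>L \<subseteq> _\<close> x] by (cases "x = 0") auto
  qed
qed

lemma adjoin_field_subfield:
  "field_subfield (adjoin_field L Y)" "L \<subseteq> adjoin_field L Y" "Y \<subseteq> adjoin_field L Y"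
proof -
  interpret F: field "ambient :: 'k ring" by (rule ambient_field)
  show "field_subfield (adjoin_field L Y)"
    unfolding adjoin_field_def by (intro subfield_ambientD F.generate_field_is_subfield) simp
  show "L \<subseteq> adjoin_field L Y" "Y \<subseteq> adjoin_field L Y"
    unfolding adjoin_field_def by (auto intro: generate_field.incl)
qed

lemma adjoin_field_least:
  assumes "field_subfield E" "L \<subseteq> E" "Y \<subseteq> E"
  shows "adjoin_field L Y \<subseteq> E"
proof -
  interpret F: field "ambient :: 'k ring" by (rule ambient_field)
  show ?thesis unfolding adjoin_field_def
    by (rule F.generate_field_min_subfield1) (use assms field_subfield.subfield_ambient[OF assms(1)] in auto)
qed

lemma adjoin_field_eq_fspan:
  assumes "x ^ n = (\<Sum>i<n. r i * x ^ i)" "\<And>i. r i \<in> L"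
    and "y ^ m = (\<Sum>i<m. t i * y ^ i)" "\<And>i. t i \<in> L"
  shows "adjoin_field L {x, y} = fspan L ({..<n} \<times> {..<m}) (\<lambda>(i, j). x ^ i * y ^ j)"
    (is "_ = ?E")
proof
  note mono = monomial_in_fspan[OF assms]
  interpret E: field_subfield ?E
    by (rule fspan_subring_is_subfield[OF _ monomial_fspan_subring[OF assms]]) simp
  have "L \<subseteq> ?E" using fspan_scale[OF _ E.one_mem] by auto
  moreover have "{x, y} \<subseteq> ?E" using mono[of 1 0] mono[of 0 1] by auto
  ultimately show "adjoin_field L {x, y} \<subseteq> ?E" by (rule adjoin_field_least[OF E.field_subfield_axioms])
  interpret G: field_subfield "adjoin_field L {x, y}" by (rule adjoin_field_subfield)
  show "?E \<subseteq> adjoin_field L {x, y}"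
    by (rule fspan_least)
      (use adjoin_field_subfield(2,3)[of "{x, y}"] in \<open>auto intro!: G.mult_mem G.power_mem G.add_mem\<close>)
qed

lemma adjoin_field_translate:
  assumes "h \<in> L" "k \<in> L"
  shows "adjoin_field L {x - h, y - k} = adjoin_field L {x, y}"
proof
  interpret D: field_subfield "adjoin_field L {x, y}" by (rule adjoin_field_subfield)
  interpret E: field_subfield "adjoin_field L {x - h, y - k}" by (rule adjoin_field_subfield)
  show "adjoin_field L {x - h, y - k} \<subseteq> adjoin_field L {x, y}"
    using assms adjoin_field_subfield(2,3)[of "{x, y}"] by (intro adjoin_field_least D.field_subfield_axioms) auto
  have "x - h + h \<in> adjoin_field L {x - h, y - k}" "y - k + k \<in> adjoin_field L {x - h, y - k}"
    using assms adjoin_field_subfield(2,3)[of "{x - h, y - k}"] by (intro E.add_mem; blast)+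
  then show "adjoin_field L {x, y} \<subseteq> adjoin_field L {x - h, y - k}"
    using adjoin_field_subfield(2)[of "{x - h, y - k}"] by (intro adjoin_field_least E.field_subfield_axioms) auto
qed

end

lemma (in field_subring) adjoin_eq_fspan:
  assumes "x ^ n = (\<Sum>i<n. r i * x ^ i)" "\<And>i. r i \<in> S"
    and "y ^ m = (\<Sum>i<m. t i * y ^ i)" "\<And>i. t i \<in> S"
  shows "adjoin S {x, y} = fspan S ({..<n} \<times> {..<m}) (\<lambda>(i, j). x ^ i * y ^ j)"
    (is "_ = ?E")
proof
  note mono = monomial_in_fspan[OF assms]
  interpret E: field_subring ?E by (rule monomial_fspan_subring[OF assms])
  have "S \<subseteq> ?E" using fspan_scale[OF _ E.one_mem] by auto
  moreover have "{x, y} \<subseteq> ?E" using mono[of 1 0] mono[of 0 1] by auto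
  ultimately show "adjoin S {x, y} \<subseteq> ?E" by (rule adjoin_least[OF E.field_subring_axioms])
  interpret G: field_subring "adjoin S {x, y}" by (rule adjoin_subring)
  show "?E \<subseteq> adjoin S {x, y}"
    by (rule fspan_least)
      (use adjoin_subring(2,3)[of "{x, y}"] in \<open>auto intro!: G.mult_mem G.power_mem G.add_mem\<close>)
qed

lemma (in field_subring) adjoin_translate:
  assumes "h \<in> S" "k \<in> S"
  shows "adjoin S {x - h, y - k} = adjoin S {x, y}"
proof
  interpret D: field_subring "adjoin S {x, y}" by (rule adjoin_subring)
  interpret E: field_subring "adjoin S {x - h, y - k}" by (rule adjoin_subring)
  show "adjoin S {x - h, y - k} \<subseteq> adjoin S {x, y}"
    using assms adjoin_subring(2,3)[of "{x, y}"] by (intro adjoin_least D.field_subring_axioms) auto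
  have "x - h + h \<in> adjoin S {x - h, y - k}" "y - k + k \<in> adjoin S {x - h, y - k}"
    using assms adjoin_subring(2,3)[of "{x - h, y - k}"] by (intro E.add_mem; blast)+
  then show "adjoin S {x, y} \<subseteq> adjoin S {x - h, y - k}"
    using adjoin_subring(2)[of "{x - h, y - k}"] by (intro adjoin_least E.field_subring_axioms) auto
qed

lemma (in field_subring) fspan_insert:
  assumes "finite I" "i \<notin> I"
  shows "x \<in> fspan S (insert i I) v \<longleftrightarrow> (\<exists>k\<in>S. \<exists>y\<in>fspan S I v. x = k * v i + y)"
proof
  assume "x \<in> fspan S (insert i I) v"
  then obtain c where "\<And>i. c i \<in> S" "x = (\<Sum>i\<in>insert i I. c i * v i)" by (elim fspanE) blast
  moreover from this have "(\<Sum>i\<in>I. c i * v i) \<in> fspan S I v" by (intro fspanI[of _ c]) auto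
  ultimately show "\<exists>k\<in>S. \<exists>y\<in>fspan S I v. x = k * v i + y"
    using assms by (intro bexI[of _ "c i"] bexI[of _ "\<Sum>i\<in>I. c i * v i"]) simp_all
next
  assume "\<exists>k\<in>S. \<exists>y\<in>fspan S I v. x = k * v i + y"
  then obtain k c where "k \<in> S" "\<And>i. c i \<in> S" "x = k * v i + (\<Sum>i\<in>I. c i * v i)"
    by (auto simp: fspan_def)
  moreover have "(\<Sum>j\<in>I. c j * v j) = (\<Sum>j\<in>I. (c(i := k)) j * v j)"
    using assms by (intro sum.cong) auto
  ultimately show "x \<in> fspan S (insert i I) v"
    using assms by (intro fspanI[of _ "c(i := k)"]) auto
qed

text \<open>
  Selecting a basis from a spanning list; the bound on its length is what allows dimensions to be
  compared.
\<close>

lemma (in ring) spanning_list_base: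
  assumes "subfield K R" "set Us \<subseteq> carrier R"
  shows "\<exists>Vs. independent K Vs \<and> Span K Vs = Span K Us \<and> length Vs \<le> length Us"
  using assms(2)
proof (induction Us)
  case Nil
  then show ?case by (intro exI[of _ "[]"]) (auto intro: li_Nil)
next
  case (Cons u Us)
  then obtain Vs where Vs: "independent K Vs" "Span K Vs = Span K Us" "length Vs \<le> length Us" by auto
  show ?case
  proof (cases "u \<in> Span K Us")
    case True
    then have "Span K (u # Us) = Span K Us"
      using Span_base_incl[OF assms(1)] mono_Span_subset[OF assms(1)] Cons.prems
      by (metis insert_subset list.simps(15) subset_antisym)
    then show ?thesis using Vs by (intro exI[of _ Vs]) auto
  next
    case False
    then have "independent K (u # Vs)" using li_Cons[of u K Vs] Cons.prems Vs by auto
    then show ?thesis using Vs by (intro exI[of _ "u # Vs"]) auto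
  qed
qed

lemma (in field_subfield) Span_eq_fspan:
  assumes "distinct xs"
  shows "ring.Span ambient L (map v xs) = fspan L (set xs) v"
proof -
  interpret F: field "ambient :: 'k ring" by (rule ambient_field)
  show ?thesis using assms
  proof (induction xs)
    case Nil
    then show ?case using zero_mem by (auto simp: fspan_def)
  next
    case (Cons a xs)
    then have IH: "F.Span L (map v xs) = fspan L (set xs) v" and a: "a \<notin> set xs" by simp_all
    have "x \<in> F.Span L (map v (a # xs)) \<longleftrightarrow> x \<in> fspan L (set (a # xs)) v" for x
      by (simp add: F.line_extension_mem_iff fspan_insert[OF _ a] IH[simplified])
    then show ?case by blast
  qed
qed

text \<open>
  A nontrivial relation would allow one member to be dropped, leaving a spanning family with fewer
  members than the dimension.
\<close>

lemma (in field_subfield) independent_if_card_dimension: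
  assumes "finite I" "ring.dimension ambient (card I) L (fspan L I v)"
    and c: "\<And>i. c i \<in> L" "(\<Sum>i\<in>I. c i * v i) = 0" and "k \<in> I"
  shows "c k = 0"
proof (rule ccontr)
  interpret F: field "ambient :: 'k ring" by (rule ambient_field)
  assume "c k \<noteq> 0"
  let ?J = "I - {k}"
  have "c k * v k + (\<Sum>i\<in>?J. c i * v i) = 0"
    by (rule trans[OF sum.remove[OF assms(1,5), symmetric] c(2)])
  then have "c k * v k = - (\<Sum>i\<in>?J. c i * v i)" by (simp add: eq_neg_iff_add_eq_0)
  then have "v k = inverse (c k) * - (\<Sum>i\<in>?J. c i * v i)"
    using \<open>c k \<noteq> 0\<close> by (metis left_inverse mult.assoc mult_1)
  also have "\<dots> \<in> fspan L ?J v"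
    using c(1) inverse_mem by (intro fspan_scale fspan_uminus fspanI[of _ c]) auto
  finally have vk: "v k \<in> fspan L ?J v" .
  have "v i \<in> fspan L ?J v" if "i \<in> I" for i
  proof (cases "i = k")
    case True
    show ?thesis unfolding True by (rule vk)
  next
    case False
    then have i: "i \<in> ?J" using that by simp
    show ?thesis by (rule fspan_base[OF finite_Diff[OF assms(1)] i])
  qed
  then have "fspan L I v \<subseteq> fspan L ?J v"
    by (rule fspan_subset[of I v ?J v])
  moreover have "fspan L ?J v \<subseteq> fspan L I v"
    by (rule fspan_subset[of ?J v I v]) (simp add: fspan_base[OF assms(1), of _ v])
  ultimately have eq: "fspan L I v = fspan L ?J v" by (rule antisym)
  obtain xs where xs: "set xs = ?J" "distinct xs"
    using finite_distinct_list[OF finite_Diff[OF assms(1)]] by blast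
  obtain Vs where Vs: "F.independent L Vs" "F.Span L Vs = F.Span L (map v xs)" "length Vs \<le> length (map v xs)"
    using F.spanning_list_base[OF subfield_ambient, of "map v xs", unfolded ambient_simps, OF subset_UNIV]
    by (elim exE conjE)
  have "F.Span L Vs = fspan L I v" unfolding Vs(2) Span_eq_fspan[OF xs(2)] xs(1) eq ..
  then have "F.dimension (length Vs) L (fspan L I v)"
    using F.dimension_independent[OF Vs(1)] by (simp only:)
  then have "length Vs = card I"
    by (rule F.dimension_is_inj[OF subfield_ambient _ assms(2)])
  moreover have "length xs = card ?J" using distinct_card[OF xs(2)] unfolding xs(1) ..
  ultimately show False
    using Vs(3) card_Diff1_less[OF assms(1,5)] unfolding length_map by linarith
qed

section \<open>Roots of unity and conjugation\<close>

lemma root_of_unity_exists: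
  fixes L :: "'k::field_char_0 set"
  assumes "algebraic_closure (ambient :: 'k ring) L" "p \<ge> 2"
  obtains \<zeta> :: 'k where "\<zeta> ^ p = 1" "\<zeta> \<noteq> 1"
proof -
  interpret algebraic_closure "ambient :: 'k ring" L by fact
  define q :: "'k list" where "q = replicate p 1"
  have q: "q \<in> carrier (poly_ring ambient)"
    using assms(2) unfolding univ_poly_carrier[symmetric] polynomial_def q_def by (cases p) auto
  have "splitted q" using roots_over_carrier q by simp
  then have "size (roots q) \<noteq> 0" using assms(2) by (simp add: splitted_def q_def)
  then obtain \<zeta> where "\<zeta> \<in># roots q" by fastforce
  then have "is_root q \<zeta>" using roots_mem_iff_is_root q by blast
  then have "local.eval q \<zeta> = 0" by (simp add: is_root_def)
  then have "(\<Sum>i<p. \<zeta> ^ i) = 0" unfolding ambient_eval q_def by simp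
  moreover have "(\<zeta> - 1) * (\<Sum>i<p. \<zeta> ^ i) = \<zeta> ^ p - 1" by (simp add: power_diff_1_eq)
  ultimately have "\<zeta> ^ p = 1" "\<zeta> \<noteq> 1" using assms(2) by auto
  then show thesis by (rule that)
qed

lemma sum_powers_root_of_unity:
  fixes \<zeta> :: "'k::field_char_0"
  assumes "Factorial_Ring.prime p" "\<zeta> ^ p = 1" "\<zeta> \<noteq> 1"
  shows "(\<Sum>a<p. \<zeta> ^ (a * n)) = (if p dvd n then of_nat p else 0)"
proof (cases "p dvd n")
  case True
  then obtain m where "n = p * m" by auto
  then have "\<zeta> ^ (a * n) = 1" for a
    using assms(2) by (metis mult.commute mult.assoc power_mult power_one)
  then show ?thesis using True by simp
next
  case False
  then have "coprime n p" using assms(1) prime_imp_coprime coprime_commute by blast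
  have "p \<noteq> 0" "n \<noteq> 0" using assms(1) False prime_gt_0_nat by (auto intro: Nat.gr0I)
  have "\<zeta> ^ n \<noteq> 1"
  proof
    assume n: "\<zeta> ^ n = 1"
    obtain x y where "n * x = p * y + gcd n p" using bezout_nat[OF \<open>n \<noteq> 0\<close>] by blast
    moreover have "gcd n p = 1" using \<open>coprime n p\<close> by (simp only: coprime_iff_gcd_eq_1)
    ultimately have "n * x = p * y + 1" by (simp only:)
    then have "\<zeta> ^ (n * x) = \<zeta> ^ (p * y + 1)" by (simp only:)
    then have "(\<zeta> ^ n) ^ x = (\<zeta> ^ p) ^ y * \<zeta>" by (simp add: power_add power_mult)
    then show False using n assms by simp
  qed
  moreover have "(\<zeta> ^ n - 1) * (\<Sum>a<p. (\<zeta> ^ n) ^ a) = (\<zeta> ^ n) ^ p - 1" by (simp add: power_diff_1_eq)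
  moreover have "(\<zeta> ^ n) ^ p = 1" using assms(2) by (metis mult.commute power_mult power_one)
  ultimately have "(\<Sum>a<p. (\<zeta> ^ n) ^ a) = 0" by simp
  moreover have "(\<zeta> ^ n) ^ a = \<zeta> ^ (a * n)" for a by (simp add: mult.commute flip: power_mult)
  ultimately show ?thesis using False by simp
qed

text \<open>
  The graph of the linear map that carries one family to the other. When the first family is
  independent and the products of both families have the same structure constants, this map is a
  ring homomorphism, so it preserves integral equations.
\<close>

definition (in field_subring) base_change :: "'i set \<Rightarrow> ('i \<Rightarrow> 'k) \<Rightarrow> ('i \<Rightarrow> 'k) \<Rightarrow> 'k \<Rightarrow> 'k \<Rightarrow> bool"
  where "base_change I v v' x x' \<longleftrightarrow>
    (\<exists>c. (\<forall>i. c i \<in> S) \<and> x = (\<Sum>i\<in>I. c i * v i) \<and> x' = (\<Sum>i\<in>I. c i * v' i))"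

context field_subring
begin

lemma base_change_add:
  assumes "base_change I v v' x x'" "base_change I v v' y y'"
  shows "base_change I v v' (x + y) (x' + y')"
proof -
  obtain c d where "\<forall>i. c i \<in> S" "x = (\<Sum>i\<in>I. c i * v i)" "x' = (\<Sum>i\<in>I. c i * v' i)"
    "\<forall>i. d i \<in> S" "y = (\<Sum>i\<in>I. d i * v i)" "y' = (\<Sum>i\<in>I. d i * v' i)"
    using assms unfolding base_change_def by blast
  then show ?thesis unfolding base_change_def
    by (intro exI[of _ "\<lambda>i. c i + d i"]) (auto simp: sum.distrib distrib_right)
qed

lemma base_change_scale:
  assumes "s \<in> S" "base_change I v v' x x'"
  shows "base_change I v v' (s * x) (s * x')"
proof -
  obtain c where "\<forall>i. c i \<in> S" "x = (\<Sum>i\<in>I. c i * v i)" "x' = (\<Sum>i\<in>I. c i * v' i)"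
    using assms unfolding base_change_def by blast
  then show ?thesis unfolding base_change_def using assms(1)
    by (intro exI[of _ "\<lambda>i. s * c i"]) (auto simp: sum_distrib_left mult.assoc)
qed

lemma base_change_zero: "base_change I v v' 0 0"
  unfolding base_change_def by (intro exI[of _ "\<lambda>_. 0"]) auto

lemma base_change_base: "finite I \<Longrightarrow> i \<in> I \<Longrightarrow> base_change I v v' (v i) (v' i)"
  unfolding base_change_def
  by (intro exI[of _ "\<lambda>j. if j = i then 1 else 0"])
    (auto simp: if_distrib[of "\<lambda>x. x * _"] cong: if_cong)

lemma base_change_sum:
  "(\<And>j. j \<in> J \<Longrightarrow> base_change I v v' (h j) (h' j)) \<Longrightarrow> base_change I v v' (sum h J) (sum h' J)"
  by (induction J rule: infinite_finite_induct) (auto intro: base_change_zero base_change_add)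

lemma base_change_mult:
  assumes mult: "\<And>i j. i \<in> I \<Longrightarrow> j \<in> I \<Longrightarrow> base_change I v v' (v i * v j) (v' i * v' j)"
    and "base_change I v v' x x'" "base_change I v v' y y'"
  shows "base_change I v v' (x * y) (x' * y')"
proof -
  obtain c d where *: "\<And>i. c i \<in> S" "x = (\<Sum>i\<in>I. c i * v i)" "x' = (\<Sum>i\<in>I. c i * v' i)"
    "\<And>i. d i \<in> S" "y = (\<Sum>i\<in>I. d i * v i)" "y' = (\<Sum>i\<in>I. d i * v' i)"
    using assms(2,3) unfolding base_change_def by blast
  have "x * y = (\<Sum>i\<in>I. \<Sum>j\<in>I. (c i * d j) * (v i * v j))"
    "x' * y' = (\<Sum>i\<in>I. \<Sum>j\<in>I. (c i * d j) * (v' i * v' j))"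
    unfolding * by (simp_all add: sum_product mult_ac)
  then show ?thesis
    by (simp only:) (intro base_change_sum base_change_scale mult_mem * mult)
qed

lemma base_change_integral:
  assumes "finite I"
    and indep: "\<And>c. (\<And>i. c i \<in> S) \<Longrightarrow> (\<Sum>i\<in>I. c i * v i) = 0 \<Longrightarrow> \<forall>i\<in>I. c i = 0"
    and mult: "\<And>i j. i \<in> I \<Longrightarrow> j \<in> I \<Longrightarrow> base_change I v v' (v i * v j) (v' i * v' j)"
    and one: "base_change I v v' 1 1"
    and x: "base_change I v v' x x'" and D: "D \<subseteq> S" "integral_elem D x"
  shows "integral_elem D x'"
proof -
  obtain n c where c: "\<And>i. c i \<in> D" "x ^ n = (\<Sum>i<n. c i * x ^ i)"
    using D(2) unfolding integral_elem_def by blast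
  have pow: "base_change I v v' (x ^ k) (x' ^ k)" for k
    by (induction k) (auto intro: one base_change_mult[OF mult x])
  have "base_change I v v' (x ^ n + (- 1) * (\<Sum>i<n. c i * x ^ i)) (x' ^ n + (- 1) * (\<Sum>i<n. c i * x' ^ i))"
    using c(1) D(1) by (intro base_change_add base_change_scale base_change_sum pow) auto
  then obtain d where d: "\<And>i. d i \<in> S" "0 = (\<Sum>i\<in>I. d i * v i)"
    "x' ^ n + (- 1) * (\<Sum>i<n. c i * x' ^ i) = (\<Sum>i\<in>I. d i * v' i)"
    unfolding base_change_def using c(2) by auto
  have "\<forall>i\<in>I. d i = 0" using indep d by metis
  then have "x' ^ n = (\<Sum>i<n. c i * x' ^ i)" using d(3) by simp
  then show ?thesis unfolding integral_elem_def using c(1) by blast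
qed

end

text \<open>
  Averaging the conjugates of an integral element against the characters of the group of pairs
  of p-th roots of unity isolates its homogeneous components, up to the factor p^2.
\<close>

lemma power_commutes_exponents: "(x ^ m) ^ n = (x ^ n) ^ m" for x :: "'a::monoid_mult"
  unfolding power_mult[symmetric] by (simp add: mult.commute)

lemma homogeneous_component_integral:
  fixes \<omega> \<mu> \<zeta> :: "'k::field_char_0"
  defines "I p \<equiv> {..<p} \<times> {..<p}"
  assumes S: "field_subring S" and p: "Factorial_Ring.prime p" and zeta: "\<zeta> ^ p = 1" "\<zeta> \<noteq> 1"
    and pow: "\<omega> ^ p \<in> S" "\<mu> ^ p \<in> S"
    and indep: "\<And>c. (\<And>i. c i \<in> S) \<Longrightarrow> (\<Sum>(i, j)\<in>I p. c (i, j) * (\<omega> ^ i * \<mu> ^ j)) = 0 \<Longrightarrow> \<forall>i\<in>I p. c i = 0"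
    and c: "\<And>i. c i \<in> S"
    and D: "D \<subseteq> S" "field_subring D" "integral_elem D (\<Sum>(i, j)\<in>I p. c (i, j) * (\<omega> ^ i * \<mu> ^ j))"
    and kl: "k < p" "l < p"
  shows "integral_elem D (of_nat p ^ 2 * c (k, l) * (\<omega> ^ k * \<mu> ^ l))"
proof -
  interpret field_subring S by fact
  interpret D: field_subring D by fact
  have p0: "p > 0" using p prime_gt_0_nat by blast
  define v where "v = (\<lambda>(i, j). \<omega> ^ i * \<mu> ^ j)"
  define v' where "v' = (\<lambda>a b (i, j). (\<zeta> ^ a * \<omega>) ^ i * (\<zeta> ^ b * \<mu>) ^ j)"
  define x where "x = (\<Sum>i\<in>I p. c i * v i)"
  define x' where "x' = (\<lambda>a b. \<Sum>i\<in>I p. c i * v' a b i)"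
  have fin: "finite (I p)" by (simp add: I_def)
  have zint: "integral_elem D \<zeta>" unfolding integral_elem_def
    by (rule exI[of _ p], rule exI[of _ "\<lambda>i. if i = 0 then 1 else 0"])
      (use p0 zeta in \<open>auto simp: if_distrib[of "\<lambda>x. x * _"] cong: if_cong\<close>)
  have int': "integral_elem D (x' a b)" for a b
  proof (rule base_change_integral[OF fin, of v "v' a b" x])
    show "\<forall>i\<in>I p. e i = 0" if "\<And>i. e i \<in> S" "(\<Sum>i\<in>I p. e i * v i) = 0" for e
      using indep[of e] that by (simp add: v_def case_prod_unfold)
    show "base_change (I p) v (v' a b) 1 1"
      using base_change_base[OF fin, of "(0, 0)" v "v' a b"] p0 by (simp add: v_def v'_def I_def)
    show "base_change (I p) v (v' a b) x (x' a b)"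
      unfolding base_change_def x_def x'_def using c by blast
    show "integral_elem D x" using D(3) by (simp add: x_def v_def case_prod_unfold)
    fix i j assume "i \<in> I p" "j \<in> I p"
    obtain i1 i2 j1 j2 where [simp]: "i = (i1, i2)" "j = (j1, j2)" by (cases i; cases j)
    have split: "z ^ n = (z ^ p) ^ (n div p) * z ^ (n mod p)" for z :: 'k and n
      by (simp flip: power_mult power_add)
    have zp: "(\<zeta> ^ a * z) ^ p = z ^ p" for z a
    proof -
      have "(\<zeta> ^ a) ^ p = (\<zeta> ^ p) ^ a" by (rule power_commutes_exponents)
      then show ?thesis using zeta(1) by (simp add: power_mult_distrib)
    qed
    let ?s = "(\<omega> ^ p) ^ ((i1 + j1) div p) * (\<mu> ^ p) ^ ((i2 + j2) div p)"
    let ?m = "((i1 + j1) mod p, (i2 + j2) mod p)"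
    have "v i * v j = \<omega> ^ (i1 + j1) * \<mu> ^ (i2 + j2)" by (simp add: v_def power_add)
    also have "\<dots> = ?s * v ?m"
      by (subst split[of \<omega> "i1 + j1"], subst split[of \<mu> "i2 + j2"]) (simp add: v_def mult_ac)
    finally have 1: "v i * v j = ?s * v ?m" .
    have "v' a b i * v' a b j = (\<zeta> ^ a * \<omega>) ^ (i1 + j1) * (\<zeta> ^ b * \<mu>) ^ (i2 + j2)"
      unfolding power_add by (simp add: v'_def)
    also have "\<dots> = ?s * v' a b ?m"
      by (subst split[of "\<zeta> ^ a * \<omega>" "i1 + j1"],
        subst split[of "\<zeta> ^ b * \<mu>" "i2 + j2"])
        (simp only: v'_def zp prod.case, simp only: mult_ac)
    finally have 2: "v' a b i * v' a b j = ?s * v' a b ?m" .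
    show "base_change (I p) v (v' a b) (v i * v j) (v' a b i * v' a b j)"
      unfolding 1 2 using p0
      by (intro base_change_scale base_change_base fin mult_mem[OF power_mem[OF pow(1)] power_mem[OF pow(2)]])
        (simp add: I_def)
  qed (use D in auto)
  \<comment> \<open>The exponent p - k stands for - k, since \<zeta>^p = 1.\<close>
  have "(\<Sum>a<p. \<Sum>b<p. \<zeta> ^ (a * (p - k)) * \<zeta> ^ (b * (p - l)) * x' a b)
      = (\<Sum>a<p. \<Sum>b<p. \<Sum>i\<in>I p. c i * v i * (\<zeta> ^ (a * (p - k + fst i)) * \<zeta> ^ (b * (p - l + snd i))))"
    unfolding x'_def sum_distrib_left
  proof (intro sum.cong refl)
    fix a b i
    have E: "\<zeta> ^ (a * (n + m)) = \<zeta> ^ (a * n) * (\<zeta> ^ a) ^ m" for a n m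
      by (simp add: distrib_left power_add power_mult)
    show "\<zeta> ^ (a * (p - k)) * \<zeta> ^ (b * (p - l)) * (c i * v' a b i)
        = c i * v i * (\<zeta> ^ (a * (p - k + fst i)) * \<zeta> ^ (b * (p - l + snd i)))"
      unfolding E v'_def v_def case_prod_unfold power_mult_distrib by (simp only: mult_ac)
  qed
  also have "\<dots> = (\<Sum>a<p. \<Sum>i\<in>I p. \<Sum>b<p. c i * v i * (\<zeta> ^ (a * (p - k + fst i)) * \<zeta> ^ (b * (p - l + snd i))))"
    by (intro sum.cong refl sum.swap)
  also have "\<dots> = (\<Sum>i\<in>I p. \<Sum>a<p. \<Sum>b<p. c i * v i * (\<zeta> ^ (a * (p - k + fst i)) * \<zeta> ^ (b * (p - l + snd i))))"
    by (rule sum.swap)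
  also have "\<dots> = (\<Sum>i\<in>I p. c i * v i * ((\<Sum>a<p. \<zeta> ^ (a * (p - k + fst i))) * (\<Sum>b<p. \<zeta> ^ (b * (p - l + snd i)))))"
    by (simp only: sum_product, simp only: sum_distrib_left)
  also have "\<dots> = (\<Sum>i\<in>I p. if i = (k, l) then c i * v i * of_nat p ^ 2 else 0)"
  proof (rule sum.cong[OF refl])
    fix i assume i: "i \<in> I p"
    have dvd: "p dvd p - k + n \<longleftrightarrow> n = k" if "k < p" "n < p" for k n
    proof
      assume "p dvd p - k + n"
      then obtain m where m: "p - k + n = p * m" by auto
      have "p * m < p * 2" unfolding m[symmetric] using that by linarith
      then have "m < 2" by simp
      moreover have "m \<noteq> 0" using m that by (cases m) auto
      ultimately have "m = 1" by simp
      then show "n = k" using m that by simp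
    qed (use that in auto)
    show "c i * v i * ((\<Sum>a<p. \<zeta> ^ (a * (p - k + fst i))) * (\<Sum>b<p. \<zeta> ^ (b * (p - l + snd i))))
        = (if i = (k, l) then c i * v i * of_nat p ^ 2 else 0)"
      unfolding sum_powers_root_of_unity[OF p zeta]
      using i kl dvd[OF kl(1), of "fst i"] dvd[OF kl(2), of "snd i"]
      by (cases i) (auto simp: I_def power2_eq_square)
  qed
  also have "\<dots> = of_nat p ^ 2 * c (k, l) * (\<omega> ^ k * \<mu> ^ l)"
    using fin kl by (simp add: I_def v_def mult_ac)
  finally have eq: "(\<Sum>a<p. \<Sum>b<p. \<zeta> ^ (a * (p - k)) * \<zeta> ^ (b * (p - l)) * x' a b)
      = of_nat p ^ 2 * c (k, l) * (\<omega> ^ k * \<mu> ^ l)" .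
  have "integral_elem D (\<Sum>a<p. \<Sum>b<p. \<zeta> ^ (a * (p - k)) * \<zeta> ^ (b * (p - l)) * x' a b)"
    by (intro D.integral_sum D.integral_mult D.integral_power zint int')
  then show ?thesis unfolding eq .
qed

section \<open>Rings in which p is prime\<close>

text \<open>
  The inner binomial coefficients are divisible by p, so the p-th power is additive up to a multiple
  of p in every ring that contains x and y.
\<close>

lemma (in field_subring) freshman_dream:
  assumes "Factorial_Ring.prime p" "x \<in> S" "y \<in> S"
  obtains w where "w \<in> S" "(x + y) ^ p = x ^ p + y ^ p + of_nat p * w"
proof -
  have p: "p > 1" using assms(1) prime_gt_1_nat by blast
  have "\<exists>w\<in>S. of_nat (p choose k) * x ^ k * y ^ (p - k) = of_nat p * w" if k: "k \<in> {1..<p}" for k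
  proof -
    have "p dvd p choose k" using assms(1) k by (intro dvd_choose_prime) auto
    then obtain m where m: "p choose k = p * m" by (rule dvdE)
    have "of_nat m * x ^ k * y ^ (p - k) \<in> S" using assms by (intro mult_mem power_mem) auto
    then show ?thesis unfolding m by (intro bexI[of _ "of_nat m * x ^ k * y ^ (p - k)"]) (auto simp: mult.assoc)
  qed
  then obtain w where w: "\<And>k. k \<in> {1..<p} \<Longrightarrow> w k \<in> S"
    "\<And>k. k \<in> {1..<p} \<Longrightarrow> of_nat (p choose k) * x ^ k * y ^ (p - k) = of_nat p * w k"
    by metis
  have set: "{..p} = insert 0 (insert p {1..<p})" using p by auto
  have "(x + y) ^ p = (\<Sum>k\<le>p. of_nat (p choose k) * x ^ k * y ^ (p - k))"
    by (rule binomial_ring)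
  also have "\<dots> = y ^ p + (x ^ p + (\<Sum>k\<in>{1..<p}. of_nat (p choose k) * x ^ k * y ^ (p - k)))"
    unfolding set using p by (subst sum.insert; simp)+
  also have "(\<Sum>k\<in>{1..<p}. of_nat (p choose k) * x ^ k * y ^ (p - k)) = of_nat p * (\<Sum>k\<in>{1..<p}. w k)"
    unfolding sum_distrib_left by (rule sum.cong[OF refl w(2)])
  finally have "(x + y) ^ p = x ^ p + y ^ p + of_nat p * (\<Sum>k\<in>{1..<p}. w k)" by (simp only: add_ac)
  moreover have "(\<Sum>k\<in>{1..<p}. w k) \<in> S" using w(1) by (rule sum_mem)
  ultimately show thesis using that by blast
qed

lemma (in field_subring) freshman_dream_diff:
  assumes "Factorial_Ring.prime p" "odd p" "x \<in> S" "y \<in> S"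
  obtains w where "w \<in> S" "(x - y) ^ p = x ^ p - y ^ p + of_nat p * w"
proof -
  obtain w where "w \<in> S" "(x + - y) ^ p = x ^ p + (- y) ^ p + of_nat p * w"
    using freshman_dream[OF assms(1,3) uminus_mem[OF assms(4)]] .
  then show thesis using that[of w] assms(2) by simp
qed

text \<open>
  Divisibility of x by p is written as x / p being an element of S, which is meaningful because S is
  a domain inside a field of characteristic zero.
\<close>

locale p_prime_subring = field_subring S for S :: "'k::field_char_0 set" +
  fixes p :: nat
  assumes prime_p: "Factorial_Ring.prime p"
    and p_mult: "x \<in> S \<Longrightarrow> y \<in> S \<Longrightarrow> x * y / of_nat p \<in> S \<Longrightarrow> x / of_nat p \<in> S \<or> y / of_nat p \<in> S"
    and p_nonunit: "1 / of_nat p \<notin> S"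
begin

lemma p_pos: "p > 0" "of_nat p \<noteq> (0::'k)"
  using prime_p prime_gt_0_nat by auto

lemma div_add: "x / of_nat p \<in> S \<Longrightarrow> y / of_nat p \<in> S \<Longrightarrow> (x + y) / of_nat p \<in> S"
  unfolding add_divide_distrib by (rule add_mem)

lemma div_diff: "x / of_nat p \<in> S \<Longrightarrow> y / of_nat p \<in> S \<Longrightarrow> (x - y) / of_nat p \<in> S"
  unfolding diff_divide_distrib by (rule diff_mem)

lemma div_mult: "x / of_nat p \<in> S \<Longrightarrow> y \<in> S \<Longrightarrow> x * y / of_nat p \<in> S"
  using mult_mem[of "x / of_nat p" y] by simp

lemma div_mult': "y \<in> S \<Longrightarrow> x / of_nat p \<in> S \<Longrightarrow> y * x / of_nat p \<in> S"
  using mult_mem[of y "x / of_nat p"] by simp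

lemma div_p: "x \<in> S \<Longrightarrow> of_nat p * x / of_nat p \<in> S"
  using p_pos by simp

lemma div_zero: "0 / of_nat p \<in> S"
  by simp

lemma div_sum: "(\<And>i. i \<in> I \<Longrightarrow> h i / of_nat p \<in> S) \<Longrightarrow> sum h I / of_nat p \<in> S"
  unfolding sum_divide_distrib by (rule sum_mem)

lemma div_power: "x \<in> S \<Longrightarrow> x ^ n / of_nat p \<in> S \<Longrightarrow> x / of_nat p \<in> S"
proof (induction n)
  case 0
  then show ?case using p_nonunit by simp
next
  case (Suc n)
  then show ?case using p_mult[of x "x ^ n"] by auto
qed

lemma div_cong: "x / of_nat p \<in> S \<Longrightarrow> (x - y) / of_nat p \<in> S \<Longrightarrow> y / of_nat p \<in> S"
  using div_diff[of x "x - y"] by simp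

lemma of_nat_not_div:
  assumes "\<not> p dvd n"
  shows "of_nat n / of_nat p \<notin> S"
proof
  assume n: "of_nat n / of_nat p \<in> S"
  have "coprime n p" using prime_p assms prime_imp_coprime coprime_commute by blast
  then have g: "gcd n p = 1" by (simp only: coprime_iff_gcd_eq_1)
  have "n \<noteq> 0" using assms by (metis dvd_0_right)
  obtain x y where "n * x = p * y + gcd n p" using bezout_nat[OF \<open>n \<noteq> 0\<close>] by blast
  then have "n * x = p * y + 1" unfolding g .
  then have "of_nat n * of_nat x = of_nat p * of_nat y + (1::'k)"
    by (metis of_nat_1 of_nat_add of_nat_mult)
  then have "1 = of_nat n * of_nat x - of_nat p * (of_nat y :: 'k)" by simp
  moreover have "(of_nat n * of_nat x - of_nat p * (of_nat y :: 'k)) / of_nat p \<in> S"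
    by (intro div_diff div_mult div_p n of_nat_mem)
  ultimately show False using p_nonunit by simp
qed

lemma nondiv_cancel_fspan:
  assumes indep: "\<And>c. (\<And>i. c i \<in> quotients S) \<Longrightarrow> (\<Sum>i\<in>I. c i * v i) = 0 \<Longrightarrow> \<forall>i\<in>I. c i = 0"
    and s: "s \<in> S" "s / of_nat p \<notin> S" and x: "x \<in> fspan S I v" "s * x / of_nat p \<in> fspan S I v"
  shows "x / of_nat p \<in> fspan S I v"
proof -
  interpret Q: field_subfield "quotients S" by (rule quotients_subfield)
  obtain c where c: "\<And>i. c i \<in> S" "x = (\<Sum>i\<in>I. c i * v i)"
    using x(1) by (elim fspanE) blast
  have eq: "s * x / of_nat p = (\<Sum>i\<in>I. (s * c i / of_nat p) * v i)"
    unfolding c(2) sum_distrib_left sum_divide_distrib by (intro sum.cong) (auto simp: mult_ac)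
  have "s * c i / of_nat p \<in> S" if i: "i \<in> I" for i
  proof (rule fspan_coord[of v I "\<lambda>i. s * c i / of_nat p", OF indep])
    show "s * c i / of_nat p \<in> quotients S" for i
      by (intro Q.divide_mem Q.of_nat_mem subsetD[OF subset_quotients mult_mem[OF s(1) c(1)]])
  qed (use x(2) eq i in simp_all)
  then have "c i / of_nat p \<in> S" if "i \<in> I" for i using that p_mult[OF s(1) c(1)] s(2) by blast
  then show ?thesis unfolding c(2) sum_divide_distrib
    by (intro fspanI[of I "\<lambda>i. c i / of_nat p"]) auto
qed

end

section \<open>Polynomials over a local ring with maximal ideal (p)\<close>

locale p_local_subring = p_prime_subring +
  assumes inverse_or_div: "x \<in> S \<Longrightarrow> x / of_nat p \<notin> S \<Longrightarrow> inverse x \<in> S"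
begin

definition coeffs_in :: "'a Polynomial.poly \<Rightarrow> bool"
  where "coeffs_in q \<longleftrightarrow> (\<forall>i. coeff q i \<in> S)"

definition coeffs_div :: "'a Polynomial.poly \<Rightarrow> bool"
  where "coeffs_div q \<longleftrightarrow> (\<forall>i. coeff q i / of_nat p \<in> S)"

lemma coeffs_in_simps [intro]:
  "coeffs_in 0" "coeffs_in 1" "coeffs_in q \<Longrightarrow> coeffs_in r \<Longrightarrow> coeffs_in (q + r)" "coeffs_in q \<Longrightarrow> coeffs_in r \<Longrightarrow> coeffs_in (q - r)"
  "a \<in> S \<Longrightarrow> coeffs_in q \<Longrightarrow> coeffs_in (Polynomial.smult a q)" "a \<in> S \<Longrightarrow> coeffs_in (Polynomial.monom a n)" "a \<in> S \<Longrightarrow> coeffs_in [:a:]"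
  "coeffs_in q \<Longrightarrow> coeffs_in (pderiv q)"
  by (auto simp: coeffs_in_def coeff_1 coeff_pderiv coeff_pCons split: nat.splits simp del: of_nat_Suc)

lemma coeffs_in_mult [intro]: "coeffs_in q \<Longrightarrow> coeffs_in r \<Longrightarrow> coeffs_in (q * r)"
  by (auto simp: coeffs_in_def coeff_mult)

lemma coeffs_in_power [intro]: "coeffs_in q \<Longrightarrow> coeffs_in (q ^ n)"
  by (induction n) auto

lemma coeffs_div_zero: "coeffs_div 0"
  by (simp add: coeffs_div_def)

lemma coeffs_div_add: "coeffs_div q \<Longrightarrow> coeffs_div r \<Longrightarrow> coeffs_div (q + r)"
  by (simp add: coeffs_div_def div_add)

lemma coeffs_div_diff: "coeffs_div q \<Longrightarrow> coeffs_div r \<Longrightarrow> coeffs_div (q - r)"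
  by (simp add: coeffs_div_def div_diff)

lemma coeffs_div_mult: "coeffs_div q \<Longrightarrow> coeffs_in r \<Longrightarrow> coeffs_div (q * r)"
  unfolding coeffs_div_def coeffs_in_def coeff_mult by (auto intro!: div_sum div_mult)

lemma coeffs_div_pderiv: "coeffs_div q \<Longrightarrow> coeffs_div (pderiv q)"
  unfolding coeffs_div_def coeff_pderiv by (auto intro: div_mult' simp del: of_nat_Suc)

lemma monic_division:
  assumes y: "coeffs_in y" "lead_coeff y = 1" and z: "coeffs_in z"
  shows "\<exists>q r. coeffs_in q \<and> coeffs_in r \<and> z = q * y + r \<and> (degree r < degree y \<or> r = 0)"
  using z
proof (induction "degree z" arbitrary: z rule: less_induct)
  case less
  show ?case
  proof (cases "degree z < degree y \<or> z = 0")
    case True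
    then show ?thesis using less.prems by (intro exI[of _ 0] exI[of _ z]) auto
  next
    case False
    then have dz: "degree y \<le> degree z" "z \<noteq> 0" by auto
    define u where "u = Polynomial.monom (lead_coeff z) (degree z - degree y)"
    have u: "coeffs_in u" using less.prems unfolding u_def by (auto simp: coeffs_in_def)
    define z' where "z' = z - u * y"
    have oz': "coeffs_in z'" unfolding z'_def using u y less.prems by blast
    have "degree (u * y) \<le> degree z"
      unfolding u_def using dz degree_mult_le[of "Polynomial.monom (lead_coeff z) (degree z - degree y)" y]
        degree_monom_le[of "lead_coeff z" "degree z - degree y"] by linarith
    then have deg: "degree z' \<le> degree z" unfolding z'_def by (intro degree_diff_le) auto
    have "coeff (u * y) (degree z) = lead_coeff z"
      unfolding u_def coeff_monom_mult using dz y(2) by simp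
    then have c0: "coeff z' (degree z) = 0" by (simp add: z'_def)
    show ?thesis
    proof (cases "z' = 0")
      case True
      then show ?thesis using u by (intro exI[of _ u] exI[of _ 0]) (auto simp: z'_def)
    next
      case False
      have "degree z' < degree z"
      proof (rule ccontr)
        assume "\<not> degree z' < degree z"
        then have "degree z' = degree z" using deg by simp
        then show False using c0 False by (metis leading_coeff_0_iff)
      qed
      then obtain q r where qr: "coeffs_in q" "coeffs_in r" "z' = q * y + r" "degree r < degree y \<or> r = 0"
        using less.hyps[OF _ oz'] by blast
      have "z = (u + q) * y + r" using qr(3) by (simp add: z'_def algebra_simps)
      then show ?thesis using qr u by (intro exI[of _ "u + q"] exI[of _ r]) auto
    qed
  qed
qed

text \<open>
  Multiplication by a monic polynomial shifts the highest coefficient that is not divisible by p.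
\<close>

lemma top_coeff_monic_mult:
  assumes "coeffs_in u" "\<not> coeffs_div u" "coeffs_in y" "lead_coeff y = 1"
  obtains i where "coeff (u * y) (i + degree y) / of_nat p \<notin> S"
proof -
  define J where "J = {i. coeff u i / of_nat p \<notin> S}"
  have sub: "J \<subseteq> {..degree u}"
  proof
    fix i assume "i \<in> J"
    then have "coeff u i \<noteq> 0" unfolding J_def using div_zero by auto
    then show "i \<in> {..degree u}" using le_degree by auto
  qed
  then have fin: "finite J" using finite_subset by blast
  have "J \<noteq> {}" using assms(2) by (auto simp: J_def coeffs_div_def)
  define i where "i = Max J"
  have i: "i \<in> J" "\<And>j. j \<in> J \<Longrightarrow> j \<le> i"
    unfolding i_def using fin \<open>J \<noteq> {}\<close> by auto
  let ?m = "degree y"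
  have fin': "finite {..i + ?m}" "i \<in> {..i + ?m}" by auto
  have "coeff (u * y) (i + ?m) = coeff u i * coeff y (i + ?m - i)
      + (\<Sum>k\<in>{..i + ?m} - {i}. coeff u k * coeff y (i + ?m - k))"
    unfolding coeff_mult by (rule sum.remove[OF fin'])
  then have "coeff (u * y) (i + ?m) - coeff u i = (\<Sum>k\<in>{..i + ?m} - {i}. coeff u k * coeff y (i + ?m - k))"
    using assms(4) by simp
  moreover have "(\<Sum>k\<in>{..i + ?m} - {i}. coeff u k * coeff y (i + ?m - k)) / of_nat p \<in> S"
  proof (rule div_sum)
    fix k assume k: "k \<in> {..i + ?m} - {i}"
    show "coeff u k * coeff y (i + ?m - k) / of_nat p \<in> S"
    proof (cases "k < i")
      case True
      then have "coeff y (i + ?m - k) = 0" by (intro coeff_eq_0) simp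
      then show ?thesis by simp
    next
      case False
      then have "k \<notin> J" using i(2)[of k] k by auto
      then show ?thesis using assms(3) by (intro div_mult) (auto simp: J_def coeffs_in_def)
    qed
  qed
  ultimately have "(coeff (u * y) (i + ?m) - coeff u i) / of_nat p \<in> S" by simp
  then have "coeff (u * y) (i + ?m) / of_nat p \<notin> S"
    using div_cong i(1) unfolding J_def by blast
  then show thesis by (rule that)
qed

lemma coeffs_div_cancel_monic:
  assumes "coeffs_in u" "coeffs_in y" "lead_coeff y = 1" "coeffs_div (u * y)"
  shows "coeffs_div u"
  using top_coeff_monic_mult[OF assms(1) _ assms(2,3)] assms(4) unfolding coeffs_div_def by blast

lemma degree_monic_power:
  assumes "lead_coeff (y :: 'a Polynomial.poly) = 1"
  shows "lead_coeff (y ^ n) = 1" "degree (y ^ n) = n * degree y"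
proof -
  have "y \<noteq> 0" using assms by auto
  then show "degree (y ^ n) = n * degree y" by (rule Polynomial.degree_power_eq)
  show "lead_coeff (y ^ n) = 1" by (simp only: lead_coeff_power assms power_one)
qed

lemma coeff_monom_minus_const:
  "coeff (Polynomial.monom 1 p - [:c:]) n = (if n = p then 1 else 0) - (if n = 0 then c else (0::'a))"
  by (cases n) (auto simp: coeff_pCons)

text \<open>
  Let I be a prime ideal of the polynomial ring lying over (p) that contains T^p - c, and suppose
  that its monic generator y modulo p has degree m < p. The derivative of y has smaller degree and
  so lies outside I. Differentiating T^p - c = r y^s modulo p gives s r y' = - r' y; for 0 < s < p
  it follows that r lies in I, so that one more power of y divides T^p - c. Eventually y^p does,
  which forces m = 1, and then the root of y is a p-th root of c.
\<close>

lemma radical_of_pure_equation: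
  fixes I :: "'a Polynomial.poly \<Rightarrow> bool"
  assumes I_in: "\<And>q. I q \<Longrightarrow> coeffs_in q"
    and I_div: "\<And>q. coeffs_div q \<Longrightarrow> coeffs_in q \<Longrightarrow> I q"
    and I_add: "\<And>q r. I q \<Longrightarrow> I r \<Longrightarrow> I (q + r)"
    and I_mult: "\<And>q r. coeffs_in q \<Longrightarrow> I r \<Longrightarrow> I (q * r)"
    and I_prime: "\<And>q r. coeffs_in q \<Longrightarrow> coeffs_in r \<Longrightarrow> I (q * r) \<Longrightarrow> I q \<or> I r"
    and I_const: "\<And>v. I [:v:] \<Longrightarrow> v / of_nat p \<in> S"
    and c: "c \<in> S" and F: "I (Polynomial.monom 1 p - [:c:])"
    and no_root: "\<And>\<gamma>. \<gamma> \<in> S \<Longrightarrow> (\<gamma> ^ p - c) / of_nat p \<notin> S"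
    and z: "I z" "degree z < p"
  shows "coeffs_div z"
proof (rule ccontr)
  assume nz: "\<not> coeffs_div z"
  define F where "F = Polynomial.monom 1 p - [:c:]"
  note p0 = p_pos(1)
  have inF: "coeffs_in F" unfolding F_def using c by (intro coeffs_in_simps) auto
  have coeffF: "coeff F n = (if n = p then 1 else 0) - (if n = 0 then c else 0)" for n
    unfolding F_def by (rule coeff_monom_minus_const)
  have I_diff: "I (q - r)" if "I q" "I r" for q r
  proof -
    have "I (q + [:- 1:] * r)" using that by (intro I_add I_mult coeffs_in_simps) auto
    then show ?thesis by simp
  qed
  have I_congr: "I q" if "I r" "coeffs_div (q - r)" "coeffs_in q" for q r
    using I_add[OF that(1) I_div[OF that(2)]] that I_in by auto
  define good where "good = (\<lambda>m. \<exists>u. I u \<and> \<not> coeffs_div u \<and> degree u = m)"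
  define m where "m = (LEAST m. good m)"
  have "good (degree z)" unfolding good_def using z nz by blast
  then have m: "good m" "m < p" and least: "\<And>k. good k \<Longrightarrow> m \<le> k"
    unfolding m_def using LeastI[of good] Least_le[of good] z(2) by (auto intro: le_less_trans)
  obtain u where u: "I u" "\<not> coeffs_div u" "degree u = m" using m(1) unfolding good_def by blast
  have small: "coeffs_div r" if "I r" "degree r < m" for r
    using least[of "degree r"] that unfolding good_def by auto
  have lead: "lead_coeff u / of_nat p \<notin> S"
  proof
    assume l: "lead_coeff u / of_nat p \<in> S"
    define h where "h = Polynomial.monom (lead_coeff u) m"
    have h: "coeffs_div h" "coeffs_in h"
      using l I_in[OF u(1)] unfolding h_def coeffs_div_def coeffs_in_def by auto
    have Iuh: "I (u - h)" by (rule I_diff[OF u(1) I_div[OF h]])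
    have "degree (u - h) \<le> m" unfolding h_def using u(3) by (intro degree_diff_le degree_monom_le) auto
    moreover have "coeff (u - h) m = 0" using u(3) by (simp add: h_def)
    ultimately have "degree (u - h) < m \<or> u - h = 0"
      by (metis le_neq_implies_less leading_coeff_0_iff)
    then have "coeffs_div (u - h)" using small[OF Iuh] coeffs_div_zero by auto
    then have "coeffs_div (u - h + h)" using h(1) by (rule coeffs_div_add)
    then show False using u(2) by simp
  qed
  have lead0: "lead_coeff u \<noteq> 0" using lead div_zero by metis
  have leadin: "lead_coeff u \<in> S" using I_in[OF u(1)] by (auto simp: coeffs_in_def)
  define y where "y = Polynomial.smult (inverse (lead_coeff u)) u"
  have inv: "inverse (lead_coeff u) \<in> S" using inverse_or_div[OF leadin lead] .
  have "I ([:inverse (lead_coeff u):] * u)" using inv u(1) by (intro I_mult coeffs_in_simps) auto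
  then have Iy: "I y" by (simp add: y_def)
  have y: "lead_coeff y = 1" "degree y = m" "coeffs_in y"
    using lead0 u(3) I_in[OF Iy] by (auto simp: y_def)
  have I1: "\<not> I 1" using I_const[of 1] p_nonunit by (auto simp: one_pCons)
  have m0: "m > 0"
  proof (rule ccontr)
    assume "\<not> m > 0"
    then have "degree y = 0" using y(2) by simp
    then have "y = 1" using y(1) by (metis degree_eq_zeroE lead_coeff_pCons(2) one_pCons)
    then show False using Iy I1 by simp
  qed
  have factor: "\<exists>q. coeffs_in q \<and> coeffs_div (w - q * y)" if Iw: "I w" for w
  proof -
    obtain q r where qr: "coeffs_in q" "coeffs_in r" "w = q * y + r" "degree r < degree y \<or> r = 0"
      using monic_division[OF y(3,1) I_in[OF Iw]] by blast
    have "I (w - q * y)" by (rule I_diff[OF Iw I_mult[OF qr(1) Iy]])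
    then have "I r" using qr(3) by simp
    then have "coeffs_div r" using small[of r] qr(4) y(2) coeffs_div_zero by auto
    then show ?thesis using qr by auto
  qed
  have Iy': "\<not> I (pderiv y)"
  proof
    assume "I (pderiv y)"
    moreover have "degree (pderiv y) < m" using m0 y(2) by (simp add: degree_pderiv)
    ultimately have "coeffs_div (pderiv y)" by (rule small)
    then have "coeff (pderiv y) (m - 1) / of_nat p \<in> S" unfolding coeffs_div_def by blast
    moreover have "coeff (pderiv y) (m - 1) = of_nat m"
      using y(1,2) m0 by (simp add: coeff_pderiv del: of_nat_Suc)
    moreover have "\<not> p dvd m" using m0 m(2) by (auto dest: dvd_imp_le)
    ultimately show False using of_nat_not_div by metis
  qed
  have divide_power: "\<exists>r. coeffs_in r \<and> coeffs_div (F - r * y ^ s)" if "s \<le> p" for s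
    using that
  proof (induction s)
    case 0
    then show ?case using inF coeffs_div_zero by (intro exI[of _ F]) simp
  next
    case (Suc s)
    then obtain r where r: "coeffs_in r" "coeffs_div (F - r * y ^ s)" by auto
    have ys: "coeffs_in (y ^ s)" using y(3) by blast
    have Ir: "I r"
    proof (cases "s = 0")
      case True
      have "coeffs_div (0 - (F - r * y ^ s))" by (rule coeffs_div_diff[OF coeffs_div_zero r(2)])
      then have "coeffs_div (r - F)" using True by simp
      then show ?thesis using I_congr[of F r] F r(1) unfolding F_def by blast
    next
      case False
      define E where "E = pderiv r * y + Polynomial.smult (of_nat s) (r * pderiv y)"
      have inE: "coeffs_in E" unfolding E_def using r(1) y(3) by (intro coeffs_in_simps coeffs_in_mult) auto
      have "coeffs_div (pderiv (F - r * y ^ s))" using r(2) by (rule coeffs_div_pderiv)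
      moreover have "coeffs_div (pderiv F)"
        unfolding coeffs_div_def coeff_pderiv coeffF using p_pos by (auto simp del: of_nat_Suc)
      ultimately have "coeffs_div (pderiv F - pderiv (F - r * y ^ s))" by (intro coeffs_div_diff)
      then have "coeffs_div (pderiv (r * y ^ s))" by (simp add: pderiv_diff)
      moreover have "pderiv (r * y ^ s) = E * y ^ (s - 1)"
      proof -
        obtain t where "s = Suc t" using False by (cases s) auto
        show ?thesis
          unfolding E_def \<open>s = Suc t\<close> pderiv_mult pderiv_power_Suc
          by (simp add: algebra_simps del: of_nat_Suc)
      qed
      ultimately have "coeffs_div (E * y ^ (s - 1))" by simp
      then have "coeffs_div E"
        using coeffs_div_cancel_monic[OF inE _ degree_monic_power(1)[OF y(1)]] y(3) by blast
      then have "I E" using I_div inE by blast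
      moreover have "I (pderiv r * y)" using r(1) Iy by (intro I_mult coeffs_in_simps)
      ultimately have "I (E - pderiv r * y)" by (rule I_diff)
      then have "I ([:of_nat s:] * (r * pderiv y))" by (simp add: E_def)
      then have "I [:of_nat s:] \<or> I r \<or> I (pderiv y)"
        using I_prime[of "[:of_nat s:]" "r * pderiv y"] I_prime[of r "pderiv y"] r(1) y(3) of_nat_mem
        by (metis coeffs_in_mult coeffs_in_simps(7) coeffs_in_simps(8))
      moreover have "\<not> I [:of_nat s:]"
      proof
        assume "I [:of_nat s:]"
        then have "of_nat s / of_nat p \<in> S" by (rule I_const)
        moreover have "\<not> p dvd s" using False Suc.prems by (auto dest: dvd_imp_le)
        ultimately show False using of_nat_not_div by blast
      qed
      ultimately show ?thesis using Iy' by blast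
    qed
    obtain q where q: "coeffs_in q" "coeffs_div (r - q * y)" using factor[OF Ir] by blast
    have "coeffs_div ((F - r * y ^ s) + (r - q * y) * y ^ s)"
      by (intro coeffs_div_add r(2) coeffs_div_mult q(2) ys)
    moreover have "(F - r * y ^ s) + (r - q * y) * y ^ s = F - q * y ^ Suc s"
      by (simp add: algebra_simps)
    ultimately show ?case using q(1) by auto
  qed
  obtain r where r: "coeffs_in r" "coeffs_div (F - r * y ^ p)" using divide_power[of p] by blast
  have "\<not> coeffs_div r"
  proof
    assume "coeffs_div r"
    then have "coeffs_div ((F - r * y ^ p) + r * y ^ p)"
      using y(3) by (intro coeffs_div_add r(2) coeffs_div_mult coeffs_in_power)
    then have "coeff F p / of_nat p \<in> S" unfolding coeffs_div_def by simp
    then show False unfolding coeffF using p0 p_nonunit by simp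
  qed
  then obtain i where i: "coeff (r * y ^ p) (i + degree (y ^ p)) / of_nat p \<notin> S"
    using top_coeff_monic_mult[OF r(1) _ coeffs_in_power[OF y(3)] degree_monic_power(1)[OF y(1)]] by blast
  define n where "n = i + p * m"
  have "coeff (r * y ^ p) n / of_nat p \<notin> S" using i unfolding n_def degree_monic_power(2)[OF y(1)] y(2) .
  moreover have "(coeff F n - coeff (r * y ^ p) n) / of_nat p \<in> S"
    using r(2) unfolding coeffs_div_def by simp
  ultimately have "coeff F n \<noteq> 0" using div_cong[of "coeff F n"] div_zero by auto
  then have "n \<le> p" unfolding coeffF by (auto split: if_splits)
  then have "p * m \<le> p * 1" unfolding n_def by linarith
  then have "m \<le> 1" using p0 by (metis mult_le_cancel1)
  then have "m = 1" using m0 by linarith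
  define \<gamma> where "\<gamma> = - coeff y 0"
  have y_eq: "y = [:- \<gamma>, 1:]"
    using y(1,2) \<open>m = 1\<close> by (auto simp: \<gamma>_def poly_eq_iff coeff_pCons coeff_eq_0 split: nat.splits)
  have \<gamma>S: "\<gamma> \<in> S" using y(3) by (auto simp: \<gamma>_def coeffs_in_def)
  obtain q v where qv: "coeffs_in q" "coeffs_in v" "F = q * y + v" "degree v < degree y \<or> v = 0"
    using monic_division[OF y(3,1) inF] by blast
  then have "degree v = 0" using y(2) \<open>m = 1\<close> by auto
  then obtain a where a: "v = [:a:]" by (rule degree_eq_zeroE)
  have "I F" using F unfolding F_def .
  then have "I (F - q * y)" using I_mult[OF qv(1) Iy] by (rule I_diff)
  then have "I [:a:]" using qv(3) a by simp
  then have "a / of_nat p \<in> S" by (rule I_const)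
  moreover have "a = \<gamma> ^ p - c"
    using arg_cong[OF qv(3), of "\<lambda>q. poly q \<gamma>"] by (simp add: F_def y_eq a poly_monom)
  ultimately show False using no_root[OF \<gamma>S] by simp
qed

text \<open>
  The residue field is not formed as a ring of its own, so the bound on the number of roots is
  proved for congruences modulo p, by splitting off one linear factor at a time.
\<close>

lemma card_roots_mod_p_le:
  assumes "coeffs_in q" "\<not> coeffs_div q" "degree q \<le> n"
    and "finite A" "A \<subseteq> S" "\<And>a b. a \<in> A \<Longrightarrow> b \<in> A \<Longrightarrow> a \<noteq> b \<Longrightarrow> (a - b) / of_nat p \<notin> S"
    and "\<And>a. a \<in> A \<Longrightarrow> poly q a / of_nat p \<in> S"
  shows "card A \<le> n"
  using assms
proof (induction n arbitrary: q A)
  case 0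
  then obtain v where v: "q = [:v:]" by (metis degree_eq_zeroE le_zero_eq)
  then have "v / of_nat p \<notin> S" using 0(2) unfolding coeffs_div_def by (auto simp: coeff_pCons split: nat.splits, metis gr0_implies_Suc)
  then have "A = {}" using 0(7) v by auto
  then show ?case by simp
next
  case (Suc n)
  show ?case
  proof (cases "A = {}")
    case False
    then obtain a where a: "a \<in> A" by blast
    let ?y = "[:- a, 1:]"
    have y: "coeffs_in ?y" "lead_coeff ?y = 1"
      using a Suc.prems(5) by (auto simp: coeffs_in_def coeff_pCons split: nat.splits)
    obtain r v where rv: "coeffs_in r" "coeffs_in v" "q = r * ?y + v" "degree v < degree ?y \<or> v = 0"
      using monic_division[OF y Suc.prems(1)] by blast
    then have "degree v = 0" by auto
    then obtain w where w: "v = [:w:]" by (rule degree_eq_zeroE)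
    have qa: "poly q x = (x - a) * poly r x + w" for x
      by (subst rv(3), unfold w) (simp add: algebra_simps)
    have wd: "w / of_nat p \<in> S" using Suc.prems(7)[OF a] qa[of a] by simp
    have nr: "\<not> coeffs_div r"
    proof
      assume "coeffs_div r"
      then have "coeffs_div (r * ?y + v)"
        using wd w y(1) by (intro coeffs_div_add coeffs_div_mult)
          (auto simp: coeffs_div_def coeff_pCons split: nat.splits)
      then show False using Suc.prems(2) rv(3) by simp
    qed
    have "degree r \<le> n"
    proof (cases "r = 0")
      case False
      have "degree (r * ?y) = Suc (degree r)" using False by (subst degree_mult_eq) auto
      moreover have "degree (r * ?y) \<le> Suc n"
      proof -
        have "r * ?y = q - v" using rv(3) by simp
        then show ?thesis using Suc.prems(3) \<open>degree v = 0\<close> by (simp only:) (intro degree_diff_le, auto)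
      qed
      ultimately show ?thesis by simp
    qed simp
    have "card (A - {a}) \<le> n"
    proof (rule Suc.IH[OF rv(1) nr \<open>degree r \<le> n\<close>])
      fix b assume b: "b \<in> A - {a}"
      have bS: "b \<in> S" "a \<in> S" using b a Suc.prems(5) by auto
      have prS: "poly r b \<in> S" unfolding poly_altdef using rv(1) bS by (auto simp: coeffs_in_def)
      have "poly q b / of_nat p \<in> S" using Suc.prems(7) b by blast
      then have "(poly q b - w) / of_nat p \<in> S" using wd by (rule div_diff)
      then have "(b - a) * poly r b / of_nat p \<in> S" using qa[of b] by simp
      moreover have "(b - a) / of_nat p \<notin> S" using Suc.prems(6)[of b a] a b by blast
      ultimately show "poly r b / of_nat p \<in> S" using p_mult[of "b - a" "poly r b"] prS bS by blast
    qed (use Suc.prems in auto)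
    moreover have "card A = Suc (card (A - {a}))" using a Suc.prems(4) by (metis card_Suc_Diff1)
    ultimately show ?thesis by simp
  qed simp
qed

lemma fermat_little: "\<not> p dvd i \<Longrightarrow> (of_nat i ^ (p - 1) - 1) / of_nat p \<in> S"
proof -
  assume "\<not> p dvd i"
  then have "[i ^ (p - 1) = 1] (mod p)" using fermat_theorem prime_p by blast
  moreover have "1 \<le> i ^ (p - 1)" using \<open>\<not> p dvd i\<close> by (cases i) auto
  ultimately have "p dvd i ^ (p - 1) - 1" by (simp add: cong_altdef_nat cong_sym)
  then obtain m where "i ^ (p - 1) - 1 = p * m" by (rule dvdE)
  then have "i ^ (p - 1) = p * m + 1" using \<open>1 \<le> i ^ (p - 1)\<close> by simp
  then have "(of_nat i ^ (p - 1) :: 'a) = of_nat p * of_nat m + 1"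
    by (metis of_nat_1 of_nat_add of_nat_mult of_nat_power)
  then have "of_nat i ^ (p - 1) - 1 = (of_nat p * of_nat m :: 'a)" by simp
  then show ?thesis using div_p[of "of_nat m"] by simp
qed

text \<open>
  The ratio x / y is a root of T^(p-1) - 1 modulo p, and 1, ..., p - 1 already are as many roots as
  its degree permits.
\<close>

lemma prime_field_ratio:
  assumes x: "x \<in> S" and y: "y \<in> S" "y / of_nat p \<notin> S"
    and eq: "(x ^ (p - 1) - y ^ (p - 1)) / of_nat p \<in> S"
  obtains i where "i \<in> {1..p - 1}" "(x - of_nat i * y) / of_nat p \<in> S"
proof -
  have inv: "inverse y \<in> S" using inverse_or_div y by blast
  have y0: "y \<noteq> 0" using y(2) div_zero by auto
  define r where "r = x * inverse y"
  have rS: "r \<in> S" using x inv by (auto simp: r_def)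
  have "\<exists>i\<in>{1..p - 1}. (r - of_nat i) / of_nat p \<in> S"
  proof (rule ccontr)
    assume "\<not> (\<exists>i\<in>{1..p - 1}. (r - of_nat i) / of_nat p \<in> S)"
    then have n: "\<And>i. i \<in> {1..p - 1} \<Longrightarrow> (r - of_nat i) / of_nat p \<notin> S" by blast
    define q where "q = Polynomial.monom 1 (p - 1) - [:1::'a:]"
    define A where "A = insert r (of_nat ` {1..p - 1})"
    have p2: "p - 1 > 0" using prime_p prime_gt_1_nat by (simp add: prime_gt_1_nat)
    have inq: "coeffs_in q" unfolding q_def by (intro coeffs_in_simps) auto
    have "coeff q (p - 1) = 1" using p2 by (cases "p - 1") (auto simp: q_def coeff_pCons)
    then have nq: "\<not> coeffs_div q" using p_nonunit unfolding coeffs_div_def by metis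
    have dq: "degree q \<le> p - 1" unfolding q_def by (intro degree_diff_le degree_monom_le) auto
    have small: "\<not> p dvd i" if "i \<in> {1..p - 1}" for i using that p2 by (auto dest: dvd_imp_le)
    have nat_diff: "(of_nat i - of_nat j :: 'a) / of_nat p \<notin> S" if "i \<in> {1..p - 1}" "j < i" for i j
    proof -
      have "\<not> p dvd i - j" using that p2 by (auto dest: dvd_imp_le)
      then show ?thesis using of_nat_not_div[of "i - j"] that(2) by (simp add: of_nat_diff)
    qed
    have sym: "(u - v) / of_nat p \<in> S \<longleftrightarrow> (v - u) / of_nat p \<in> S" for u v :: 'a
      using uminus_mem_iff[of "(u - v) / of_nat p"] by (simp add: minus_divide_left)
    have "card A \<le> p - 1"
    proof (rule card_roots_mod_p_le[OF inq nq dq])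
      show "finite A" "A \<subseteq> S" unfolding A_def using rS by auto
      fix a b assume ab: "a \<in> A" "b \<in> A" "a \<noteq> b"
      show "(a - b) / of_nat p \<notin> S"
      proof (cases "a = r \<or> b = r")
        case True
        then show ?thesis using ab n sym[of a b] unfolding A_def by auto
      next
        case False
        then obtain i j where ij: "i \<in> {1..p - 1}" "j \<in> {1..p - 1}" "a = of_nat i" "b = of_nat j"
          using ab unfolding A_def by auto
        then consider "i < j" | "j < i" using ab(3) by (metis linorder_neqE_nat)
        then show ?thesis using nat_diff[of i j] nat_diff[of j i] ij sym[of a b] by cases auto
      qed
    next
      fix a assume "a \<in> A"
      then consider "a = r" | i where "i \<in> {1..p - 1}" "a = of_nat i" unfolding A_def by auto
      then show "poly q a / of_nat p \<in> S"
      proof cases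
        case 1
        have "poly q a = (x ^ (p - 1) - y ^ (p - 1)) * inverse y ^ (p - 1)"
          using y0 1 by (simp add: q_def poly_monom r_def algebra_simps flip: power_mult_distrib)
        then show ?thesis using div_mult[OF eq power_mem[OF inv]] by simp
      next
        case 2
        then show ?thesis using fermat_little[OF small[OF 2(1)]] by (simp add: q_def poly_monom)
      qed
    qed
    moreover have "card A = Suc (p - 1)"
    proof -
      have "r \<notin> of_nat ` {1..p - 1}" using n div_zero by force
      moreover have "inj_on (of_nat :: nat \<Rightarrow> 'a) {1..p - 1}" by (simp add: inj_on_def)
      ultimately show ?thesis unfolding A_def by (simp add: card_image)
    qed
    ultimately show False by simp
  qed
  then obtain i where i: "i \<in> {1..p - 1}" "(r - of_nat i) / of_nat p \<in> S" by blast
  have "(r - of_nat i) * y / of_nat p \<in> S" using i(2) y(1) by (rule div_mult)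
  moreover have "(r - of_nat i) * y = x - of_nat i * y" using y0 by (simp add: r_def algebra_simps)
  ultimately show thesis using that i(1) by simp
qed

end

section \<open>Localization at (p)\<close>

context p_prime_subring
begin

text \<open>
  The localization at (p) of an S-submodule of the ambient field; it is applied to S, to rings that
  contain S and to the ring of all integral elements.
\<close>

definition loc :: "'k set \<Rightarrow> 'k set"
  where "loc M = {x. \<exists>s\<in>S. s / of_nat p \<notin> S \<and> s * x \<in> M}"

lemma locI: "s \<in> S \<Longrightarrow> s / of_nat p \<notin> S \<Longrightarrow> s * x \<in> M \<Longrightarrow> x \<in> loc M"
  unfolding loc_def by blast

lemma locE:
  assumes "x \<in> loc M"
  obtains s where "s \<in> S" "s / of_nat p \<notin> S" "s * x \<in> M" "s \<noteq> 0"
proof -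
  obtain s where s: "s \<in> S" "s / of_nat p \<notin> S" "s * x \<in> M" using assms unfolding loc_def by blast
  moreover have "s \<noteq> 0" using s(2) div_zero by metis
  ultimately show thesis by (rule that)
qed

lemma nondiv_mult: "s \<in> S \<Longrightarrow> t \<in> S \<Longrightarrow> s / of_nat p \<notin> S \<Longrightarrow> t / of_nat p \<notin> S \<Longrightarrow> s * t / of_nat p \<notin> S"
  using p_mult by blast

lemma subset_loc: "M \<subseteq> loc M"
  using p_nonunit by (auto intro!: locI[of 1])

lemma loc_mono: "M \<subseteq> N \<Longrightarrow> loc M \<subseteq> loc N"
  by (auto simp: loc_def)

lemma loc_subring:
  assumes "field_subring M" "S \<subseteq> M"
  shows "field_subring (loc M)"
proof (rule field_subringI)
  interpret M: field_subring M by fact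
  show "1 \<in> loc M" using subset_loc M.one_mem by blast
  fix x y assume "x \<in> loc M" "y \<in> loc M"
  then obtain s t where st: "s \<in> S" "s / of_nat p \<notin> S" "s * x \<in> M" "t \<in> S" "t / of_nat p \<notin> S" "t * y \<in> M"
    by (metis locE)
  have "t \<in> M" "s \<in> M" using st assms(2) by auto
  then have "t * (s * x) - s * (t * y) \<in> M" using st(3,6) by blast
  then have "s * t * (x - y) \<in> M" by (simp add: algebra_simps)
  then show "x - y \<in> loc M" using st by (intro locI[OF _ nondiv_mult]) auto
  have "(s * x) * (t * y) \<in> M" using st by blast
  then have "s * t * (x * y) \<in> M" by (simp add: mult_ac)
  then show "x * y \<in> loc M" using st by (intro locI[OF _ nondiv_mult]) auto
qed

lemma inverse_mem_loc:
  assumes "s \<in> S" "s / of_nat p \<notin> S"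
  shows "inverse s \<in> loc S"
proof (rule locI[OF assms])
  have "s \<noteq> 0" using assms(2) div_zero by metis
  then show "s * inverse s \<in> S" by simp
qed

lemma p_local_loc: "p_local_subring (loc S) p"
proof -
  interpret V: field_subring "loc S" by (rule loc_subring[OF field_subring_axioms]) simp
  show ?thesis
  proof
    show "Factorial_Ring.prime p" by (rule prime_p)
  next
    fix x y assume xy: "x \<in> loc S" "y \<in> loc S" "x * y / of_nat p \<in> loc S"
    obtain s where s: "s \<in> S" "s / of_nat p \<notin> S" "s * x \<in> S" using xy(1) by (rule locE)
    obtain t where t: "t \<in> S" "t / of_nat p \<notin> S" "t * y \<in> S" using xy(2) by (rule locE)
    obtain u where u: "u \<in> S" "u / of_nat p \<notin> S" "u * (x * y / of_nat p) \<in> S" using xy(3) by (rule locE)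
    have "(s * t) * (u * (x * y / of_nat p)) \<in> S" using s t u by blast
    then have "(s * x) * ((t * y) * u) / of_nat p \<in> S" by (simp add: mult_ac)
    then have "s * x / of_nat p \<in> S \<or> (t * y) * u / of_nat p \<in> S" using p_mult s t u by blast
    then have "s * x / of_nat p \<in> S \<or> t * y / of_nat p \<in> S" using p_mult[OF t(3) u(1)] u(2) by blast
    then show "x / of_nat p \<in> loc S \<or> y / of_nat p \<in> loc S"
      using locI[OF s(1,2), of "x / of_nat p"] locI[OF t(1,2), of "y / of_nat p"] by auto
  next
    show "1 / of_nat p \<notin> loc S"
    proof
      assume "1 / of_nat p \<in> loc S"
      then obtain s where "s \<in> S" "s / of_nat p \<notin> S" "s * (1 / of_nat p) \<in> S" by (rule locE)
      then show False by simp
    qed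
  next
    fix x assume x: "x \<in> loc S" "x / of_nat p \<notin> loc S"
    obtain s where s: "s \<in> S" "s / of_nat p \<notin> S" "s * x \<in> S" using x(1) by (rule locE)
    have n: "s * x / of_nat p \<notin> S" using x(2) locI[OF s(1,2), of "x / of_nat p" S] by auto
    have "x \<noteq> 0" using x(2) V.zero_mem by auto
    then have "(s * x) * inverse x = s" by simp
    then have "(s * x) * inverse x \<in> S" using s(1) by (simp only:)
    then show "inverse x \<in> loc S" using locI[OF s(3) n] by blast
  qed
qed

end

section \<open>The equation of a shifted p-th root\<close>

text \<open>
  Only the term linear in x matters later; the higher terms are collected in a multiple of x^2.
\<close>

lemma (in field_subring) shifted_root_equation:
  fixes x h a :: 'k
  assumes p: "Factorial_Ring.prime p" "p \<ge> 3" and h: "h \<in> S"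
    and eq: "(x + h) ^ p = h ^ p + of_nat p * a"
  obtains r where "\<And>k. r k \<in> S"
    "x ^ p = of_nat p * (a - h ^ (p - 1) * x - x ^ 2 * (\<Sum>k<p - 2. r k * x ^ k))"
proof -
  define n where "n = p - 2"
  have n: "p = Suc (Suc n)" using p(2) by (simp add: n_def)
  define r :: "nat \<Rightarrow> 'k" where "r k = of_nat ((p choose (k + 2)) div p) * h ^ (p - (k + 2))" for k
  define t where "t k = of_nat (p choose k) * x ^ k * h ^ (p - k)" for k
  have t: "t (Suc (Suc k)) = of_nat p * (x ^ 2 * (r k * x ^ k))" if "k < n" for k
  proof -
    have "p dvd p choose (k + 2)" using p(1) that n by (intro dvd_choose_prime) auto
    then have "p choose (k + 2) = p * ((p choose (k + 2)) div p)" by simp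
    then have "(of_nat (p choose (k + 2)) :: 'k) = of_nat p * of_nat ((p choose (k + 2)) div p)"
      by (metis of_nat_mult)
    then show ?thesis by (simp add: t_def r_def power2_eq_square mult_ac)
  qed
  have "(x + h) ^ p = (\<Sum>k<Suc (Suc (Suc n)). t k)"
    unfolding binomial_ring t_def n[symmetric] lessThan_Suc_atMost ..
  also have "\<dots> = t 0 + (t 1 + ((\<Sum>k<n. t (Suc (Suc k))) + t p))"
    unfolding sum.lessThan_Suc_shift[of _ "Suc (Suc n)"] sum.lessThan_Suc_shift[of _ "Suc n"]
      sum.lessThan_Suc[of _ n] n by simp
  also have "(\<Sum>k<n. t (Suc (Suc k))) = of_nat p * (x ^ 2 * (\<Sum>k<n. r k * x ^ k))"
    unfolding sum_distrib_left using t by (intro sum.cong) auto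
  finally have "h ^ p + of_nat p * a = h ^ p + (of_nat p * x * h ^ (p - 1)
      + (of_nat p * (x ^ 2 * (\<Sum>k<n. r k * x ^ k)) + x ^ p))"
    unfolding eq by (simp add: t_def)
  then have "x ^ p = of_nat p * (a - h ^ (p - 1) * x - x ^ 2 * (\<Sum>k<p - 2. r k * x ^ k))"
    by (simp add: algebra_simps n_def)
  moreover have "r k \<in> S" for k unfolding r_def using h by blast
  ultimately show thesis using that by blast
qed

lemma (in field_subring) shifted_root_monic:
  assumes "p \<ge> 3" "h \<in> S" "a \<in> S" "\<And>k. r k \<in> S"
    and eq: "x ^ p = of_nat p * (a - h ^ (p - 1) * x - x ^ 2 * (\<Sum>k<p - 2. r k * x ^ k))"
  obtains t where "\<And>i. t i \<in> S" "x ^ p = (\<Sum>i<p. t i * x ^ i)"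
proof -
  define n where "n = p - 2"
  have n: "p = Suc (Suc n)" using assms(1) by (simp add: n_def)
  define t where "t i = of_nat p * (case i of 0 \<Rightarrow> a | Suc 0 \<Rightarrow> - (h ^ (p - 1)) | Suc (Suc k) \<Rightarrow> - r k)" for i
  have "(\<Sum>i<p. t i * x ^ i) = t 0 + (t 1 * x + (\<Sum>k<n. t (Suc (Suc k)) * x ^ Suc (Suc k)))"
    unfolding n sum.lessThan_Suc_shift by simp
  also have "(\<Sum>k<n. t (Suc (Suc k)) * x ^ Suc (Suc k)) = - of_nat p * (x ^ 2 * (\<Sum>k<n. r k * x ^ k))"
    unfolding sum_distrib_left by (intro sum.cong) (auto simp: t_def power2_eq_square mult_ac)
  finally have "(\<Sum>i<p. t i * x ^ i) = x ^ p"
    unfolding eq by (simp add: t_def n algebra_simps del: of_nat_Suc)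
  moreover have "t i \<in> S" for i
    unfolding t_def using assms by (intro mult_mem of_nat_mem) (auto split: nat.splits)
  ultimately show thesis using that by metis
qed

section \<open>Localization at a prime and free modules\<close>

context field_subring
begin

lemma localization_subring:
  assumes "prime_in P"
  shows "field_subring (localization_at S P)" "S \<subseteq> localization_at S P"
proof -
  note D = prime_inD[OF assms]
  have I: "a / s \<in> localization_at S P" if "a \<in> S" "s \<in> S" "s \<notin> P" for a s
    unfolding localization_at_def using that by blast
  have E: "\<exists>a s. a \<in> S \<and> s \<in> S \<and> s \<notin> P \<and> x = a / s" if "x \<in> localization_at S P" for x
    using that unfolding localization_at_def by blast
  show "S \<subseteq> localization_at S P" using I[OF _ one_mem D(6)] by auto
  show "field_subring (localization_at S P)"
  proof (rule field_subringI)
    show "1 \<in> localization_at S P" using I[of 1 1] D(6) by simp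
    fix x y assume "x \<in> localization_at S P" "y \<in> localization_at S P"
    then obtain a s b t where *: "a \<in> S" "s \<in> S" "s \<notin> P" "x = a / s" "b \<in> S" "t \<in> S" "t \<notin> P" "y = b / t"
      using E by metis
    have nz: "s \<noteq> 0" "t \<noteq> 0" using * D(2) by auto
    have st: "s * t \<in> S" "s * t \<notin> P" using * D(7) by blast+
    have "x - y = (a * t - b * s) / (s * t)" "x * y = (a * b) / (s * t)"
      using * nz by (simp_all add: field_simps)
    then show "x - y \<in> localization_at S P" "x * y \<in> localization_at S P"
      using I[OF _ st, of "a * t - b * s"] I[OF _ st, of "a * b"] * by auto
  qed
qed

text \<open>
  Freeness indexes the coefficients by the members of a basis instead of by I. Independence makes v
  injective, which translates between the two.
\<close>

lemma free_module_fspan: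
  assumes fin: "finite I"
    and indep: "\<And>c. (\<And>i. c i \<in> S) \<Longrightarrow> (\<Sum>i\<in>I. c i * v i) = 0 \<Longrightarrow> \<forall>i\<in>I. c i = 0"
  shows "free_module (ring_on S) (module_on (fspan S I v))"
proof -
  let ?E = "fspan S I v" and ?N = "module_on (fspan S I v)"
  have N: "carrier ?N = ?E" "\<And>x y. x \<oplus>\<^bsub>?N\<^esub> y = x + y" "\<And>s x. s \<odot>\<^bsub>?N\<^esub> x = s * x" "\<zero>\<^bsub>?N\<^esub> = 0"
    by (simp_all add: module_on_def)
  have group: "abelian_group ?N"
  proof (rule abelian_groupI)
    fix x assume "x \<in> carrier ?N"
    then have "- x \<in> ?E" using fspan_uminus N by simp
    then show "\<exists>y\<in>carrier ?N. y \<oplus>\<^bsub>?N\<^esub> x = \<zero>\<^bsub>?N\<^esub>" by (intro bexI[of _ "- x"]) (simp_all add: N)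
  qed (auto simp: N fspan_add fspan_zero)
  then interpret G: abelian_group ?N .
  have module: "module (ring_on S) ?N"
    by (rule moduleI[OF cring_ring_on group]) (auto simp: N fspan_scale algebra_simps)
  have finsum: "finsum ?N h J = sum h J" if "finite J" "\<And>j. j \<in> J \<Longrightarrow> h j \<in> ?E" for h :: "'k \<Rightarrow> 'k" and J
    using that
  proof (induction J rule: finite_induct)
    case empty
    then show ?case using G.finsum_empty N by simp
  next
    case (insert j J)
    have "h \<in> J \<rightarrow> carrier ?N" "h j \<in> carrier ?N" using insert.prems N by auto
    then show ?case using G.finsum_insert[OF insert.hyps, of h] insert N by simp
  qed
  have inj: "inj_on v I"
  proof (rule inj_onI, rule ccontr)
    fix i j assume ij: "i \<in> I" "j \<in> I" "v i = v j" "i \<noteq> j"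
    define d where "d k = (if k = i then 1 else if k = j then - 1 else 0 :: 'k)" for k
    have "(\<Sum>k\<in>I. d k * v k) = (\<Sum>k\<in>{i, j}. d k * v k)"
      using ij fin by (intro sum.mono_neutral_right) (auto simp: d_def)
    also have "\<dots> = 0" using ij by (simp add: d_def)
    finally have "\<forall>k\<in>I. d k = 0" by (intro indep) (auto simp: d_def)
    then show False using ij(1) by (auto simp: d_def)
  qed
  define B where "B = v ` I"
  have finB: "finite B" using fin by (simp add: B_def)
  have BE: "B \<subseteq> ?E" unfolding B_def using fspan_base[OF fin, of _ v] by auto
  have expand: "(\<Oplus>\<^bsub>?N\<^esub>b\<in>{b. c b \<noteq> 0}. c b \<odot>\<^bsub>?N\<^esub> b) = (\<Sum>i\<in>I. c (v i) * v i)"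
    if "\<And>b. c b \<in> S" "{b. c b \<noteq> 0} \<subseteq> B" for c
  proof -
    have "(\<Oplus>\<^bsub>?N\<^esub>b\<in>{b. c b \<noteq> 0}. c b \<odot>\<^bsub>?N\<^esub> b) = (\<Oplus>\<^bsub>?N\<^esub>b\<in>{b. c b \<noteq> 0}. c b * b)"
      by (simp add: N)
    also have "\<dots> = (\<Sum>b\<in>{b. c b \<noteq> 0}. c b * b)"
      using that finB BE by (intro finsum fspan_scale) (auto intro: finite_subset)
    also have "\<dots> = (\<Sum>b\<in>B. c b * b)"
      using that finB by (intro sum.mono_neutral_left) auto
    also have "\<dots> = (\<Sum>i\<in>I. c (v i) * v i)"
      unfolding B_def using inj by (simp add: sum.reindex)
    finally show ?thesis .
  qed
  have "\<exists>!c. (\<forall>b. c b \<in> carrier (ring_on S)) \<and> finite {b. c b \<noteq> \<zero>\<^bsub>ring_on S\<^esub>} \<and>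
      {b. c b \<noteq> \<zero>\<^bsub>ring_on S\<^esub>} \<subseteq> B \<and>
      x = (\<Oplus>\<^bsub>?N\<^esub>b \<in> {b. c b \<noteq> \<zero>\<^bsub>ring_on S\<^esub>}. c b \<odot>\<^bsub>?N\<^esub> b)" if "x \<in> carrier ?N" for x
  proof -
    have "x \<in> ?E" using that N by simp
    then obtain d where d: "\<And>i. d i \<in> S" "x = (\<Sum>i\<in>I. d i * v i)" by (elim fspanE) blast
    define c where "c b = (if b \<in> B then d (inv_into I v b) else 0)" for b
    have c: "\<And>b. c b \<in> S" "{b. c b \<noteq> 0} \<subseteq> B" using d(1) by (auto simp: c_def)
    have cv: "c (v i) = d i" if "i \<in> I" for i
      using that inj by (simp add: c_def B_def)
    have "x = (\<Sum>i\<in>I. c (v i) * v i)" unfolding d(2) using cv by (intro sum.cong) auto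
    then have x: "x = (\<Oplus>\<^bsub>?N\<^esub>b\<in>{b. c b \<noteq> 0}. c b \<odot>\<^bsub>?N\<^esub> b)" using expand[OF c] by simp
    show ?thesis
    proof (rule ex1I[of _ c])
      show "(\<forall>b. c b \<in> carrier (ring_on S)) \<and> finite {b. c b \<noteq> \<zero>\<^bsub>ring_on S\<^esub>} \<and>
          {b. c b \<noteq> \<zero>\<^bsub>ring_on S\<^esub>} \<subseteq> B \<and>
          x = (\<Oplus>\<^bsub>?N\<^esub>b \<in> {b. c b \<noteq> \<zero>\<^bsub>ring_on S\<^esub>}. c b \<odot>\<^bsub>?N\<^esub> b)"
        using c x finite_subset[OF c(2) finB] by simp
    next
      fix e assume "(\<forall>b. e b \<in> carrier (ring_on S)) \<and> finite {b. e b \<noteq> \<zero>\<^bsub>ring_on S\<^esub>} \<and>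
          {b. e b \<noteq> \<zero>\<^bsub>ring_on S\<^esub>} \<subseteq> B \<and>
          x = (\<Oplus>\<^bsub>?N\<^esub>b \<in> {b. e b \<noteq> \<zero>\<^bsub>ring_on S\<^esub>}. e b \<odot>\<^bsub>?N\<^esub> b)"
      then have e: "\<And>b. e b \<in> S" "{b. e b \<noteq> 0} \<subseteq> B" "x = (\<Oplus>\<^bsub>?N\<^esub>b\<in>{b. e b \<noteq> 0}. e b \<odot>\<^bsub>?N\<^esub> b)"
        by simp_all
      have "(\<Sum>i\<in>I. c (v i) * v i) = (\<Sum>i\<in>I. e (v i) * v i)"
        using x e(3) expand[OF c] expand[OF e(1,2)] by simp
      then have "(\<Sum>i\<in>I. (e (v i) - c (v i)) * v i) = 0"
        by (simp add: left_diff_distrib sum_subtractf)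
      then have "\<forall>i\<in>I. e (v i) - c (v i) = 0"
        using c(1) e(1) by (intro indep) auto
      then have "e b = c b" if "b \<in> B" for b using that unfolding B_def by auto
      moreover have "e b = c b" if "b \<notin> B" for b proof -
        have "e b = 0" "c b = 0" using that c(2) e(2) by auto
        then show ?thesis by simp
      qed
      ultimately show "e = c" by blast
    qed
  qed
  note unique = this
  have "B \<subseteq> carrier ?N" using BE N(1) by simp
  then show ?thesis unfolding free_module_def
    by (intro conjI[OF module] exI[of _ B] conjI ballI unique)
qed

end

section \<open>The ring spanned by divided monomials\<close>

text \<open>
  The elements \<alpha> and \<beta> are the p-th roots shifted so that they lie in the prime over p. The last
  four assumptions on divisibility are the form in which the normality of the two simple extensions
  and the conditions modulo p^2 enter.
\<close>

locale two_roots = p_prime_subring S p for S :: "'k::field_char_0 set" and p :: nat +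
  fixes \<alpha> \<beta> h1 h2 a b :: 'k
  assumes p3: "p \<ge> 3"
    and h1: "h1 \<in> S" and h2: "h2 \<in> S" and a: "a \<in> S" and b: "b \<in> S"
    and \<alpha>_eq: "(\<alpha> + h1) ^ p = h1 ^ p + of_nat p * a"
    and \<beta>_eq: "(\<beta> + h2) ^ p = h2 ^ p + of_nat p * b"
    and indep: "\<And>c. (\<And>i. c i \<in> quotients S) \<Longrightarrow>
        (\<Sum>i\<in>{..<p} \<times> {..<p}. c i * (\<lambda>(i, j). \<alpha> ^ i * \<beta> ^ j) i) = 0 \<Longrightarrow> \<forall>i\<in>{..<p} \<times> {..<p}. c i = 0"
    and closed: "\<And>u. u \<in> quotients S \<Longrightarrow> integral_elem S u \<Longrightarrow> u \<in> S"
    and a_nondiv: "a / of_nat p \<notin> S" and b_nondiv: "b / of_nat p \<notin> S" and h2_nondiv: "h2 / of_nat p \<notin> S"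
    and combination_nondiv: "\<And>i. i \<in> {1..p - 1} \<Longrightarrow> (a * h2 ^ p + of_nat i * b * h1 ^ p) / of_nat p \<notin> S"
begin

abbreviation idx :: "(nat \<times> nat) set" where "idx \<equiv> {..<p} \<times> {..<p}"

abbreviation mon :: "nat \<times> nat \<Rightarrow> 'k" where "mon \<equiv> \<lambda>(i, j). \<alpha> ^ i * \<beta> ^ j"

definition wt :: "nat \<times> nat \<Rightarrow> 'k" where "wt = (\<lambda>(i, j). if i + j < p then 1 else 1 / of_nat p)"

definition A where "A = fspan S idx mon"

text \<open>
  Locally at (p) both \<alpha>^p and \<beta>^p are p times a unit, so a monomial of total degree at least p has
  room for one division by p.
\<close>

definition M where "M = fspan S idx (\<lambda>i. wt i * mon i)"

lemma fin: "finite idx"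
  by simp

lemma \<alpha>_monic: obtains t where "\<And>i. t i \<in> S" "\<alpha> ^ p = (\<Sum>i<p. t i * \<alpha> ^ i)"
proof -
  obtain r where r: "\<And>k. r k \<in> S"
    "\<alpha> ^ p = of_nat p * (a - h1 ^ (p - 1) * \<alpha> - \<alpha> ^ 2 * (\<Sum>k<p - 2. r k * \<alpha> ^ k))"
    by (rule shifted_root_equation[OF prime_p p3 h1 \<alpha>_eq]) blast
  show thesis by (rule shifted_root_monic[OF p3 h1 a r]) (rule that)
qed

lemma \<beta>_monic: obtains t where "\<And>i. t i \<in> S" "\<beta> ^ p = (\<Sum>i<p. t i * \<beta> ^ i)"
proof -
  obtain r where r: "\<And>k. r k \<in> S"
    "\<beta> ^ p = of_nat p * (b - h2 ^ (p - 1) * \<beta> - \<beta> ^ 2 * (\<Sum>k<p - 2. r k * \<beta> ^ k))"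
    by (rule shifted_root_equation[OF prime_p p3 h2 \<beta>_eq]) blast
  show thesis by (rule shifted_root_monic[OF p3 h2 b r]) (rule that)
qed

lemma A_subring: "field_subring A"
proof -
  obtain t where t: "\<And>i. t i \<in> S" "\<alpha> ^ p = (\<Sum>i<p. t i * \<alpha> ^ i)" using \<alpha>_monic by blast
  obtain u where u: "\<And>i. u i \<in> S" "\<beta> ^ p = (\<Sum>i<p. u i * \<beta> ^ i)" using \<beta>_monic by blast
  show ?thesis unfolding A_def by (rule monomial_fspan_subring[OF t(2,1) u(2,1)])
qed

lemma mon_A: "\<alpha> ^ i * \<beta> ^ j \<in> A"
proof -
  obtain t where t: "\<And>i. t i \<in> S" "\<alpha> ^ p = (\<Sum>i<p. t i * \<alpha> ^ i)" using \<alpha>_monic by blast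
  obtain u where u: "\<And>i. u i \<in> S" "\<beta> ^ p = (\<Sum>i<p. u i * \<beta> ^ i)" using \<beta>_monic by blast
  show ?thesis unfolding A_def by (rule monomial_in_fspan[OF t(2,1) u(2,1)])
qed

interpretation A: field_subring A by (rule A_subring)

interpretation Q: field_subfield "quotients S" by (rule quotients_subfield)

lemma S_A: "S \<subseteq> A"
proof
  fix s assume "s \<in> S"
  then have "s * 1 \<in> A" using A.one_mem unfolding A_def by (rule fspan_scale)
  then show "s \<in> A" by simp
qed

lemma \<alpha>_A: "\<alpha> \<in> A" and \<beta>_A: "\<beta> \<in> A"
  using mon_A[of 1 0] mon_A[of 0 1] by simp_all

lemma root_form:
  assumes "h \<in> S" "c \<in> S" "(x + h) ^ p = h ^ p + of_nat p * c" "x \<in> A"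
  shows "\<exists>w\<in>A. x ^ p / of_nat p = c - h ^ (p - 1) * x - x ^ 2 * w"
proof -
  obtain r where r: "\<And>k. r k \<in> S"
    "x ^ p = of_nat p * (c - h ^ (p - 1) * x - x ^ 2 * (\<Sum>k<p - 2. r k * x ^ k))"
    by (rule shifted_root_equation[OF prime_p p3 assms(1,3)]) blast
  have "(\<Sum>k<p - 2. r k * x ^ k) \<in> A"
    using r(1) S_A assms(4) by (intro A.sum_mem A.mult_mem A.power_mem) auto
  moreover have "x ^ p / of_nat p = c - h ^ (p - 1) * x - x ^ 2 * (\<Sum>k<p - 2. r k * x ^ k)"
    unfolding r(2) using p_pos(2) by (rule nonzero_mult_div_cancel_left)
  ultimately show ?thesis by blast
qed

text \<open>
  The units that relate \<alpha>^p and \<beta>^p to p near the prime over p.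
\<close>

definition e1 :: 'k where "e1 = \<alpha> ^ p / of_nat p"
definition e2 :: 'k where "e2 = \<beta> ^ p / of_nat p"

lemma e1_form: "\<exists>w\<in>A. e1 = a - h1 ^ (p - 1) * \<alpha> - \<alpha> ^ 2 * w"
  unfolding e1_def by (rule root_form[OF h1 a \<alpha>_eq \<alpha>_A])

lemma e2_form: "\<exists>w\<in>A. e2 = b - h2 ^ (p - 1) * \<beta> - \<beta> ^ 2 * w"
  unfolding e2_def by (rule root_form[OF h2 b \<beta>_eq \<beta>_A])

lemma \<alpha>_pow: "\<alpha> ^ p = of_nat p * e1" and \<beta>_pow: "\<beta> ^ p = of_nat p * e2"
  using p_pos(2) by (simp_all add: e1_def e2_def)

lemma e1_A: "e1 \<in> A"
proof -
  obtain w where "w \<in> A" "e1 = a - h1 ^ (p - 1) * \<alpha> - \<alpha> ^ 2 * w" using e1_form by blast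
  moreover have "a \<in> A" "h1 \<in> A" using S_A a h1 by auto
  ultimately show ?thesis using \<alpha>_A by (simp only:) (intro A.diff_mem A.mult_mem A.power_mem)
qed

lemma e2_A: "e2 \<in> A"
proof -
  obtain w where "w \<in> A" "e2 = b - h2 ^ (p - 1) * \<beta> - \<beta> ^ 2 * w" using e2_form by blast
  moreover have "b \<in> A" "h2 \<in> A" using S_A b h2 by auto
  ultimately show ?thesis using \<beta>_A by (simp only:) (intro A.diff_mem A.mult_mem A.power_mem)
qed

lemma wt_Q: "wt i \<in> quotients S"
  unfolding wt_def by (auto simp: case_prod_unfold)

lemma wt_nonzero: "wt i \<noteq> 0"
  unfolding wt_def using p_pos(2) by (auto simp: case_prod_unfold)

lemma A_coord:
  assumes "\<And>i. c i \<in> quotients S" "(\<Sum>i\<in>idx. c i * mon i) \<in> A" "i \<in> idx"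
  shows "c i \<in> S"
  using assms unfolding A_def by (intro fspan_coord[of mon idx c i] indep)

lemma indep_wt:
  assumes c: "\<And>i. c i \<in> quotients S" and zero: "(\<Sum>i\<in>idx. c i * (wt i * mon i)) = 0"
  shows "\<forall>i\<in>idx. c i = 0"
proof -
  have "\<forall>i\<in>idx. c i * wt i = 0"
  proof (rule indep)
    show "c i * wt i \<in> quotients S" for i using c wt_Q by blast
    show "(\<Sum>i\<in>idx. c i * wt i * mon i) = 0" using zero by (simp only: mult.assoc)
  qed
  then show ?thesis using wt_nonzero by simp
qed

lemma nondiv_cancel_A:
  assumes "s \<in> S" "s / of_nat p \<notin> S" "x \<in> A" "s * x / of_nat p \<in> A"
  shows "x / of_nat p \<in> A"
  using assms unfolding A_def by (intro nondiv_cancel_fspan[of mon idx s x] indep)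

lemma nondiv_cancel_M:
  assumes "s \<in> S" "s / of_nat p \<notin> S" "x \<in> M" "s * x / of_nat p \<in> M"
  shows "x / of_nat p \<in> M"
  using assms unfolding M_def
  by (intro nondiv_cancel_fspan[of "\<lambda>i. wt i * mon i" idx s x] indep_wt)

text \<open>
  A power \<alpha>^p or \<beta>^p supplies a factor p.
\<close>

lemma mon_over_p_A:
  assumes "p \<le> i \<or> p \<le> j"
  shows "\<alpha> ^ i * \<beta> ^ j / of_nat p \<in> A"
proof (cases "p \<le> i")
  case True
  then have "\<alpha> ^ i = \<alpha> ^ (i - p) * (of_nat p * e1)" unfolding \<alpha>_pow[symmetric] by (simp flip: power_add)
  then have "\<alpha> ^ i * \<beta> ^ j / of_nat p = (\<alpha> ^ (i - p) * \<beta> ^ j) * e1" using p_pos(2) by simp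
  also have "\<dots> \<in> A" by (intro A.mult_mem mon_A e1_A)
  finally show ?thesis .
next
  case False
  then have "\<beta> ^ j = \<beta> ^ (j - p) * (of_nat p * e2)" using assms unfolding \<beta>_pow[symmetric] by (simp flip: power_add)
  then have "\<alpha> ^ i * \<beta> ^ j / of_nat p = (\<alpha> ^ i * \<beta> ^ (j - p)) * e2" using p_pos(2) by simp
  also have "\<dots> \<in> A" by (intro A.mult_mem mon_A e2_A)
  finally show ?thesis .
qed

lemma A_M: "A \<subseteq> M"
  unfolding A_def
proof (rule fspan_least)
  fix i assume i: "i \<in> idx"
  have base: "wt i * mon i \<in> M" unfolding M_def using fspan_base[OF fin i, of "\<lambda>i. wt i * mon i"] .
  have "mon i = (if fst i + snd i < p then 1 else of_nat p) * (wt i * mon i)"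
    using p_pos(2) by (simp add: wt_def case_prod_unfold)
  also have "\<dots> \<in> M" unfolding M_def by (rule fspan_scale) (use base in \<open>auto simp: M_def\<close>)
  finally show "mon i \<in> M" .
qed (auto simp: M_def intro: fspan_zero fspan_add fspan_scale)

lemma M_high:
  assumes "i + j \<ge> p"
  shows "\<alpha> ^ i * \<beta> ^ j / of_nat p \<in> M"
proof -
  show ?thesis
  proof (cases "p \<le> i \<or> p \<le> j")
    case True
    then show ?thesis using mon_over_p_A A_M by blast
  next
    case False
    then have ij: "(i, j) \<in> idx" by simp
    have "wt (i, j) * mon (i, j) \<in> M"
      unfolding M_def using fspan_base[OF fin ij, of "\<lambda>i. wt i * mon i"] .
    then show ?thesis using assms by (simp add: wt_def)
  qed
qed

lemma M_wt: "wt (i, j) * (\<alpha> ^ i * \<beta> ^ j) \<in> M"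
  using M_high[of i j] A_M mon_A[of i j] by (auto simp: wt_def)

lemma A_mult_M: "x \<in> A \<Longrightarrow> y \<in> M \<Longrightarrow> x * y \<in> M"
proof -
  have "mon i * (wt j * mon j) \<in> fspan S idx (\<lambda>i. wt i * mon i)" for i j
  proof -
    obtain i1 i2 j1 j2 where [simp]: "i = (i1, i2)" "j = (j1, j2)" by (cases i; cases j)
    have eq: "\<alpha> ^ (i1 + j1) * \<beta> ^ (i2 + j2) = mon i * mon j" by (simp add: power_add mult_ac)
    have "wt j * (\<alpha> ^ (i1 + j1) * \<beta> ^ (i2 + j2)) \<in> M"
    proof (cases "j1 + j2 < p")
      case True
      then show ?thesis using A_M mon_A by (auto simp: wt_def)
    next
      case False
      then show ?thesis using M_high[of "i1 + j1" "i2 + j2"] by (simp add: wt_def)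
    qed
    then show ?thesis unfolding eq by (simp only: M_def mult_ac)
  qed
  then show "x \<in> A \<Longrightarrow> y \<in> M \<Longrightarrow> x * y \<in> M"
    unfolding A_def M_def by (rule fspan_mult)
qed

text \<open>
  In the product of two divided monomials the total degree is at least 2 p, so one of the exponents
  reaches p; this cancels one of the two denominators and leaves enough degree for the other.
\<close>

lemma M_subring: "field_subring M"
  unfolding M_def
proof (rule fspan_subring)
  show "1 \<in> fspan S idx (\<lambda>i. wt i * mon i)"
    using A.one_mem A_M unfolding M_def by blast
  fix i j assume "i \<in> idx" "j \<in> idx"
  obtain i1 i2 j1 j2 where ij[simp]: "i = (i1, i2)" "j = (j1, j2)" by (cases i; cases j)
  have Mi: "wt i * mon i \<in> M" "wt j * mon j \<in> M" using M_wt by simp_all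
  consider "i1 + i2 < p" | "j1 + j2 < p" | "i1 + i2 \<ge> p" "j1 + j2 \<ge> p" by linarith
  then have "(wt i * mon i) * (wt j * mon j) \<in> M"
  proof cases
    case 1
    then have "wt i * mon i \<in> A" using mon_A by (simp add: wt_def)
    then show ?thesis using A_mult_M Mi by blast
  next
    case 2
    then have "wt j * mon j \<in> A" using mon_A by (simp add: wt_def)
    then have "(wt j * mon j) * (wt i * mon i) \<in> M" using A_mult_M Mi by blast
    then show ?thesis by (simp only: mult.commute)
  next
    case 3
    have prod: "(wt i * mon i) * (wt j * mon j)
        = \<alpha> ^ (i1 + j1) * \<beta> ^ (i2 + j2) / of_nat p / of_nat p"
      using 3 by (simp add: wt_def power_add)
    consider "i1 + j1 \<ge> p" | "i2 + j2 \<ge> p" using 3 by linarith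
    then show ?thesis
    proof cases
      case 1
      then have "\<alpha> ^ (i1 + j1) = \<alpha> ^ (i1 + j1 - p) * (of_nat p * e1)"
        unfolding \<alpha>_pow[symmetric] by (simp flip: power_add)
      then have "(wt i * mon i) * (wt j * mon j)
          = e1 * (\<alpha> ^ (i1 + j1 - p) * \<beta> ^ (i2 + j2) / of_nat p)"
        unfolding prod using p_pos(2) by simp
      then show ?thesis using A_mult_M[OF e1_A M_high[of "i1 + j1 - p" "i2 + j2"]] 3 1 by simp
    next
      case 2
      then have "\<beta> ^ (i2 + j2) = \<beta> ^ (i2 + j2 - p) * (of_nat p * e2)"
        unfolding \<beta>_pow[symmetric] by (simp flip: power_add)
      then have "(wt i * mon i) * (wt j * mon j)
          = e2 * (\<alpha> ^ (i1 + j1) * \<beta> ^ (i2 + j2 - p) / of_nat p)"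
        unfolding prod using p_pos(2) by simp
      then show ?thesis using A_mult_M[OF e2_A M_high[of "i1 + j1" "i2 + j2 - p"]] 3 2 by simp
    qed
  qed
  then show "(wt i * mon i) * (wt j * mon j) \<in> fspan S idx (\<lambda>i. wt i * mon i)"
    unfolding M_def .
qed

interpretation M: field_subring M by (rule M_subring)

lemma M_integral: "x \<in> M \<Longrightarrow> integral_elem S x"
  unfolding M_def by (rule integral_in_subring_fspan[OF fin M_subring[unfolded M_def]])

section \<open>Normality at (p)\<close>

text \<open>
  The ring B is compared with N, the localization at (p) of all integral elements of the ambient
  field. The link between them is that N and the fraction field of S have only V in common.
\<close>

definition V where "V = loc S"

definition B where "B = loc M"

definition N where "N = loc {x. integral_elem S x}"

interpretation V: p_local_subring V p
  unfolding V_def by (rule p_local_loc)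

lemma S_M: "S \<subseteq> M"
  using S_A A_M by blast

lemma B_subring: "field_subring B"
  unfolding B_def by (rule loc_subring[OF M_subring S_M])

interpretation B: field_subring B by (rule B_subring)

lemma integral_subring: "field_subring {x. integral_elem S x}"
  by (rule field_subringI) (auto intro: integral_self integral_diff integral_mult)

lemma N_subring: "field_subring N"
  unfolding N_def by (rule loc_subring[OF integral_subring]) (auto intro: integral_self)

interpretation N: field_subring N by (rule N_subring)

lemma V_B: "V \<subseteq> B" and B_N: "B \<subseteq> N" and S_V: "S \<subseteq> V" and M_B: "M \<subseteq> B"
  unfolding V_def B_def N_def
  using loc_mono[OF S_M] subset_loc[of S] subset_loc[of M] loc_mono[of M "{x. integral_elem S x}"]
    M_integral by blast+

lemma S_B: "S \<subseteq> B" and A_B: "A \<subseteq> B"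
  using V_B S_V A_M M_B by blast+

lemma V_N: "V \<subseteq> N"
  using V_B B_N by blast

lemma div_S_of_V:
  assumes "s \<in> S" "s / of_nat p \<in> V"
  shows "s / of_nat p \<in> S"
proof -
  obtain t where t: "t \<in> S" "t / of_nat p \<notin> S" "t * (s / of_nat p) \<in> S"
    using assms(2) unfolding V_def by (rule locE)
  then show ?thesis using p_mult[OF t(1) assms(1)] by simp
qed

lemma div_V_of_N:
  assumes "v \<in> V" "v / of_nat p \<in> N"
  shows "v / of_nat p \<in> V"
proof -
  obtain s where s: "s \<in> S" "s / of_nat p \<notin> S" "s * v \<in> S"
    using assms(1) unfolding V_def by (rule locE)
  obtain t where t: "t \<in> S" "t / of_nat p \<notin> S" "t * (v / of_nat p) \<in> {x. integral_elem S x}"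
    using assms(2) unfolding N_def by (rule locE)
  have "t * (s * v) \<in> S" using t(1) s(3) by (rule mult_mem)
  then have "t * (s * v) / of_nat p \<in> quotients S" using subset_quotients by (intro Q.divide_mem) auto
  then have q: "(s * t) * (v / of_nat p) \<in> quotients S" by (simp add: mult_ac)
  have "integral_elem S (s * (t * (v / of_nat p)))" using integral_mult[OF integral_self[OF s(1)]] t(3) by blast
  then have "integral_elem S ((s * t) * (v / of_nat p))" by (simp only: mult.assoc)
  then have "(s * t) * (v / of_nat p) \<in> S" using closed[OF q] by blast
  then show ?thesis unfolding V_def by (intro locI[OF mult_mem[OF s(1) t(1)] nondiv_mult[OF s(1) t(1) s(2) t(2)]])
qed

lemma inverse_nondiv: "s \<in> S \<Longrightarrow> s / of_nat p \<notin> S \<Longrightarrow> inverse s \<in> V"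
  unfolding V_def by (rule inverse_mem_loc)

text \<open>
  The element e2 = b - \<beta> x is a unit near p: modulo e2 the nonzero constant b^p is the p-th power
  of \<beta> x, which is itself a multiple of \<beta>^p and hence of e2.
\<close>

lemma e2_unit: "e2 \<noteq> 0" "inverse e2 \<in> B"
proof -
  obtain w where w: "w \<in> A" "e2 = b - h2 ^ (p - 1) * \<beta> - \<beta> ^ 2 * w" using e2_form by blast
  define x where "x = h2 ^ (p - 1) + \<beta> * w"
  have x: "x \<in> A" unfolding x_def using w(1) \<beta>_A S_A h2 by blast
  have e2: "e2 = b - \<beta> * x" unfolding w(2) x_def by (simp add: algebra_simps power2_eq_square)
  define q where "q = (\<Sum>i<p. (\<beta> * x) ^ (p - Suc i) * b ^ i)"
  have q: "q \<in> A" unfolding q_def using x \<beta>_A S_A b by (intro A.sum_mem A.mult_mem A.power_mem) auto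
  have "b ^ p - (\<beta> * x) ^ p = e2 * q" unfolding e2 q_def by (rule power_diff_sumr2)
  moreover have "(\<beta> * x) ^ p = of_nat p * e2 * x ^ p" unfolding power_mult_distrib \<beta>_pow ..
  ultimately have bp: "b ^ p = e2 * (q + of_nat p * x ^ p)" by (simp add: algebra_simps)
  have nd: "b ^ p / of_nat p \<notin> S" using div_power[OF b] b_nondiv by blast
  then have b0: "b ^ p \<noteq> 0" using div_zero by metis
  then show e0: "e2 \<noteq> 0" using bp by auto
  have "inverse e2 = (q + of_nat p * x ^ p) * inverse (b ^ p)"
    using bp b0 e0 by (simp add: field_simps)
  moreover have "q + of_nat p * x ^ p \<in> B" using q x A_B by blast
  moreover have "inverse (b ^ p) \<in> B" using inverse_nondiv[OF power_mem[OF b] nd] V_B by blast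
  ultimately show "inverse e2 \<in> B" using B.mult_mem by simp
qed

lemma \<beta>_nonzero: "\<beta> \<noteq> 0"
proof
  assume "\<beta> = 0"
  then have "\<beta> ^ p = 0" using p_pos(1) by (simp add: zero_power)
  then show False unfolding \<beta>_pow using e2_unit(1) p_pos(2) by simp
qed

lemma \<beta>_B: "\<beta> \<in> B"
  using \<beta>_A A_B by blast

lemma p_over_\<beta>_power:
  assumes "n \<le> p"
  shows "of_nat p / \<beta> ^ n \<in> B"
proof -
  have "of_nat p = \<beta> ^ p * inverse e2" unfolding \<beta>_pow using e2_unit(1) by simp
  also have "\<beta> ^ p = \<beta> ^ (p - n) * \<beta> ^ n" using assms by (simp flip: power_add)
  finally have "of_nat p / \<beta> ^ n = \<beta> ^ (p - n) * inverse e2" using \<beta>_nonzero by simp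
  then show ?thesis using \<beta>_B e2_unit(2) by auto
qed

lemma p_over_\<beta>: "of_nat p / \<beta> \<in> B"
  using p_over_\<beta>_power[of 1] p_pos by simp

lemma p_mult_over_\<beta>: "x \<in> B \<Longrightarrow> of_nat p * x / \<beta> \<in> B"
  using B.mult_mem[OF p_over_\<beta>, of x] by simp

text \<open>
  Since p is a unit times \<beta>^p, divisibility by \<beta> of v gives divisibility by p of v^p, and (p) is
  prime.
\<close>

lemma div_V_of_\<beta>:
  assumes "v \<in> V" "v / \<beta> \<in> N"
  shows "v / of_nat p \<in> V"
proof -
  have "(v / \<beta>) ^ p * e2 \<in> N" using assms(2) e2_A A_B B_N by blast
  moreover have "(v / \<beta>) ^ p * e2 = v ^ p / of_nat p"
    unfolding power_divide \<beta>_pow using e2_unit(1) p_pos(2) by simp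
  ultimately have "v ^ p / of_nat p \<in> V" using div_V_of_N[OF V.power_mem[OF assms(1)]] by simp
  then show ?thesis using V.div_power[OF assms(1)] by blast
qed

lemma over_\<beta>_of_div: "v / of_nat p \<in> V \<Longrightarrow> v / \<beta> \<in> B"
  using p_mult_over_\<beta>[of "v / of_nat p"] V_B p_pos(2) by auto

text \<open>
  Both \<alpha> and \<beta> have order one, so T is integral at (p); its p-th power is congruent to
  c = a / b modulo \<beta>.
\<close>

definition T where "T = \<alpha> / \<beta>"

lemma T_B: "T \<in> B"
proof -
  have "\<beta> ^ p = \<beta> ^ (p - 1) * \<beta>" using p_pos(1) by (metis power_minus_mult)
  then have "T = (\<alpha> * \<beta> ^ (p - 1)) / (of_nat p * e2)"
    unfolding T_def \<beta>_pow[symmetric] using \<beta>_nonzero by simp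
  then have "T = (\<alpha> ^ 1 * \<beta> ^ (p - 1) / of_nat p) * inverse e2" by (simp add: divide_inverse mult_ac)
  moreover have "\<alpha> ^ 1 * \<beta> ^ (p - 1) / of_nat p \<in> M" by (rule M_high) simp
  ultimately show ?thesis using M_B B.mult_mem[OF _ e2_unit(2)] by (simp only:) blast
qed

lemma \<alpha>_power: "\<alpha> ^ n = \<beta> ^ n * T ^ n"
  using \<beta>_nonzero by (simp add: T_def power_divide)

lemma e1_form_B: "\<exists>x\<in>B. e1 = a - h1 ^ (p - 1) * \<beta> * T - \<beta> ^ 2 * x"
proof -
  obtain w where w: "w \<in> A" "e1 = a - h1 ^ (p - 1) * \<alpha> - \<alpha> ^ 2 * w" using e1_form by blast
  have "e1 = a - h1 ^ (p - 1) * \<beta> * T - \<beta> ^ 2 * (T ^ 2 * w)"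
    using w(2) \<alpha>_power[of 1] \<alpha>_power[of 2] by (simp add: mult_ac)
  moreover have "T ^ 2 * w \<in> B" using T_B w(1) A_B by blast
  ultimately show ?thesis by blast
qed

lemma e2_form_B: "\<exists>x\<in>B. e2 = b - h2 ^ (p - 1) * \<beta> - \<beta> ^ 2 * x"
  using e2_form A_B by blast

lemma T_pow: "e2 * T ^ p = e1"
  unfolding T_def power_divide \<alpha>_pow \<beta>_pow using e2_unit(1) p_pos(2) by simp

definition c where "c = a * inverse b"

lemma b_nonzero: "b \<noteq> 0"
  using b_nondiv div_zero by metis

lemma c_V: "c \<in> V"
  unfolding c_def using inverse_nondiv[OF b b_nondiv] a S_V by blast

lemma c_b: "c * b = a"
  unfolding c_def using b_nonzero by simp

lemma T_pow_c: "(T ^ p - c) / \<beta> \<in> B"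
proof -
  obtain x1 where x1: "x1 \<in> B" "e1 = a - h1 ^ (p - 1) * \<beta> * T - \<beta> ^ 2 * x1" using e1_form_B by blast
  obtain x2 where x2: "x2 \<in> B" "e2 = b - h2 ^ (p - 1) * \<beta> - \<beta> ^ 2 * x2" using e2_form_B by blast
  define y where "y = c * (h2 ^ (p - 1) + \<beta> * x2) - (h1 ^ (p - 1) * T + \<beta> * x1)"
  have y: "y \<in> B" unfolding y_def
    using c_V V_B h1 h2 S_B x1(1) x2(1) T_B \<beta>_B by (intro B.diff_mem B.mult_mem B.add_mem B.power_mem) auto
  have "e2 * (T ^ p - c) = e1 - c * e2" unfolding right_diff_distrib T_pow by (simp add: mult_ac)
  also have "\<dots> = (c * b - h1 ^ (p - 1) * \<beta> * T - \<beta> ^ 2 * x1) - c * (b - h2 ^ (p - 1) * \<beta> - \<beta> ^ 2 * x2)"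
    by (simp only: x1(2)[symmetric] x2(2)[symmetric] c_b)
  also have "\<dots> = \<beta> * y"
    unfolding y_def by (simp add: algebra_simps power2_eq_square)
  finally have "(T ^ p - c) / \<beta> = inverse e2 * y"
    using e2_unit(1) \<beta>_nonzero by (simp add: field_simps)
  then show ?thesis using e2_unit(2) y by auto
qed

text \<open>
  Written in terms of \<beta> and T, the basis of M consists of T^i \<beta>^(i+j) and T^i \<beta>^(i+j-p) e2. Modulo \<beta>
  only the monomial 1 and those with i + j = p survive, and the latter become b T^i. The shift by
  \<gamma> serves the case in which T - \<gamma> is nilpotent modulo \<beta>.
\<close>

lemma B_decomposition:
  assumes \<gamma>: "\<gamma> \<in> V" and x: "x \<in> B"
  shows "\<exists>z w. (\<forall>j. z j \<in> V) \<and> w \<in> B \<and> x = (\<Sum>j<p. z j * (T - \<gamma>) ^ j) + \<beta> * w"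
proof -
  define G where "G = fspan V {..<p} (\<lambda>j. (T - \<gamma>) ^ j)"
  define D where "D = {u + \<beta> * w | u w. u \<in> G \<and> w \<in> B}"
  have DI: "u + \<beta> * w \<in> D" if "u \<in> G" "w \<in> B" for u w unfolding D_def using that by blast
  have D_add: "y + y' \<in> D" if "y \<in> D" "y' \<in> D" for y y'
  proof -
    obtain u w u' w' where *: "u \<in> G" "w \<in> B" "y = u + \<beta> * w" "u' \<in> G" "w' \<in> B" "y' = u' + \<beta> * w'"
      using \<open>y \<in> D\<close> \<open>y' \<in> D\<close> unfolding D_def by blast
    have "y + y' = (u + u') + \<beta> * (w + w')" using * by (simp add: algebra_simps)
    moreover have "u + u' \<in> G" using * V.fspan_add unfolding G_def by blast
    ultimately show ?thesis using DI * B.add_mem by metis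
  qed
  have D_scale: "v * y \<in> D" if "v \<in> V" "y \<in> D" for v y
  proof -
    obtain u w where *: "u \<in> G" "w \<in> B" "y = u + \<beta> * w"
      using \<open>y \<in> D\<close> unfolding D_def by blast
    have "v * y = v * u + \<beta> * (v * w)" using * by (simp add: algebra_simps)
    moreover have "v * u \<in> G" using * that V.fspan_scale unfolding G_def by blast
    moreover have "v * w \<in> B" using * that V_B by blast
    ultimately show ?thesis using DI by metis
  qed
  have zero: "0 \<in> G" unfolding G_def by (rule V.fspan_zero)
  have D_\<beta>: "\<beta> * w \<in> D" if "w \<in> B" for w using DI[OF zero that] by simp
  have D_T: "T ^ i \<in> D" if i: "i < p" for i
  proof -
    have "T ^ i = ((T - \<gamma>) + \<gamma>) ^ i" by simp
    also have "\<dots> = (\<Sum>k\<le>i. (of_nat (i choose k) * \<gamma> ^ (i - k)) * (T - \<gamma>) ^ k)"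
      unfolding binomial_ring by (intro sum.cong) (auto simp: mult_ac)
    also have "\<dots> \<in> G" unfolding G_def
    proof (intro V.fspan_sum V.fspan_scale)
      fix k assume "k \<in> {..i}"
      then have "k \<in> {..<p}" using i by simp
      then show "(T - \<gamma>) ^ k \<in> fspan V {..<p} (\<lambda>j. (T - \<gamma>) ^ j)"
        using V.fspan_base[of "{..<p}" k "\<lambda>j. (T - \<gamma>) ^ j"] by simp
    qed (use \<gamma> in blast)
    finally have "T ^ i + \<beta> * 0 \<in> D" by (intro DI) auto
    then show ?thesis by simp
  qed
  obtain x2 where x2: "x2 \<in> B" "e2 = b - h2 ^ (p - 1) * \<beta> - \<beta> ^ 2 * x2" using e2_form_B by blast
  have e2B: "e2 \<in> B" using e2_A A_B by blast
  have base: "wt i * mon i \<in> D" if "i \<in> idx" for i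
  proof -
    obtain j k where i: "i = (j, k)" "j < p" "k < p" using \<open>i \<in> idx\<close> by auto
    have m: "mon i = T ^ j * \<beta> ^ (j + k)" using \<alpha>_power[of j] by (simp add: i power_add mult_ac)
    consider "j + k = 0" | "0 < j + k" "j + k < p" | "j + k = p" | "j + k > p" by linarith
    then show ?thesis
    proof cases
      case 1
      then show ?thesis using D_T[of 0] p_pos(1) by (simp add: i wt_def)
    next
      case 2
      then obtain l where l: "j + k = Suc l" by (cases "j + k") auto
      have "wt i * mon i = \<beta> * (T ^ j * \<beta> ^ l)" using 2 unfolding m by (simp add: i wt_def l mult_ac)
      then show ?thesis using D_\<beta>[of "T ^ j * \<beta> ^ l"] T_B \<beta>_B by auto
    next
      case 3
      have "wt i * mon i = T ^ j * e2" unfolding m 3 \<beta>_pow using p_pos(2) 3 by (simp add: i wt_def)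
      also have "\<dots> = b * T ^ j + \<beta> * (- (T ^ j * (h2 ^ (p - 1) + \<beta> * x2)))"
        unfolding x2(2) by (simp add: algebra_simps power2_eq_square)
      finally have "wt i * mon i = b * T ^ j + \<beta> * (- (T ^ j * (h2 ^ (p - 1) + \<beta> * x2)))" .
      moreover have "b * T ^ j \<in> D" using D_scale[OF _ D_T[OF i(2)]] b S_V by blast
      moreover have "\<beta> * (- (T ^ j * (h2 ^ (p - 1) + \<beta> * x2))) \<in> D"
        using T_B \<beta>_B x2(1) h2 S_B by (intro D_\<beta>) blast
      ultimately show ?thesis by (simp only: D_add)
    next
      case 4
      then obtain l where l: "j + k = p + Suc l" using less_imp_Suc_add by auto
      have "wt i * mon i = \<beta> * (T ^ j * e2 * \<beta> ^ l)"
        unfolding m l power_add \<beta>_pow using p_pos(2) 4 l by (simp add: i wt_def mult_ac)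
      then show ?thesis using D_\<beta>[of "T ^ j * e2 * \<beta> ^ l"] T_B \<beta>_B e2B by auto
    qed
  qed
  have "M \<subseteq> D" unfolding M_def
    by (rule fspan_least[OF base]) (use D_\<beta>[of 0] D_add D_scale S_V in auto)
  obtain s where s: "s \<in> S" "s / of_nat p \<notin> S" "s * x \<in> M" "s \<noteq> 0" using x unfolding B_def by (rule locE)
  have "inverse s * (s * x) \<in> D" using inverse_nondiv[OF s(1,2)] s(3) \<open>M \<subseteq> D\<close> by (intro D_scale[of "inverse s"]) auto
  moreover have "inverse s * (s * x) = x" using s(4) by simp
  ultimately have "x \<in> D" by (simp only:)
  then obtain u w where uw: "u \<in> G" "w \<in> B" "x = u + \<beta> * w" unfolding D_def by blast
  obtain z where "\<And>j. z j \<in> V" "u = (\<Sum>j<p. z j * (T - \<gamma>) ^ j)"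
    using uw(1) unfolding G_def by (elim fspanE) blast
  then show ?thesis using uw by blast
qed

lemma over_\<beta>_add: "x / \<beta> \<in> B \<Longrightarrow> y / \<beta> \<in> B \<Longrightarrow> (x + y) / \<beta> \<in> B"
  unfolding add_divide_distrib by (rule B.add_mem)

lemma over_\<beta>_mult: "x / \<beta> \<in> B \<Longrightarrow> y \<in> B \<Longrightarrow> x * y / \<beta> \<in> B"
  using B.mult_mem[of "x / \<beta>" y] by simp

lemma p_odd: "odd p"
  using prime_p p3 prime_odd_nat by auto

text \<open>
  Modulo \<beta> the ring B has characteristic p and is generated over V by T, whose p-th power is
  congruent to an element of V.
\<close>

lemma pow_p_mod_\<beta>:
  assumes "x \<in> B"
  shows "\<exists>v\<in>V. (x ^ p - v) / \<beta> \<in> B"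
proof -
  define G where "G = {x \<in> B. \<exists>v\<in>V. (x ^ p - v) / \<beta> \<in> B}"
  have G_V: "V \<subseteq> G" unfolding G_def using V_B by (auto intro!: bexI[of _ "_ ^ p"])
  have G_T: "T \<in> G" unfolding G_def using T_B T_pow_c c_V by blast
  have G_\<beta>: "\<beta> * w \<in> G" if "w \<in> B" for w
  proof -
    have "\<beta> ^ p = \<beta> ^ (p - 1) * \<beta>" using p_pos(1) by (metis power_minus_mult)
    then have "((\<beta> * w) ^ p - 0) / \<beta> = \<beta> ^ (p - 1) * w ^ p" using \<beta>_nonzero by (simp add: power_mult_distrib)
    also have "\<dots> \<in> B" using \<beta>_B that by blast
    finally have "((\<beta> * w) ^ p - 0) / \<beta> \<in> B" .
    moreover have "0 \<in> V" by (rule V.zero_mem)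
    moreover have "\<beta> * w \<in> B" using \<beta>_B that by (rule B.mult_mem)
    ultimately show ?thesis unfolding G_def by blast
  qed
  have G_add: "x + y \<in> G" if "x \<in> G" "y \<in> G" for x y
  proof -
    obtain v v' where *: "x \<in> B" "v \<in> V" "(x ^ p - v) / \<beta> \<in> B" "y \<in> B" "v' \<in> V" "(y ^ p - v') / \<beta> \<in> B"
      using \<open>x \<in> G\<close> \<open>y \<in> G\<close> unfolding G_def by blast
    obtain w where w: "w \<in> B" "(x + y) ^ p = x ^ p + y ^ p + of_nat p * w"
      using B.freshman_dream[OF prime_p *(1,4)] .
    have "((x ^ p - v) + (y ^ p - v') + of_nat p * w) / \<beta> \<in> B"
      by (intro over_\<beta>_add * p_mult_over_\<beta> w)
    moreover have "(x ^ p - v) + (y ^ p - v') + of_nat p * w = (x + y) ^ p - (v + v')" using w(2) by simp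
    ultimately have "((x + y) ^ p - (v + v')) / \<beta> \<in> B" by simp
    moreover have "v + v' \<in> V" "x + y \<in> B" using * by blast+
    ultimately show ?thesis unfolding G_def by blast
  qed
  have G_mult: "x * y \<in> G" if "x \<in> G" "y \<in> G" for x y
  proof -
    obtain v v' where *: "x \<in> B" "v \<in> V" "(x ^ p - v) / \<beta> \<in> B" "y \<in> B" "v' \<in> V" "(y ^ p - v') / \<beta> \<in> B"
      using \<open>x \<in> G\<close> \<open>y \<in> G\<close> unfolding G_def by blast
    have "((x ^ p - v) * y ^ p + (y ^ p - v') * v) / \<beta> \<in> B"
      using * V_B by (intro over_\<beta>_add over_\<beta>_mult) auto
    moreover have "(x ^ p - v) * y ^ p + (y ^ p - v') * v = (x * y) ^ p - v * v'"
      by (simp add: algebra_simps power_mult_distrib)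
    ultimately have "((x * y) ^ p - v * v') / \<beta> \<in> B" by simp
    moreover have "v * v' \<in> V" "x * y \<in> B" using * by blast+
    ultimately show ?thesis unfolding G_def by blast
  qed
  have G_pow: "T ^ n \<in> G" for n
    by (induction n) (use G_T G_mult G_V V.one_mem in auto)
  have G_sum: "sum h J \<in> G" if "\<And>j. j \<in> J \<Longrightarrow> h j \<in> G" for h and J :: "nat set"
    using that by (induction J rule: infinite_finite_induct) (use G_V V.zero_mem G_add in auto)
  obtain z w where z: "\<forall>j. z j \<in> V" "w \<in> B" "x = (\<Sum>j<p. z j * (T - 0) ^ j) + \<beta> * w"
    using B_decomposition[OF V.zero_mem assms] by blast
  have "x \<in> G" unfolding z(3) diff_0_right
    using z G_V by (intro G_add G_sum G_mult G_pow G_\<beta>) auto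
  then show ?thesis unfolding G_def by blast
qed

lemma sum_over_\<beta>:
  assumes "\<And>j. j < p \<Longrightarrow> z j / of_nat p \<in> V" "t \<in> B"
  shows "(\<Sum>j<p. z j * t ^ j) / \<beta> \<in> B"
proof -
  have "(\<Sum>j<p. (z j / \<beta>) * t ^ j) \<in> B"
    using assms over_\<beta>_of_div by (intro B.sum_mem B.mult_mem B.power_mem) auto
  moreover have "(\<Sum>j<p. (z j / \<beta>) * t ^ j) = (\<Sum>j<p. z j * t ^ j) / \<beta>"
    unfolding sum_divide_distrib by (intro sum.cong) auto
  ultimately show ?thesis by simp
qed

lemma over_\<beta>_N_add: "x / \<beta> \<in> N \<Longrightarrow> y / \<beta> \<in> N \<Longrightarrow> (x + y) / \<beta> \<in> N"
  unfolding add_divide_distrib by (rule N.add_mem)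

lemma over_\<beta>_N_diff: "x / \<beta> \<in> N \<Longrightarrow> y / \<beta> \<in> N \<Longrightarrow> (x - y) / \<beta> \<in> N"
  unfolding diff_divide_distrib by (rule N.diff_mem)

lemma over_\<beta>_N_mult: "x / \<beta> \<in> N \<Longrightarrow> y \<in> N \<Longrightarrow> x * y / \<beta> \<in> N"
  using N.mult_mem[of "x / \<beta>" y] by simp

text \<open>
  When c has no p-th root modulo p, the quotient of B by \<beta> is a field; the polynomials whose
  value at T is nilpotent modulo \<beta> form the prime ideal to which the lemma on pure equations
  applies.
\<close>

lemma coefficients_div_if_not_power:
  assumes no_root: "\<And>\<gamma>. \<gamma> \<in> V \<Longrightarrow> (\<gamma> ^ p - c) / of_nat p \<notin> V"
    and z: "\<And>j. z j \<in> V" and sum: "(\<Sum>j<p. z j * T ^ j) / \<beta> \<in> N" and "j < p"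
  shows "z j / of_nat p \<in> V"
proof -
  define I where "I q \<longleftrightarrow> V.coeffs_in q \<and> poly q T ^ p / \<beta> \<in> N" for q
  have polyB: "poly q T \<in> B" if "V.coeffs_in q" for q
    unfolding poly_altdef using that V_B T_B
    by (intro B.sum_mem B.mult_mem B.power_mem) (auto simp: V.coeffs_in_def)
  have pow_over: "x ^ p / \<beta> \<in> N" if "x / \<beta> \<in> N" for x
  proof -
    have "x \<in> N" using N.mult_mem[OF that, of \<beta>] \<beta>_B B_N \<beta>_nonzero by auto
    moreover have "x ^ p = x * x ^ (p - 1)" using p_pos(1) by (metis power_eq_if not_gr0)
    ultimately show ?thesis using over_\<beta>_N_mult[OF that, of "x ^ (p - 1)"] by auto
  qed
  have poly_over: "poly q T / \<beta> \<in> N" if "V.coeffs_div q" for q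
  proof -
    have "(\<Sum>i\<le>degree q. (coeff q i / \<beta>) * T ^ i) \<in> B"
      using that over_\<beta>_of_div T_B
      by (intro B.sum_mem B.mult_mem B.power_mem) (auto simp: V.coeffs_div_def)
    moreover have "(\<Sum>i\<le>degree q. (coeff q i / \<beta>) * T ^ i) = poly q T / \<beta>"
      unfolding poly_altdef sum_divide_distrib by (intro sum.cong) auto
    ultimately show ?thesis using B_N by auto
  qed
  define q where "q = (\<Sum>j<p. Polynomial.monom (z j) j)"
  have cq: "coeff q i = (if i < p then z i else 0)" for i
  proof -
    have "coeff q i = (\<Sum>j<p. if j = i then z j else 0)" by (simp add: q_def coeff_sum)
    then show ?thesis by simp
  qed
  have "V.coeffs_div q"
  proof (rule V.radical_of_pure_equation[of I c])
    show "V.coeffs_in r" if "I r" for r using that by (simp add: I_def)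
    show "I r" if "V.coeffs_div r" "V.coeffs_in r" for r
      unfolding I_def using that pow_over[OF poly_over] by blast
    show "I (r + s)" if "I r" "I s" for r s
    proof -
      have rs: "V.coeffs_in r" "V.coeffs_in s" using that by (auto simp: I_def)
      obtain w where w: "w \<in> B" "(poly r T + poly s T) ^ p = poly r T ^ p + poly s T ^ p + of_nat p * w"
        using B.freshman_dream[OF prime_p polyB[OF rs(1)] polyB[OF rs(2)]] .
      have "of_nat p * w / \<beta> \<in> N" using p_mult_over_\<beta>[OF w(1)] B_N by blast
      then have "poly (r + s) T ^ p / \<beta> \<in> N"
        unfolding poly_add w(2) using that unfolding I_def by (intro over_\<beta>_N_add) auto
      then show ?thesis using V.coeffs_in_simps(3)[OF rs] by (simp add: I_def)
    qed
    show "I (r * s)" if "V.coeffs_in r" "I s" for r s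
    proof -
      have s: "V.coeffs_in s" "poly s T ^ p / \<beta> \<in> N" using that by (auto simp: I_def)
      have "poly r T ^ p \<in> N" using polyB[OF that(1)] B_N by blast
      then have "poly s T ^ p * poly r T ^ p / \<beta> \<in> N" using s(2) by (intro over_\<beta>_N_mult)
      then show ?thesis using V.coeffs_in_mult[OF that(1) s(1)]
        by (simp add: I_def power_mult_distrib mult.commute)
    qed
    show "I r \<or> I s" if "V.coeffs_in r" "V.coeffs_in s" "I (r * s)" for r s
    proof -
      obtain v where v: "v \<in> V" "(poly r T ^ p - v) / \<beta> \<in> B" using pow_p_mod_\<beta>[OF polyB[OF \<open>V.coeffs_in r\<close>]] by blast
      obtain w where w: "w \<in> V" "(poly s T ^ p - w) / \<beta> \<in> B" using pow_p_mod_\<beta>[OF polyB[OF \<open>V.coeffs_in s\<close>]] by blast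
      have "poly r T ^ p * poly s T ^ p / \<beta> \<in> N"
        using that(3) by (simp add: I_def power_mult_distrib)
      moreover have "((poly r T ^ p - v) * poly s T ^ p) / \<beta> \<in> N" "((poly s T ^ p - w) * v) / \<beta> \<in> N"
        using v w polyB[OF that(2)] B_N V_B by (auto intro!: over_\<beta>_N_mult)
      ultimately have "(poly r T ^ p * poly s T ^ p - (poly r T ^ p - v) * poly s T ^ p
          - (poly s T ^ p - w) * v) / \<beta> \<in> N"
        by (intro over_\<beta>_N_diff)
      moreover have "poly r T ^ p * poly s T ^ p - (poly r T ^ p - v) * poly s T ^ p
          - (poly s T ^ p - w) * v = v * w"
        by (simp add: algebra_simps)
      ultimately have "v * w / \<beta> \<in> N" by (simp only:)
      then have "v / of_nat p \<in> V \<or> w / of_nat p \<in> V"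
        using div_V_of_\<beta>[OF V.mult_mem[OF v(1) w(1)]] V.p_mult[OF v(1) w(1)] by blast
      then have "v / \<beta> \<in> B \<or> w / \<beta> \<in> B" using over_\<beta>_of_div by blast
      then have "((poly r T ^ p - v) + v) / \<beta> \<in> B \<or> ((poly s T ^ p - w) + w) / \<beta> \<in> B"
        using over_\<beta>_add[OF v(2), of v] over_\<beta>_add[OF w(2), of w] by blast
      then show ?thesis using that(1,2) B_N by (auto simp: I_def)
    qed
    show "v / of_nat p \<in> V" if "I [:v:]" for v
    proof -
      have v: "v \<in> V" using that by (auto simp: I_def V.coeffs_in_def coeff_pCons dest: spec[of _ 0])
      have "v ^ p / \<beta> \<in> N" using that by (simp add: I_def)
      then have "v ^ p / of_nat p \<in> V" using div_V_of_\<beta>[OF V.power_mem[OF v]] by blast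
      then show ?thesis by (rule V.div_power[OF v])
    qed
    show "I (Polynomial.monom 1 p - [:c:])"
    proof -
      have "poly (Polynomial.monom 1 p - [:c:]) T = T ^ p - c" by (simp add: poly_monom)
      moreover have "(T ^ p - c) / \<beta> \<in> N" using T_pow_c B_N by blast
      ultimately show ?thesis unfolding I_def using pow_over c_V
        by (auto intro!: V.coeffs_in_simps)
    qed
    show "c \<in> V" by (rule c_V)
    show "(\<gamma> ^ p - c) / of_nat p \<notin> V" if "\<gamma> \<in> V" for \<gamma> by (rule no_root[OF that])
    have "poly q T = (\<Sum>j<p. z j * T ^ j)" by (simp add: q_def poly_sum poly_monom)
    moreover have "V.coeffs_in q" using z by (auto simp: V.coeffs_in_def cq)
    ultimately show "I q" unfolding I_def using pow_over[OF sum] by simp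
    have "degree q \<le> p - 1" by (intro degree_le) (auto simp: cq)
    then show "degree q < p" using p_pos(1) by linarith
  qed
  then have "coeff q j / of_nat p \<in> V" unfolding V.coeffs_div_def by blast
  then show ?thesis using \<open>j < p\<close> by (simp add: cq)
qed

text \<open>
  The coefficient that governs (T - \<gamma>)^p when \<gamma> is a p-th root of c modulo p. It equals
  \<gamma> ((\<gamma> h2)^(p-1) - h1^(p-1)); if it were divisible by p, then \<gamma> h2 would be congruent to i h1 for
  some i from the prime field. Raising this to the p-th power and multiplying by b would give
  a h2^p = i b h1^p modulo p.
\<close>

definition \<delta> where "\<delta> \<gamma> = \<gamma> ^ p * h2 ^ (p - 1) - h1 ^ (p - 1) * \<gamma>"

lemma \<delta>_nondiv:
  assumes \<gamma>: "\<gamma> \<in> V" "(\<gamma> ^ p - c) / of_nat p \<in> V"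
  shows "\<delta> \<gamma> / of_nat p \<notin> V"
proof
  assume d: "\<delta> \<gamma> / of_nat p \<in> V"
  have V': "h1 \<in> V" "h2 \<in> V" "a \<in> V" "b \<in> V" using S_V h1 h2 a b by auto
  have h2n: "h2 / of_nat p \<notin> V" using div_S_of_V[OF h2] h2_nondiv by blast
  have p1: "p - 1 \<noteq> 0" using p3 by simp
  have gp: "\<gamma> ^ p = \<gamma> * \<gamma> ^ (p - 1)" using p_pos(1) by (metis power_eq_if not_gr0)
  have \<gamma>n: "\<gamma> / of_nat p \<notin> V"
  proof
    assume "\<gamma> / of_nat p \<in> V"
    then have "\<gamma> ^ p / of_nat p \<in> V" unfolding gp using \<gamma>(1) by (intro V.div_mult) auto
    then have "c / of_nat p \<in> V" using V.div_cong[OF _ \<gamma>(2)] by blast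
    then have "c * b / of_nat p \<in> V" using V'(4) by (rule V.div_mult)
    then show False unfolding c_b using div_S_of_V[OF a] a_nondiv by blast
  qed
  define x where "x = \<gamma> * h2"
  have x: "x \<in> V" unfolding x_def using \<gamma>(1) V'(2) by blast
  have "\<delta> \<gamma> = \<gamma> * (x ^ (p - 1) - h1 ^ (p - 1))"
    unfolding \<delta>_def gp x_def by (simp add: algebra_simps power_mult_distrib)
  then have eq: "(x ^ (p - 1) - h1 ^ (p - 1)) / of_nat p \<in> V"
    using d V.p_mult[OF \<gamma>(1), of "x ^ (p - 1) - h1 ^ (p - 1)"] \<gamma>n x V'(1) by auto
  show False
  proof (cases "h1 / of_nat p \<in> V")
    case True
    have "p - 1 = Suc (p - 2)" using p3 by simp
    then have "h1 ^ (p - 1) = h1 * h1 ^ (p - 2)" by (simp only: power_Suc)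
    then have "h1 ^ (p - 1) / of_nat p \<in> V" using V.div_mult[OF True V.power_mem[OF V'(1)]] by simp
    then have "(x ^ (p - 1) - h1 ^ (p - 1) + h1 ^ (p - 1)) / of_nat p \<in> V" using eq by (intro V.div_add)
    then have "x / of_nat p \<in> V" using V.div_power[OF x] by simp
    then show False unfolding x_def using V.p_mult[OF \<gamma>(1) V'(2)] \<gamma>n h2n by blast
  next
    case False
    obtain i where i: "i \<in> {1..p - 1}" "(x - of_nat i * h1) / of_nat p \<in> V"
      using V.prime_field_ratio[OF x V'(1) False eq] .
    define y where "y = of_nat i * h1"
    have y: "y \<in> V" unfolding y_def using V'(1) by blast
    have "x ^ p - y ^ p = (x - y) * (\<Sum>k<p. y ^ (p - Suc k) * x ^ k)" by (rule power_diff_sumr2)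
    moreover have "(\<Sum>k<p. y ^ (p - Suc k) * x ^ k) \<in> V" using x y by (intro V.sum_mem V.mult_mem V.power_mem)
    ultimately have 1: "(x ^ p - y ^ p) / of_nat p \<in> V" using V.div_mult i(2) unfolding y_def by simp
    have "\<not> p dvd i" using i(1) p3 by (auto dest: dvd_imp_le)
    then have "(of_nat i ^ (p - 1) - 1) / of_nat p \<in> V" by (rule V.fermat_little)
    then have "(of_nat i ^ (p - 1) - 1) * (of_nat i * h1 ^ p) / of_nat p \<in> V"
      using V'(1) by (intro V.div_mult) auto
    moreover have "(of_nat i ^ (p - 1) - 1) * (of_nat i * h1 ^ p) = y ^ p - of_nat i * h1 ^ p"
    proof -
      have "(of_nat i :: 'k) ^ p = of_nat i * of_nat i ^ (p - 1)" using p_pos(1) by (metis power_eq_if not_gr0)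
      then show ?thesis unfolding y_def power_mult_distrib by (simp add: algebra_simps)
    qed
    ultimately have 2: "(y ^ p - of_nat i * h1 ^ p) / of_nat p \<in> V" by simp
    have 3: "(\<gamma> ^ p - c) * h2 ^ p / of_nat p \<in> V" using \<gamma>(2) V'(2) by (intro V.div_mult) auto
    have "((x ^ p - y ^ p) + (y ^ p - of_nat i * h1 ^ p) - (\<gamma> ^ p - c) * h2 ^ p) / of_nat p \<in> V"
      by (intro V.div_diff V.div_add 1 2 3)
    moreover have "(x ^ p - y ^ p) + (y ^ p - of_nat i * h1 ^ p) - (\<gamma> ^ p - c) * h2 ^ p
        = c * h2 ^ p - of_nat i * h1 ^ p"
      unfolding x_def by (simp add: algebra_simps power_mult_distrib)
    ultimately have "(c * h2 ^ p - of_nat i * h1 ^ p) / of_nat p \<in> V" by (simp only:)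
    then have "(c * h2 ^ p - of_nat i * h1 ^ p) * b / of_nat p \<in> V" using V'(4) by (rule V.div_mult)
    moreover have "of_nat p * (b * h1 ^ p) / of_nat p \<in> V" using V' by (intro V.div_p) auto
    ultimately have "((c * h2 ^ p - of_nat i * h1 ^ p) * b + of_nat p * (b * h1 ^ p)) / of_nat p \<in> V"
      by (rule V.div_add)
    moreover have "(c * h2 ^ p - of_nat i * h1 ^ p) * b + of_nat p * (b * h1 ^ p)
        = (c * b) * h2 ^ p + of_nat (p - i) * b * h1 ^ p"
    proof -
      have "i \<le> p" using i(1) unfolding atLeastAtMost_iff by linarith
      then have d: "of_nat (p - i) = (of_nat p - of_nat i :: 'k)" by (rule of_nat_diff)
      show ?thesis unfolding d by (simp add: algebra_simps)
    qed
    ultimately have "(a * h2 ^ p + of_nat (p - i) * b * h1 ^ p) / of_nat p \<in> V" unfolding c_b by simp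
    then have "(a * h2 ^ p + of_nat (p - i) * b * h1 ^ p) / of_nat p \<in> S"
      using a b h1 h2 by (intro div_S_of_V add_mem mult_mem power_mem) auto
    moreover have "p - i \<in> {1..p - 1}" using i(1) by auto
    ultimately show False using combination_nondiv by blast
  qed
qed

text \<open>
  Up to the factor e2 and modulo \<beta>^2, the p-th power of T - \<gamma> is the difference of the equations
  for \<alpha>^p / p and \<gamma>^p \<beta>^p / p. The constant terms a and \<gamma>^p b cancel modulo p, and p is divisible by
  \<beta>^2, so the terms linear in \<beta> decide.
\<close>

lemma \<theta>_power:
  assumes \<gamma>: "\<gamma> \<in> V" "(\<gamma> ^ p - c) / of_nat p \<in> V"
  shows "\<exists>x\<in>B. e2 * (T - \<gamma>) ^ p = \<beta> * (\<delta> \<gamma> - h1 ^ (p - 1) * (T - \<gamma>) + \<beta> * x)"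
proof -
  obtain x1 where x1: "x1 \<in> B" "e1 = a - h1 ^ (p - 1) * \<beta> * T - \<beta> ^ 2 * x1" using e1_form_B by blast
  obtain x2 where x2: "x2 \<in> B" "e2 = b - h2 ^ (p - 1) * \<beta> - \<beta> ^ 2 * x2" using e2_form_B by blast
  have \<gamma>B: "\<gamma> \<in> B" using \<gamma>(1) V_B by blast
  obtain w where w: "w \<in> B" "(T - \<gamma>) ^ p = T ^ p - \<gamma> ^ p + of_nat p * w"
    using B.freshman_dream_diff[OF prime_p p_odd T_B \<gamma>B] .
  define k where "k = (\<gamma> ^ p - c) / of_nat p"
  have k: "k \<in> B" "\<gamma> ^ p = c + of_nat p * k" using \<gamma>(2) V_B p_pos(2) by (auto simp: k_def)
  define q where "q = of_nat p / \<beta> ^ 2"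
  have q: "q \<in> B" "of_nat p = \<beta> ^ 2 * q"
    using p_over_\<beta>_power[of 2] p3 \<beta>_nonzero by (auto simp: q_def)
  define x where "x = - b * q * k - x1 + \<gamma> ^ p * x2 + q * w * e2"
  have "x \<in> B" unfolding x_def
    using b S_B q(1) k(1) x1(1) x2(1) \<gamma>B w(1) e2_A A_B
    by (intro B.add_mem B.diff_mem B.mult_mem B.uminus_mem B.power_mem) auto
  have "e2 * (T - \<gamma>) ^ p = e1 - \<gamma> ^ p * e2 + of_nat p * w * e2"
    unfolding w(2) T_pow[symmetric] by (simp add: algebra_simps)
  also have "\<dots> = (e1 - a) - \<gamma> ^ p * (e2 - b) - b * of_nat p * k + of_nat p * w * e2"
  proof -
    have "\<gamma> ^ p * b = a + b * of_nat p * k" unfolding k(2) using c_b by (simp add: algebra_simps)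
    then show ?thesis by (simp add: algebra_simps)
  qed
  also have "e1 - a = - (h1 ^ (p - 1) * \<beta> * T) - \<beta> ^ 2 * x1" using x1(2) by simp
  also have "e2 - b = - (h2 ^ (p - 1) * \<beta>) - \<beta> ^ 2 * x2" using x2(2) by simp
  also have "- (h1 ^ (p - 1) * \<beta> * T) - \<beta> ^ 2 * x1 - \<gamma> ^ p * (- (h2 ^ (p - 1) * \<beta>) - \<beta> ^ 2 * x2)
      - b * of_nat p * k + of_nat p * w * e2
      = \<beta> * (\<delta> \<gamma> - h1 ^ (p - 1) * (T - \<gamma>) + \<beta> * x)"
    unfolding x_def \<delta>_def q(2) by (simp add: algebra_simps power2_eq_square)
  finally show ?thesis using \<open>x \<in> B\<close> by blast
qed

text \<open>
  In this case T - \<gamma> generates the maximal ideal of B: by the formula for its p-th power,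
  \<beta> is a unit times (T - \<gamma>)^p. In particular (T - \<gamma>)^(p-1) is not divisible by \<beta>, even after
  normalization.
\<close>

lemma \<theta>_power_nondiv:
  assumes \<gamma>: "\<gamma> \<in> V" "(\<gamma> ^ p - c) / of_nat p \<in> V"
  shows "(T - \<gamma>) ^ (p - 1) / \<beta> \<notin> N"
proof
  define \<theta> where "\<theta> = T - \<gamma>"
  assume r: "(T - \<gamma>) ^ (p - 1) / \<beta> \<in> N"
  define r where "r = \<theta> ^ (p - 1) / \<beta>"
  have rN: "r \<in> N" using r by (simp add: r_def \<theta>_def)
  obtain x where x: "x \<in> B" "e2 * \<theta> ^ p = \<beta> * (\<delta> \<gamma> - h1 ^ (p - 1) * \<theta> + \<beta> * x)"
    using \<theta>_power[OF \<gamma>] unfolding \<theta>_def by blast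
  have N': "x \<in> N" "\<theta> \<in> N" "\<beta> \<in> N" "e2 \<in> N" "h1 \<in> N" "inverse e2 \<in> N"
    using x(1) B_N T_B V_B \<gamma>(1) \<beta>_B e2_A A_B S_B h1 e2_unit(2) unfolding \<theta>_def by auto
  have gp: "\<theta> ^ p = \<theta> ^ (p - 1) * \<theta>" using p_pos(1) by (metis power_minus_mult)
  have "\<theta> ^ p = \<beta> * (r * \<theta>)" unfolding gp r_def using \<beta>_nonzero by simp
  then have "\<beta> * (e2 * (r * \<theta>)) = \<beta> * (\<delta> \<gamma> - h1 ^ (p - 1) * \<theta> + \<beta> * x)"
    using x(2) by (simp add: mult_ac)
  then have "e2 * (r * \<theta>) = \<delta> \<gamma> - h1 ^ (p - 1) * \<theta> + \<beta> * x" using \<beta>_nonzero by simp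
  then have \<delta>: "\<delta> \<gamma> = \<theta> * (e2 * r + h1 ^ (p - 1)) + \<beta> * (- x)" by (simp add: algebra_simps)
  define r1 where "r1 = e2 * r + h1 ^ (p - 1)"
  have r1: "r1 \<in> N" unfolding r1_def using N' rN by blast
  have m: "\<theta> * r1 \<in> N" "\<beta> * (- x) \<in> N" using N' r1 by blast+
  obtain w where w: "w \<in> N" "(\<theta> * r1 + \<beta> * (- x)) ^ p = (\<theta> * r1) ^ p + (\<beta> * (- x)) ^ p + of_nat p * w"
    using N.freshman_dream[OF prime_p m] .
  have over: "\<theta> ^ p / \<beta> \<in> N" unfolding \<open>\<theta> ^ p = \<beta> * (r * \<theta>)\<close> using \<beta>_nonzero N.mult_mem[OF rN N'(2)] by simp
  have bp: "\<beta> ^ p = \<beta> ^ (p - 1) * \<beta>" using p_pos(1) by (metis power_minus_mult)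
  have "\<beta> ^ p / \<beta> \<in> N" unfolding bp using \<beta>_nonzero N.power_mem[OF N'(3), of "p - 1"] by simp
  then have "(\<theta> ^ p * r1 ^ p + \<beta> ^ p * (- x) ^ p + of_nat p * w) / \<beta> \<in> N"
    using over r1 N'(1) p_over_\<beta> B_N w(1) by (intro over_\<beta>_N_add over_\<beta>_N_mult) auto
  then have "\<delta> \<gamma> ^ p / \<beta> \<in> N"
    unfolding \<delta> r1_def[symmetric] w(2) power_mult_distrib .
  moreover have \<delta>V: "\<delta> \<gamma> \<in> V" unfolding \<delta>_def using \<gamma>(1) S_V h1 h2 by blast
  ultimately have "\<delta> \<gamma> ^ p / of_nat p \<in> V" using div_V_of_\<beta> by blast
  then have "\<delta> \<gamma> / of_nat p \<in> V" by (rule V.div_power[OF \<delta>V])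
  then show False using \<delta>_nondiv[OF \<gamma>] by blast
qed

text \<open>
  Multiplying by (T - \<gamma>)^(p-1-m), where m is the first index with a coefficient not divisible by p,
  moves all later terms beyond (T - \<gamma>)^p, a multiple of \<beta>, and leaves a unit times (T - \<gamma>)^(p-1).
\<close>

lemma coefficients_div_if_power:
  assumes \<gamma>: "\<gamma> \<in> V" "(\<gamma> ^ p - c) / of_nat p \<in> V"
    and z: "\<And>j. z j \<in> V" and sum: "(\<Sum>j<p. z j * (T - \<gamma>) ^ j) / \<beta> \<in> N" and "j < p"
  shows "z j / of_nat p \<in> V"
proof (rule ccontr)
  define \<theta> where "\<theta> = T - \<gamma>"
  define P where "P j \<longleftrightarrow> j < p \<and> z j / of_nat p \<notin> V" for j
  define m where "m = (LEAST j. P j)"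
  assume "z j / of_nat p \<notin> V"
  then have "P j" using \<open>j < p\<close> by (simp add: P_def)
  then have "P m" unfolding m_def by (rule LeastI)
  then have m: "m < p" "z m / of_nat p \<notin> V" by (auto simp: P_def)
  have below: "z i / of_nat p \<in> V" if "i < m" for i
    using not_less_Least[of i P] that m(1) unfolding m_def P_def by auto
  have \<theta>B: "\<theta> \<in> B" unfolding \<theta>_def using T_B \<gamma>(1) V_B by blast
  obtain x where x: "x \<in> B" "e2 * \<theta> ^ p = \<beta> * (\<delta> \<gamma> - h1 ^ (p - 1) * \<theta> + \<beta> * x)"
    using \<theta>_power[OF \<gamma>] unfolding \<theta>_def by blast
  have \<delta>V: "\<delta> \<gamma> \<in> V" unfolding \<delta>_def using \<gamma>(1) S_V h1 h2 by blast
  have "\<theta> ^ p / \<beta> = inverse e2 * (\<delta> \<gamma> - h1 ^ (p - 1) * \<theta> + \<beta> * x)"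
    using x(2) e2_unit(1) \<beta>_nonzero by (simp add: field_simps)
  moreover have "\<dots> \<in> B"
    using e2_unit(2) \<delta>V V_B h1 S_B \<theta>B x(1) \<beta>_B
    by (intro B.mult_mem B.add_mem B.diff_mem B.power_mem) auto
  ultimately have \<theta>p: "\<theta> ^ p / \<beta> \<in> B" by simp
  let ?h = "\<lambda>i. z i * \<theta> ^ (i + (p - 1 - m))"
  have "(\<Sum>i<p. z i * \<theta> ^ i) * \<theta> ^ (p - 1 - m) / \<beta> \<in> N"
    using sum \<theta>B B_N unfolding \<theta>_def[symmetric] by (intro over_\<beta>_N_mult) auto
  then have total: "(\<Sum>i<p. ?h i) / \<beta> \<in> N"
    by (simp add: sum_distrib_right power_add mult.assoc)
  have "(\<Sum>i\<in>{..<p} - {m}. ?h i / \<beta>) \<in> B"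
  proof (rule B.sum_mem)
    fix i assume i: "i \<in> {..<p} - {m}"
    show "?h i / \<beta> \<in> B"
    proof (cases "i < m")
      case True
      have "(z i / \<beta>) * \<theta> ^ (i + (p - 1 - m)) \<in> B"
        using over_\<beta>_of_div[OF below[OF True]] \<theta>B by blast
      then show ?thesis by simp
    next
      case False
      define l where "l = i - Suc m"
      have l: "i + (p - 1 - m) = p + l" using False i m(1) by (simp add: l_def)
      have "(\<theta> ^ p / \<beta>) * (z i * \<theta> ^ l) \<in> B" using \<theta>p z V_B \<theta>B by blast
      then show ?thesis unfolding l power_add by (simp add: mult_ac)
    qed
  qed
  then have rest: "(\<Sum>i\<in>{..<p} - {m}. ?h i) / \<beta> \<in> N" unfolding sum_divide_distrib using B_N by blast
  have "(\<Sum>i<p. ?h i) = ?h m + (\<Sum>i\<in>{..<p} - {m}. ?h i)" using m(1) by (intro sum.remove) auto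
  then have "?h m = (\<Sum>i<p. ?h i) - (\<Sum>i\<in>{..<p} - {m}. ?h i)" by simp
  then have "?h m / \<beta> \<in> N" using over_\<beta>_N_diff[OF total rest] by simp
  moreover have "m + (p - 1 - m) = p - 1" using m(1) by simp
  ultimately have hm: "z m * \<theta> ^ (p - 1) / \<beta> \<in> N" by simp
  have "inverse (z m) \<in> N" using V.inverse_or_div[OF z m(2)] V_N by blast
  then have "z m * \<theta> ^ (p - 1) * inverse (z m) / \<beta> \<in> N" by (rule over_\<beta>_N_mult[OF hm])
  moreover have "z m \<noteq> 0" using m(2) V.div_zero by metis
  then have "z m * \<theta> ^ (p - 1) * inverse (z m) = \<theta> ^ (p - 1)" by simp
  ultimately have "\<theta> ^ (p - 1) / \<beta> \<in> N" by (simp only:)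
  then show False using \<theta>_power_nondiv[OF \<gamma>] unfolding \<theta>_def by blast
qed

lemma over_\<beta>_B_of_N:
  assumes "u \<in> B" "u / \<beta> \<in> N"
  shows "u / \<beta> \<in> B"
proof -
  have "\<exists>\<gamma>\<in>V. \<forall>z. (\<forall>j. z j \<in> V) \<longrightarrow> (\<Sum>j<p. z j * (T - \<gamma>) ^ j) / \<beta> \<in> N \<longrightarrow> (\<forall>j<p. z j / of_nat p \<in> V)"
  proof (cases "\<exists>\<gamma>\<in>V. (\<gamma> ^ p - c) / of_nat p \<in> V")
    case True
    then show ?thesis using coefficients_div_if_power by blast
  next
    case False
    then have "\<forall>z. (\<forall>j. z j \<in> V) \<longrightarrow> (\<Sum>j<p. z j * (T - 0) ^ j) / \<beta> \<in> N \<longrightarrow> (\<forall>j<p. z j / of_nat p \<in> V)"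
      unfolding diff_0_right using coefficients_div_if_not_power by blast
    then show ?thesis using V.zero_mem by blast
  qed
  then obtain \<gamma> where \<gamma>: "\<gamma> \<in> V"
    "\<And>z. (\<forall>j. z j \<in> V) \<Longrightarrow> (\<Sum>j<p. z j * (T - \<gamma>) ^ j) / \<beta> \<in> N \<Longrightarrow> (\<forall>j<p. z j / of_nat p \<in> V)"
    by blast
  obtain z w where z: "\<forall>j. z j \<in> V" "w \<in> B" "u = (\<Sum>j<p. z j * (T - \<gamma>) ^ j) + \<beta> * w"
    using B_decomposition[OF \<gamma>(1) assms(1)] by blast
  have u: "u / \<beta> = (\<Sum>j<p. z j * (T - \<gamma>) ^ j) / \<beta> + w"
    unfolding z(3) using \<beta>_nonzero by (simp add: add_divide_distrib)
  have "(\<Sum>j<p. z j * (T - \<gamma>) ^ j) / \<beta> = u / \<beta> - w" using u by simp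
  moreover have "u / \<beta> - w \<in> N" using assms(2) z(2) B_N by blast
  ultimately have "\<forall>j<p. z j / of_nat p \<in> V" using \<gamma>(2)[OF z(1)] by simp
  moreover have "T - \<gamma> \<in> B" using T_B \<gamma>(1) V_B by blast
  ultimately have "(\<Sum>j<p. z j * (T - \<gamma>) ^ j) / \<beta> \<in> B" by (intro sum_over_\<beta>) auto
  then show ?thesis unfolding u using z(2) by blast
qed

text \<open>
  As p is a unit times \<beta>^p, division by p can be carried out as p successive divisions by \<beta>, each of
  which stays in B.
\<close>

lemma div_M_of_integral:
  assumes "x \<in> M" "integral_elem S (x / of_nat p)"
  shows "x / of_nat p \<in> M"
proof -
  have xN: "x / of_nat p \<in> N" using assms(2) subset_loc unfolding N_def by blast
  have "x / \<beta> ^ n \<in> B" if "n \<le> p" for n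
    using that
  proof (induction n)
    case 0
    then show ?case using assms(1) M_B by auto
  next
    case (Suc n)
    have "(x / of_nat p) * (of_nat p / \<beta> ^ Suc n) \<in> N"
      using xN p_over_\<beta>_power[OF Suc.prems] B_N by blast
    then have "x / \<beta> ^ n / \<beta> \<in> N" using p_pos(2) by (simp add: mult.commute)
    then have "x / \<beta> ^ n / \<beta> \<in> B" using Suc by (intro over_\<beta>_B_of_N) auto
    then show ?case by (simp add: mult.commute)
  qed
  then have "x / \<beta> ^ p * e2 \<in> B" using e2_A A_B by blast
  then have "x / of_nat p \<in> B" unfolding \<beta>_pow using e2_unit(1) by simp
  then obtain s where "s \<in> S" "s / of_nat p \<notin> S" "s * (x / of_nat p) \<in> M"
    unfolding B_def by (rule locE)
  then show ?thesis using nondiv_cancel_M[OF _ _ assms(1)] by simp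
qed

section \<open>The prime over p, its symbolic powers and the conductor\<close>

text \<open>
  For n up to p this is the filtration of A by order along the prime over p: \<alpha> and \<beta> have order
  one, and p, being a unit times \<alpha>^p near that prime, has order p.
\<close>

definition lev :: "nat \<Rightarrow> nat \<times> nat \<Rightarrow> 'k" where "lev n = (\<lambda>(i, j). if n \<le> i + j then 1 else of_nat p)"

definition F :: "nat \<Rightarrow> 'k set" where "F n = fspan S idx (\<lambda>i. lev n i * mon i)"

lemma F_add: "x \<in> F n \<Longrightarrow> y \<in> F n \<Longrightarrow> x + y \<in> F n"
  and F_scale: "s \<in> S \<Longrightarrow> x \<in> F n \<Longrightarrow> s * x \<in> F n"
  and F_zero: "0 \<in> F n"
  unfolding F_def by (rule fspan_add fspan_scale fspan_zero; assumption)+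

lemma F_0: "F 0 = A"
  unfolding F_def A_def lev_def by (simp add: case_prod_unfold)

lemma F_base:
  assumes "(i, j) \<in> idx"
  shows "lev n (i, j) * (\<alpha> ^ i * \<beta> ^ j) \<in> F n"
  using fspan_base[OF fin assms, of "\<lambda>i. lev n i * mon i"] unfolding F_def by simp

lemma lev_A: "lev n i \<in> A"
  unfolding lev_def using A.of_nat_mem A.one_mem by (auto simp: case_prod_unfold)

lemma F_A: "F n \<subseteq> A"
  unfolding F_def
proof (rule fspan_least)
  fix i assume "i \<in> idx"
  have "mon i \<in> A" using mon_A by (cases i) simp
  then show "lev n i * mon i \<in> A" by (rule A.mult_mem[OF lev_A])
qed (use S_A in auto)

lemma p_A_F:
  assumes "x \<in> A"
  shows "of_nat p * x \<in> F n"
proof -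
  have "A \<subseteq> {x. of_nat p * x \<in> F n}"
    unfolding A_def
  proof (rule fspan_least)
    fix i assume i: "i \<in> idx"
    obtain j k where jk: "i = (j, k)" by (cases i)
    have base: "lev n i * mon i \<in> F n" using F_base[of j k n] i jk by simp
    show "mon i \<in> {x. of_nat p * x \<in> F n}"
      using base F_scale[OF of_nat_mem base, of p] by (auto simp: lev_def jk split: if_splits)
  qed (auto simp: F_zero distrib_left F_add mult.left_commute F_scale)
  then show ?thesis using assms by blast
qed

lemma mon_F:
  assumes "n \<le> i + j"
  shows "\<alpha> ^ i * \<beta> ^ j \<in> F n"
proof (cases "(i, j) \<in> idx")
  case True
  then show ?thesis using F_base[OF True, of n] assms by (simp add: lev_def)
next
  case False
  then have "of_nat p * (\<alpha> ^ i * \<beta> ^ j / of_nat p) \<in> F n" by (intro p_A_F mon_over_p_A) auto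
  then show ?thesis using p_pos(2) by simp
qed

text \<open>
  Orders add up. A generator that carries the factor p causes no loss, because p A is contained in
  every step of the filtration.
\<close>

lemma F_mult:
  assumes "x \<in> F m" "y \<in> F n"
  shows "x * y \<in> F (m + n)"
proof -
  have "(lev m i * mon i) * (lev n j * mon j) \<in> F (m + n)" for i j
  proof -
    obtain i1 i2 j1 j2 where ij: "i = (i1, i2)" "j = (j1, j2)" by (cases i; cases j)
    let ?w = "\<alpha> ^ (i1 + j1) * \<beta> ^ (i2 + j2)"
    have w: "?w = mon i * mon j" by (simp add: ij power_add)
    consider "m \<le> i1 + i2" "n \<le> j1 + j2" | "\<not> m \<le> i1 + i2" | "\<not> n \<le> j1 + j2" by blast
    then show ?thesis
    proof cases
      case 1
      then have "?w \<in> F (m + n)" by (intro mon_F) simp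
      then show ?thesis using 1 unfolding w by (simp add: lev_def ij)
    next
      case 2
      have "lev n j * ?w \<in> A" by (rule A.mult_mem[OF lev_A mon_A])
      then have "of_nat p * (lev n j * ?w) \<in> F (m + n)" by (rule p_A_F)
      moreover have "of_nat p * (lev n j * ?w) = (lev m i * mon i) * (lev n j * mon j)"
        unfolding w using 2 by (simp add: lev_def ij)
      ultimately show ?thesis by (simp only:)
    next
      case 3
      have "lev m i * ?w \<in> A" by (rule A.mult_mem[OF lev_A mon_A])
      then have "of_nat p * (lev m i * ?w) \<in> F (m + n)" by (rule p_A_F)
      moreover have "of_nat p * (lev m i * ?w) = (lev m i * mon i) * (lev n j * mon j)"
        unfolding w using 3 by (simp add: lev_def ij mult_ac)
      ultimately show ?thesis by (simp only:)
    qed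
  qed
  then show ?thesis using assms unfolding F_def
    by (rule fspan_mult[of idx idx "\<lambda>i. lev m i * mon i" "\<lambda>i. lev n i * mon i" idx "\<lambda>i. lev (m + n) i * mon i"])
qed

lemma F_mult_A: "x \<in> A \<Longrightarrow> y \<in> F n \<Longrightarrow> x * y \<in> F n"
  using F_mult[of x 0 y n] F_0 by simp

lemma F_coord:
  assumes d: "\<And>i. d i \<in> quotients S" and x: "(\<Sum>i\<in>idx. d i * mon i) \<in> F n"
    and ij: "(i, j) \<in> idx" "i + j < n"
  shows "d (i, j) / of_nat p \<in> S"
proof -
  obtain e where e: "\<And>i. e i \<in> S" "(\<Sum>i\<in>idx. d i * mon i) = (\<Sum>i\<in>idx. e i * (lev n i * mon i))"
    using x unfolding F_def by (elim fspanE) blast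
  have lQ: "lev n i \<in> quotients S" for i unfolding lev_def by (auto simp: case_prod_unfold)
  have "\<forall>i\<in>idx. d i - e i * lev n i = 0"
  proof (rule indep)
    show "d i - e i * lev n i \<in> quotients S" for i
      using d e(1) subset_quotients lQ by blast
    show "(\<Sum>i\<in>idx. (d i - e i * lev n i) * mon i) = 0"
      using e(2) by (simp only: left_diff_distrib sum_subtractf mult.assoc diff_self)
  qed
  then have "d (i, j) - e (i, j) * lev n (i, j) = 0" using ij(1) by (rule bspec)
  then have "d (i, j) = e (i, j) * of_nat p" using ij(2) by (simp add: lev_def)
  then show ?thesis using e(1) p_pos(2) by simp
qed

definition P where "P = F 1"

lemma A_constant:
  assumes "x \<in> A"
  shows "\<exists>s\<in>S. x - s \<in> P"
proof -
  have "A \<subseteq> {x. \<exists>s\<in>S. x - s \<in> P}"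
    unfolding A_def
  proof (rule fspan_least)
    fix i assume i: "i \<in> idx"
    obtain j k where jk: "i = (j, k)" by (cases i)
    show "mon i \<in> {x. \<exists>s\<in>S. x - s \<in> P}"
    proof (cases "j + k = 0")
      case True
      then show ?thesis using F_zero[of 1] by (auto simp: jk P_def intro!: bexI[of _ 1])
    next
      case False
      then have "1 \<le> j + k" by linarith
      then have "\<alpha> ^ j * \<beta> ^ k \<in> P" unfolding P_def by (rule mon_F)
      then show ?thesis by (auto simp: jk intro!: bexI[of _ 0])
    qed
  next
    show "0 \<in> {x. \<exists>s\<in>S. x - s \<in> P}" using F_zero[of 1] by (auto simp: P_def intro!: bexI[of _ 0])
  next
    fix x y assume "x \<in> {x. \<exists>s\<in>S. x - s \<in> P}" "y \<in> {x. \<exists>s\<in>S. x - s \<in> P}"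
    then obtain s t where "s \<in> S" "x - s \<in> P" "t \<in> S" "y - t \<in> P" by blast
    moreover from this have "(x - s) + (y - t) \<in> P" unfolding P_def by (intro F_add)
    ultimately show "x + y \<in> {x. \<exists>s\<in>S. x - s \<in> P}"
      by (auto intro!: bexI[of _ "s + t"] simp: algebra_simps)
  next
    fix r x assume r: "r \<in> S" and "x \<in> {x. \<exists>s\<in>S. x - s \<in> P}"
    then obtain s where "s \<in> S" "x - s \<in> P" by blast
    moreover from this have "r * (x - s) \<in> P" unfolding P_def using r by (intro F_scale)
    ultimately show "r * x \<in> {x. \<exists>s\<in>S. x - s \<in> P}"
      using r by (auto intro!: bexI[of _ "r * s"] simp: algebra_simps)
  qed
  then show ?thesis using assms by blast
qed

lemma S_inter_P:
  assumes "s \<in> S" "s \<in> P"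
  shows "s / of_nat p \<in> S"
proof -
  define d where "d = (\<lambda>i :: nat \<times> nat. if i = (0, 0) then s else 0)"
  have "(\<Sum>i\<in>idx. d i * mon i) = (\<Sum>i\<in>idx. if i = (0, 0) then s else 0)"
    by (intro sum.cong) (auto simp: d_def)
  also have "\<dots> = s" using p_pos(1) by (simp add: sum.delta[OF fin])
  finally have "(\<Sum>i\<in>idx. d i * mon i) = s" .
  then have "d (0, 0) / of_nat p \<in> S"
    using assms p_pos(1) subset_quotients unfolding P_def
    by (intro F_coord[of d 1]) (auto simp: d_def)
  then show ?thesis by (simp add: d_def)
qed

lemma p_P: "of_nat p \<in> P"
  using p_A_F[OF A.one_mem] unfolding P_def by simp

lemma P_mult: "s \<in> A \<Longrightarrow> x \<in> P \<Longrightarrow> s * x \<in> P"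
  unfolding P_def by (rule F_mult_A)

lemma P_diff: "x \<in> P \<Longrightarrow> y \<in> P \<Longrightarrow> x - y \<in> P"
  using F_add[of x 1 "(- 1) * y"] F_scale[of "- 1" y 1] unfolding P_def by simp

text \<open>
  Modulo P every element of A is congruent to a constant, and P meets S in (p).
\<close>

lemma P_prime: "A.prime_in P"
  unfolding A.prime_in_def
proof (intro conjI ballI impI)
  show "P \<subseteq> A" unfolding P_def by (rule F_A)
  show "0 \<in> P" unfolding P_def by (rule F_zero)
  show "1 \<notin> P" using S_inter_P[of 1] p_nonunit by auto
  show "x + y \<in> P" if "x \<in> P" "y \<in> P" for x y using that unfolding P_def by (rule F_add)
  show "s * x \<in> P" if "s \<in> A" "x \<in> P" for s x using that by (rule P_mult)
  fix x y assume xy: "x \<in> A" "y \<in> A" "x * y \<in> P"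
  obtain s where s: "s \<in> S" "x - s \<in> P" using A_constant[OF xy(1)] by blast
  obtain t where t: "t \<in> S" "y - t \<in> P" using A_constant[OF xy(2)] by blast
  have in_P: "of_nat p * u \<in> P" if "u \<in> S" for u using that S_A P_mult[OF _ p_P, of u] by (auto simp: mult.commute)
  have "x * y - y * (x - s) - s * (y - t) \<in> P"
    using P_diff[OF P_diff[OF xy(3) P_mult[OF xy(2) s(2)]] P_mult[OF _ t(2), of s]] s(1) S_A by blast
  then have "s * t \<in> P" by (simp add: algebra_simps)
  then have "s / of_nat p \<in> S \<or> t / of_nat p \<in> S"
    using S_inter_P[of "s * t"] p_mult s(1) t(1) by blast
  then have "s \<in> P \<or> t \<in> P"
    using in_P[of "s / of_nat p"] in_P[of "t / of_nat p"] p_pos(2) by auto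
  then have "(x - s) + s \<in> P \<or> (y - t) + t \<in> P" using s(2) t(2) F_add unfolding P_def by blast
  then show "x \<in> P \<or> y \<in> P" by simp
qed

text \<open>
  A prime containing p contains \<alpha>^p and \<beta>^p, both multiples of p.
\<close>

lemma P_contained:
  assumes "A.prime_in Q" "of_nat p \<in> Q"
  shows "P \<subseteq> Q"
proof -
  note D = A.prime_inD[OF assms(1)]
  have "\<alpha> ^ p \<in> Q" "\<beta> ^ p \<in> Q"
    unfolding \<alpha>_pow \<beta>_pow using D(5)[OF e1_A assms(2)] D(5)[OF e2_A assms(2)] by simp_all
  then have ab: "\<alpha> \<in> Q" "\<beta> \<in> Q"
    using A.prime_in_power[OF assms(1) \<alpha>_A] A.prime_in_power[OF assms(1) \<beta>_A] by blast+
  show ?thesis unfolding P_def F_def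
  proof (rule fspan_least)
    fix i assume "i \<in> idx"
    obtain j k where jk: "i = (j, k)" by (cases i)
    show "lev 1 i * mon i \<in> Q"
    proof (cases "j + k = 0")
      case True
      then show ?thesis using assms(2) by (simp add: jk lev_def)
    next
      case False
      have "\<alpha> ^ j * \<beta> ^ k \<in> Q"
      proof (cases j)
        case 0
        then obtain l where "k = Suc l" using False by (cases k) auto
        then show ?thesis using 0 D(5)[OF A.power_mem[OF \<beta>_A] ab(2), of l] by simp
      next
        case (Suc l)
        have "\<alpha> * (\<alpha> ^ l * \<beta> ^ k) \<in> Q" using D(5)[OF mon_A ab(1)] .
        then show ?thesis by (simp add: Suc mult.assoc)
      qed
      moreover have "1 \<le> j + k" using False by linarith
      ultimately show ?thesis by (simp add: jk lev_def)
    qed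
  qed (use D S_A in auto)
qed

lemma A_integral: "x \<in> A \<Longrightarrow> integral_elem S x"
  using A_M M_integral by blast

text \<open>
  The lowest nonzero coefficient of an integral equation for x is a multiple of x.
\<close>

lemma nonzero_ideal_meets_S:
  assumes "A.prime_in Q" "x \<in> Q" "x \<noteq> 0"
  shows "\<exists>s\<in>S \<inter> Q. s \<noteq> 0"
proof -
  have xA: "x \<in> A" using A.prime_inD(1)[OF assms(1,2)] .
  obtain n d where "\<And>i. d i \<in> S" "x ^ n = (\<Sum>i<n. d i * x ^ i)"
    using A_integral[OF xA] unfolding integral_elem_def by blast
  then show ?thesis
  proof (induction n arbitrary: d)
    case 0
    then show ?case by simp
  next
    case (Suc n)
    have eq: "x * x ^ n = d 0 + x * (\<Sum>i<n. d (Suc i) * x ^ i)"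
      using Suc.prems(2) unfolding sum.lessThan_Suc_shift by (simp add: sum_distrib_left mult_ac)
    show ?case
    proof (cases "d 0 = 0")
      case True
      then have "x ^ n = (\<Sum>i<n. d (Suc i) * x ^ i)" using eq assms(3) by simp
      then show ?thesis using Suc.IH[of "\<lambda>i. d (Suc i)"] Suc.prems(1) by blast
    next
      case False
      have "(x ^ n - (\<Sum>i<n. d (Suc i) * x ^ i)) * x = d 0" using eq by (simp add: algebra_simps)
      moreover have "x ^ n - (\<Sum>i<n. d (Suc i) * x ^ i) \<in> A"
        using xA Suc.prems(1) S_A by (intro A.diff_mem A.sum_mem A.mult_mem A.power_mem) auto
      ultimately have "d 0 \<in> Q" using A.prime_inD(4)[OF assms(1) _ assms(2)] by metis
      then show ?thesis using False Suc.prems(1) by blast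
    qed
  qed
qed

text \<open>
  A nonzero prime Q below P meets S in a nonzero ideal contained in pS. If p were not in Q, this
  ideal would be stable under division by p, and 1/p would be integral.
\<close>

lemma P_height_one:
  assumes "normal_noetherian_subring S"
  shows "height_one_prime (ring_on A) P"
proof (rule A.height_one_primeI[OF P_prime])
  interpret S: normal_noetherian_subring S by fact
  show "P \<noteq> {0}" using p_P p_pos(2) by auto
  fix Q assume Q: "A.prime_in Q" "Q \<noteq> {0}" "Q \<subseteq> P"
  note D = A.prime_inD[OF Q(1)]
  have "of_nat p \<in> Q"
  proof (rule ccontr)
    assume np: "of_nat p \<notin> Q"
    have "ideal (S \<inter> Q) (ring_on S)"
      unfolding ideal_ring_on_iff using D S_A by auto
    moreover have "S \<inter> Q \<noteq> {0}"
      using nonzero_ideal_meets_S[OF Q(1)] Q(2) D(2) by blast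
    moreover have "1 / of_nat p * s \<in> S \<inter> Q" if "s \<in> S \<inter> Q" for s
    proof -
      have "s / of_nat p \<in> S" using S_inter_P[of s] that Q(3) by blast
      moreover have "of_nat p * (s / of_nat p) \<in> Q" using that p_pos(2) by simp
      ultimately show ?thesis using D(7)[of "of_nat p" "s / of_nat p"] np S_A A.of_nat_mem by auto
    qed
    ultimately have "integral_elem S (1 / of_nat p)" by (rule S.stable_ideal_integral)
    moreover have "1 / of_nat p \<in> quotients S" by (intro Q.divide_mem) auto
    ultimately show False using closed p_nonunit by blast
  qed
  then show "Q = P" using P_contained[OF Q(1)] Q(3) by blast
qed

lemma unique_height_one_prime_over_p:
  assumes "normal_noetherian_subring S"
  shows "{Q. height_one_prime (ring_on A) Q \<and> of_nat p \<in> Q} = {P}"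
proof -
  have "Q = P" if "height_one_prime (ring_on A) Q" "of_nat p \<in> Q" for Q
  proof -
    have "P \<subseteq> Q" using P_contained[OF A.height_one_primeD(1)[OF that(1)] that(2)] .
    moreover have "P \<noteq> {0}" using p_P p_pos(2) by auto
    ultimately show ?thesis using A.height_one_primeD(2)[OF that(1) P_prime] by blast
  qed
  then show ?thesis using P_height_one[OF assms] p_P by blast
qed

text \<open>
  Modulo p the p-th power is additive, and it kills the generators of P. Hence an element outside P
  has a p-th power that is congruent to a constant not divisible by p, which is why pA is primary.
\<close>

lemma P_power_div:
  assumes "x \<in> P"
  shows "x ^ p / of_nat p \<in> A"
proof -
  define H where "H = {x \<in> A. x ^ p / of_nat p \<in> A}"
  have H_mult: "s * x \<in> H" if "s \<in> A" "x \<in> H" for s x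
  proof -
    have "s ^ p * (x ^ p / of_nat p) \<in> A" using that unfolding H_def by blast
    then show ?thesis using that unfolding H_def by (simp add: power_mult_distrib A.mult_mem)
  qed
  have H_add: "x + y \<in> H" if "x \<in> H" "y \<in> H" for x y
  proof -
    have xy: "x \<in> A" "y \<in> A" "x ^ p / of_nat p \<in> A" "y ^ p / of_nat p \<in> A" using that unfolding H_def by auto
    obtain w where w: "w \<in> A" "(x + y) ^ p = x ^ p + y ^ p + of_nat p * w"
      using A.freshman_dream[OF prime_p xy(1,2)] .
    have "(x + y) ^ p / of_nat p = x ^ p / of_nat p + y ^ p / of_nat p + w"
      unfolding w(2) using p_pos(2) by (simp add: add_divide_distrib)
    then show ?thesis using xy w(1) unfolding H_def by auto
  qed
  have pp: "(of_nat p :: 'k) ^ p = of_nat p * of_nat p ^ (p - 1)" using p_pos(1) by (metis power_eq_if not_gr0)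
  have H: "\<alpha> \<in> H" "\<beta> \<in> H" "of_nat p \<in> H"
    unfolding H_def using \<alpha>_A \<beta>_A \<alpha>_pow \<beta>_pow e1_A e2_A p_pos(2) A.power_mem[OF A.of_nat_mem, of p "p - 1"]
    by (auto simp: pp)
  have "P \<subseteq> H" unfolding P_def F_def
  proof (rule fspan_least)
    fix i assume "i \<in> idx"
    obtain j k where jk: "i = (j, k)" by (cases i)
    show "lev 1 i * mon i \<in> H"
    proof (cases "j + k = 0")
      case True
      then show ?thesis using H(3) by (simp add: jk lev_def)
    next
      case False
      have "\<alpha> ^ j * \<beta> ^ k \<in> H"
      proof (cases j)
        case 0
        then obtain l where "k = Suc l" using False by (cases k) auto
        then show ?thesis using 0 H_mult[OF A.power_mem[OF \<beta>_A] H(2), of l] by (simp add: mult.commute)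
      next
        case (Suc l)
        have "(\<alpha> ^ l * \<beta> ^ k) * \<alpha> \<in> H" using H_mult[OF mon_A H(1)] .
        then show ?thesis by (simp add: Suc mult_ac)
      qed
      moreover have "1 \<le> j + k" using False by linarith
      ultimately show ?thesis by (simp add: jk lev_def)
    qed
  qed (use H_mult[of 0 "of_nat p"] H(3) A.zero_mem H_add H_mult S_A in auto)
  then show ?thesis using assms unfolding H_def by blast
qed

lemma p_primary:
  assumes s: "s \<in> A" "s \<notin> P" and y: "y \<in> A" "s * y / of_nat p \<in> A"
  shows "y / of_nat p \<in> A"
proof -
  obtain t where t: "t \<in> S" "s - t \<in> P" using A_constant[OF s(1)] by blast
  have tn: "t / of_nat p \<notin> S"
  proof
    assume "t / of_nat p \<in> S"
    then have "t / of_nat p * of_nat p \<in> P" using S_A by (intro P_mult p_P) auto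
    then have "t \<in> P" using p_pos(2) by simp
    then have "(s - t) + t \<in> P" using t(2) unfolding P_def by (intro F_add)
    then show False using s(2) by simp
  qed
  define n where "n = s - t"
  have n: "n \<in> A" "n ^ p / of_nat p \<in> A"
    using t s(1) S_A P_power_div unfolding n_def by auto
  obtain w where w: "w \<in> A" "(s - n) ^ p = s ^ p - n ^ p + of_nat p * w"
    using A.freshman_dream_diff[OF prime_p p_odd s(1) n(1)] .
  have sp: "s ^ p = s ^ (p - 1) * s" using p_pos(1) by (metis power_minus_mult)
  have "t ^ p * y / of_nat p = s ^ (p - 1) * (s * y / of_nat p) - (n ^ p / of_nat p) * y + w * y"
  proof -
    have "t ^ p = s ^ (p - 1) * s - n ^ p + of_nat p * w" using w(2) unfolding sp n_def by simp
    then show ?thesis using p_pos(2)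
      by (simp add: add_divide_distrib diff_divide_distrib left_diff_distrib distrib_right mult.assoc)
  qed
  also have "\<dots> \<in> A" using s y n w by (intro A.add_mem A.diff_mem A.mult_mem A.power_mem)
  finally show ?thesis
    using nondiv_cancel_A[OF power_mem[OF t(1)] _ y(1)] div_power[OF t(1)] tn by blast
qed

definition K where "K = fspan (quotients S) idx mon"

lemma A_K: "A \<subseteq> K"
  unfolding A_def K_def fspan_def using subset_quotients by blast

lemma p_M_A:
  assumes "r \<in> M"
  shows "of_nat p * r \<in> A"
proof -
  have "M \<subseteq> {r. of_nat p * r \<in> A}" unfolding M_def
  proof (rule fspan_least)
    fix i assume "i \<in> idx"
    obtain j k where jk: "i = (j, k)" by (cases i)
    show "wt i * mon i \<in> {r. of_nat p * r \<in> A}"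
      using mon_A[of j k] A.mult_mem[OF A.of_nat_mem mon_A, of p j k] p_pos(2) by (auto simp: jk wt_def)
  qed (use S_A in \<open>auto simp: distrib_left mult.left_commute\<close>)
  then show ?thesis using assms by blast
qed

lemma M_K: "M \<subseteq> K"
proof
  fix x assume "x \<in> M"
  then obtain d where d: "\<And>i. d i \<in> S" "x = (\<Sum>i\<in>idx. d i * (wt i * mon i))"
    unfolding M_def by (elim fspanE) blast
  show "x \<in> K" unfolding K_def d(2)
  proof (rule Q.fspanI[of idx "\<lambda>i. d i * wt i"])
    show "d i * wt i \<in> quotients S" for i
      by (rule Q.mult_mem[OF subsetD[OF subset_quotients d(1)] wt_Q])
  qed (simp add: mult.assoc)
qed

text \<open>
  The product of a monomial of degree at least p - 1 and a divided monomial has degree at least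
  2 p - 1, so one exponent reaches p and supplies the factor p in the denominator.
\<close>

lemma F_conductor:
  assumes "x \<in> F (p - 1)" "r \<in> M"
  shows "x * r \<in> A"
proof -
  have "(lev (p - 1) i * mon i) * (wt j * mon j) \<in> fspan S idx mon" for i j
  proof -
    obtain i1 i2 j1 j2 where ij: "i = (i1, i2)" "j = (j1, j2)" by (cases i; cases j)
    let ?w = "\<alpha> ^ (i1 + j1) * \<beta> ^ (i2 + j2)"
    have w: "?w = mon i * mon j" by (simp add: ij power_add)
    have e: "(lev (p - 1) i * mon i) * (wt j * mon j) = lev (p - 1) i * wt j * ?w" unfolding w by simp
    consider "j1 + j2 < p" | "\<not> j1 + j2 < p" "i1 + i2 < p - 1" | "\<not> j1 + j2 < p" "p - 1 \<le> i1 + i2" by linarith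
    then have "lev (p - 1) i * wt j * ?w \<in> A"
    proof cases
      case 1
      then have "lev (p - 1) i * wt j \<in> A" by (auto simp: lev_def wt_def ij)
      then show ?thesis using mon_A by blast
    next
      case 2
      then have "lev (p - 1) i * wt j = 1" using p_pos(2) by (simp add: lev_def wt_def ij)
      then show ?thesis using mon_A by simp
    next
      case 3
      then have "lev (p - 1) i * wt j * ?w = ?w / of_nat p" by (simp add: lev_def wt_def ij)
      moreover have "?w / of_nat p \<in> A" using 3 by (intro mon_over_p_A) linarith
      ultimately show ?thesis by (simp only:)
    qed
    then show ?thesis unfolding e A_def .
  qed
  then show ?thesis using assms unfolding F_def M_def A_def
    by (rule fspan_mult[of idx idx "\<lambda>i. lev (p - 1) i * mon i" "\<lambda>i. wt i * mon i" idx mon])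
qed

text \<open>
  If a coefficient of total degree below p - 1 were not divisible by p, multiplying one of least
  degree into the corner \<alpha>^(p-1) \<beta>^(p-1) / p would leave A.
\<close>

lemma conductor_F:
  assumes "\<And>r. r \<in> M \<Longrightarrow> x * r \<in> A"
  shows "x \<in> F (p - 1)"
proof -
  have "x \<in> A" using assms[of 1] by simp
  then obtain d where d: "\<And>i. d i \<in> S" "x = (\<Sum>i\<in>idx. d i * mon i)"
    unfolding A_def by (elim fspanE) blast
  have low: "d i / of_nat p \<in> S" if "i \<in> idx" "fst i + snd i < p - 1" for i
  proof (rule ccontr)
    define bad where "bad i \<longleftrightarrow> i \<in> idx \<and> d i / of_nat p \<notin> S" for i
    assume "d i / of_nat p \<notin> S"
    then have "bad i" using that by (simp add: bad_def)
    define deg where "deg n \<longleftrightarrow> (\<exists>i. bad i \<and> fst i + snd i = n)" for n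
    define m where "m = (LEAST n. deg n)"
    have deg: "deg (fst j + snd j)" if "bad j" for j unfolding deg_def using that by blast
    have ex: "\<exists>i. bad i \<and> fst i + snd i = m"
      using LeastI[of deg, OF deg[OF \<open>bad i\<close>]] unfolding m_def deg_def .
    have least: "m \<le> fst j + snd j" if "bad j" for j
      unfolding m_def by (rule Least_le[of deg, OF deg[OF that]])
    obtain k l where kl: "bad (k, l)" "k + l = m" using ex by auto
    have m: "m < p - 1" using least[OF \<open>bad i\<close>] \<open>fst i + snd i < p - 1\<close> by linarith
    have kl': "k < p" "l < p" "(k, l) \<in> idx" using kl(1) by (auto simp: bad_def)
    let ?h = "\<alpha> ^ (p - 1 - k) * \<beta> ^ (p - 1 - l) / of_nat p"
    have "?h \<in> M" using kl kl' m by (intro M_high) linarith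
    then have "x * ?h \<in> A" by (rule assms)
    then have total: "(\<Sum>i\<in>idx. d i * mon i * ?h) \<in> A" unfolding d(2) by (simp only: sum_distrib_right)
    have mh: "mon (i, j) * ?h = \<alpha> ^ (i + (p - 1 - k)) * \<beta> ^ (j + (p - 1 - l)) / of_nat p" for i j
      by (simp add: power_add)
    have rest: "(\<Sum>i\<in>idx - {(k, l)}. d i * mon i * ?h) \<in> A"
    proof (rule A.sum_mem)
      fix q assume q: "q \<in> idx - {(k, l)}"
      obtain i j where ij: "q = (i, j)" by (cases q)
      show "d q * mon q * ?h \<in> A"
      proof (cases "bad q")
        case True
        then have "k + l \<le> i + j" using least[OF True] kl(2) ij by simp
        then have "i > k \<or> j > l" using q ij by force
        then have "p \<le> i + (p - 1 - k) \<or> p \<le> j + (p - 1 - l)" using kl' by linarith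
        then have "mon (i, j) * ?h \<in> A" unfolding mh by (rule mon_over_p_A)
        then have "d q * (mon (i, j) * ?h) \<in> A" using d(1)[of q] S_A by blast
        then show ?thesis by (simp add: ij mult.assoc)
      next
        case False
        then have dp: "d q / of_nat p \<in> A" using q S_A by (auto simp: bad_def)
        have "(d q / of_nat p) * (\<alpha> ^ (i + (p - 1 - k)) * \<beta> ^ (j + (p - 1 - l))) \<in> A"
          using dp mon_A by blast
        moreover have "d q * mon q * ?h = (d q / of_nat p) * (\<alpha> ^ (i + (p - 1 - k)) * \<beta> ^ (j + (p - 1 - l)))"
          unfolding ij mult.assoc mh by simp
        ultimately show ?thesis by (simp only:)
      qed
    qed
    have "(\<Sum>i\<in>idx. d i * mon i * ?h) = d (k, l) * mon (k, l) * ?h + (\<Sum>i\<in>idx - {(k, l)}. d i * mon i * ?h)"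
      by (rule sum.remove[OF fin kl'(3)])
    then have "d (k, l) * mon (k, l) * ?h = (\<Sum>i\<in>idx. d i * mon i * ?h) - (\<Sum>i\<in>idx - {(k, l)}. d i * mon i * ?h)"
      by simp
    then have "d (k, l) * mon (k, l) * ?h \<in> A" using A.diff_mem[OF total rest] by simp
    then have corner: "(d (k, l) / of_nat p) * (\<alpha> ^ (p - 1) * \<beta> ^ (p - 1)) \<in> A"
      unfolding mult.assoc mh using kl' by simp
    define e where "e = (\<lambda>i. if i = (p - 1, p - 1) then d (k, l) / of_nat p else 0)"
    have cidx: "(p - 1, p - 1) \<in> idx" using p_pos(1) by simp
    have "(\<Sum>i\<in>idx. e i * mon i)
        = (\<Sum>i\<in>idx. if i = (p - 1, p - 1) then (d (k, l) / of_nat p) * (\<alpha> ^ (p - 1) * \<beta> ^ (p - 1)) else 0)"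
      by (intro sum.cong) (auto simp: e_def)
    also have "\<dots> = (d (k, l) / of_nat p) * (\<alpha> ^ (p - 1) * \<beta> ^ (p - 1))"
      using cidx by (simp only: sum.delta[OF fin] if_True)
    finally have "(\<Sum>i\<in>idx. e i * mon i) \<in> A" using corner by simp
    moreover have "e i \<in> quotients S" for i
      unfolding e_def using d(1) subset_quotients by auto
    ultimately have "e (p - 1, p - 1) \<in> S" by (intro A_coord[OF _ _ cidx])
    then show False using kl(1) by (simp add: e_def bad_def)
  qed
  show ?thesis unfolding F_def d(2)
  proof (rule fspanI[of idx "\<lambda>i. if fst i + snd i < p - 1 then d i / of_nat p else d i"])
    show "(\<Sum>i\<in>idx. d i * mon i)
        = (\<Sum>i\<in>idx. (if fst i + snd i < p - 1 then d i / of_nat p else d i) * (lev (p - 1) i * mon i))"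
      using p_pos(2) by (intro sum.cong) (auto simp: lev_def)
  qed (use low d(1) in auto)
qed

lemma conductor_eq: "conductor K M A = F (p - 1)"
  unfolding conductor_def using F_conductor conductor_F F_A A_K by blast

text \<open>
  Saturation is easiest to see on the conductor: if s x r lies in A, then s (x p r) lies in pA, and
  pA is primary to P.
\<close>

lemma F_saturated:
  assumes "s \<in> A" "s \<notin> P" "x \<in> A" "s * x \<in> F (p - 1)"
  shows "x \<in> F (p - 1)"
proof (rule conductor_F)
  fix r assume r: "r \<in> M"
  have y: "x * (of_nat p * r) \<in> A" using assms(3) p_M_A[OF r] by blast
  have "s * x * r \<in> A" using F_conductor[OF assms(4) r] .
  then have "s * (x * (of_nat p * r)) / of_nat p \<in> A" using p_pos(2) by (simp add: mult_ac)
  then have "x * (of_nat p * r) / of_nat p \<in> A" by (rule p_primary[OF assms(1,2) y])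
  then show "x * r \<in> A" using p_pos(2) by (simp add: mult_ac)
qed

abbreviation ideal_power :: "nat \<Rightarrow> 'k set"
  where "ideal_power n \<equiv> P [^]\<^bsub>ideals_set (ring_on A)\<^esub> n"

lemma ideal_power_0: "ideal_power 0 = A"
  by (simp add: nat_pow_def ideals_set_def)

lemma ideal_power_Suc: "ideal_power (Suc n) = ideal_prod (ring_on A) (ideal_power n) P"
  by (simp add: nat_pow_def ideals_set_def)

lemma ideal_power_F: "ideal_power n \<subseteq> F n"
proof (induction n)
  case 0
  then show ?case unfolding ideal_power_0 F_0 by simp
next
  case (Suc n)
  show ?case unfolding ideal_power_Suc
  proof
    fix x assume "x \<in> ideal_prod (ring_on A) (ideal_power n) P"
    then show "x \<in> F (Suc n)"
    proof (induction rule: ideal_prod.induct)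
      case (prod i j)
      then have "i * j \<in> F (n + 1)" using Suc unfolding P_def by (intro F_mult) auto
      then show ?case by simp
    next
      case (sum s1 s2)
      then show ?case using F_add by simp
    qed
  qed
qed

lemma mon_ideal_power: "n \<le> i + j \<Longrightarrow> \<alpha> ^ i * \<beta> ^ j \<in> ideal_power n"
proof (induction n arbitrary: i j)
  case 0
  show ?case unfolding ideal_power_0 by (rule mon_A)
next
  case (Suc n)
  have ab: "\<alpha> \<in> P" "\<beta> \<in> P" using mon_F[of 1 1 0] mon_F[of 1 0 1] unfolding P_def by simp_all
  show ?case
  proof (cases i)
    case 0
    then obtain l where l: "j = Suc l" using Suc.prems by (cases j) auto
    have "(\<alpha> ^ i * \<beta> ^ l) \<otimes>\<^bsub>ring_on A\<^esub> \<beta> \<in> ideal_power (Suc n)"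
      unfolding ideal_power_Suc using Suc l by (intro ideal_prod.prod ab) auto
    then show ?thesis by (simp add: l mult_ac)
  next
    case (Suc l)
    have "(\<alpha> ^ l * \<beta> ^ j) \<otimes>\<^bsub>ring_on A\<^esub> \<alpha> \<in> ideal_power (Suc n)"
      unfolding ideal_power_Suc using Suc.IH Suc Suc.prems by (intro ideal_prod.prod ab) auto
    then show ?thesis by (simp add: Suc mult_ac)
  qed
qed

lemma e1_not_P: "e1 \<notin> P" "e1 \<noteq> 0"
proof -
  obtain w where w: "w \<in> A" "e1 = a - h1 ^ (p - 1) * \<alpha> - \<alpha> ^ 2 * w" using e1_form by blast
  have "\<alpha> \<in> P" using mon_F[of 1 1 0] unfolding P_def by simp
  moreover have "h1 ^ (p - 1) + \<alpha> * w \<in> A" using w(1) \<alpha>_A S_A h1 by blast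
  ultimately have "(h1 ^ (p - 1) + \<alpha> * w) * \<alpha> \<in> P" by (intro P_mult)
  then have n: "a - e1 \<in> P" unfolding w(2) by (simp add: algebra_simps power2_eq_square)
  show "e1 \<notin> P"
  proof
    assume "e1 \<in> P"
    then have "(a - e1) + e1 \<in> P" using n unfolding P_def by (intro F_add)
    then show False using S_inter_P[OF a] a_nondiv by simp
  qed
  then show "e1 \<noteq> 0" using F_zero[of 1] unfolding P_def by auto
qed

text \<open>Near P the element p is a unit times \<alpha>^p, so it lies in the p-th power of P.\<close>

lemma symbolic_power_eq: "symbolic_power A P (p - 1) = F (p - 1)"
proof
  note D = A.prime_inD[OF P_prime]
  let ?L = "localization_at A P"
  interpret L: field_subring ?L by (rule A.localization_subring(1)[OF P_prime])
  have AL: "A \<subseteq> ?L" by (rule A.localization_subring(2)[OF P_prime])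
  define J where "J = {y / s | y s. y \<in> F (p - 1) \<and> s \<in> A - P}"
  have JI: "y / s \<in> J" if "y \<in> F (p - 1)" "s \<in> A" "s \<notin> P" for y s
    unfolding J_def using that by blast
  have "ideal J (ring_on ?L)"
    unfolding L.ideal_ring_on_iff
  proof (intro conjI ballI)
    show "J \<subseteq> ?L" unfolding J_def localization_at_def using F_A by blast
    show "0 \<in> J" using JI[OF F_zero A.one_mem D(6)] by simp
  next
    fix x y assume "x \<in> J" "y \<in> J"
    then obtain u s w t where *: "u \<in> F (p - 1)" "s \<in> A" "s \<notin> P" "x = u / s"
      "w \<in> F (p - 1)" "t \<in> A" "t \<notin> P" "y = w / t"
      unfolding J_def by blast
    have nz: "s \<noteq> 0" "t \<noteq> 0" using * D(2) by auto
    have "x + y = (t * u + s * w) / (s * t)" using * nz by (simp add: field_simps)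
    moreover have "t * u + s * w \<in> F (p - 1)" using * by (intro F_add F_mult_A)
    moreover have "s * t \<in> A" "s * t \<notin> P" using * D(7) by blast+
    ultimately show "x + y \<in> J" using JI by simp
  next
    fix r x assume "r \<in> ?L" "x \<in> J"
    then obtain u s w t where *: "u \<in> A" "s \<in> A" "s \<notin> P" "r = u / s"
      "w \<in> F (p - 1)" "t \<in> A" "t \<notin> P" "x = w / t"
      unfolding J_def localization_at_def by blast
    have "r * x = (u * w) / (s * t)" using * by simp
    moreover have "u * w \<in> F (p - 1)" using * by (intro F_mult_A)
    moreover have "s * t \<in> A" "s * t \<notin> P" using * D(7) by blast+
    ultimately show "r * x \<in> J" using JI by simp
  qed
  moreover have "ideal_power (p - 1) \<subseteq> J"
    using ideal_power_F JI[OF _ A.one_mem D(6)] by fastforce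
  ultimately have sub: "genideal (ring_on ?L) (ideal_power (p - 1)) \<subseteq> J" unfolding genideal_def by blast
  show "symbolic_power A P (p - 1) \<subseteq> F (p - 1)"
  proof
    fix x assume "x \<in> symbolic_power A P (p - 1)"
    then have x: "x \<in> A" "x \<in> J" using sub unfolding symbolic_power_def by auto
    then obtain y s where ys: "y \<in> F (p - 1)" "s \<in> A" "s \<notin> P" "x = y / s" unfolding J_def by blast
    have "s \<noteq> 0" using ys(3) D(2) by auto
    then have "s * x = y" using ys(4) by simp
    then show "x \<in> F (p - 1)" using F_saturated[OF ys(2,3) x(1)] ys(1) by simp
  qed
  have "F (p - 1) \<subseteq> I" if I: "ideal I (ring_on ?L)" "ideal_power (p - 1) \<subseteq> I" for I
    unfolding F_def
  proof (rule fspan_least)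
    have Imult: "s * x \<in> I" if "s \<in> ?L" "x \<in> I" for s x
      using I(1) that unfolding L.ideal_ring_on_iff by blast
    fix i assume "i \<in> idx"
    obtain j k where jk: "i = (j, k)" by (cases i)
    show "lev (p - 1) i * mon i \<in> I"
    proof (cases "p - 1 \<le> j + k")
      case True
      then show ?thesis using mon_ideal_power[OF True] I(2) by (auto simp: jk lev_def)
    next
      case False
      have "\<alpha> ^ p * \<beta> ^ 0 \<in> ideal_power (p - 1)" by (rule mon_ideal_power) simp
      then have "\<alpha> ^ p \<in> I" using I(2) by auto
      moreover have "(\<alpha> ^ j * \<beta> ^ k) / e1 \<in> ?L"
        unfolding localization_at_def using mon_A e1_A e1_not_P(1) by blast
      ultimately have "(\<alpha> ^ j * \<beta> ^ k) / e1 * \<alpha> ^ p \<in> I" by (intro Imult)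
      then show ?thesis using False e1_not_P(2) unfolding \<alpha>_pow by (simp add: jk lev_def mult_ac)
    qed
  next
    show "s * x \<in> I" if "s \<in> S" "x \<in> I" for s x
      using I(1) that S_A AL unfolding L.ideal_ring_on_iff by blast
  qed (use I(1) in \<open>auto simp: L.ideal_ring_on_iff\<close>)
  then show "F (p - 1) \<subseteq> symbolic_power A P (p - 1)"
    unfolding symbolic_power_def genideal_def using F_A by blast
qed

text \<open>
  Two divisions by p take p^2 x back to x.
\<close>

lemma normalization_eq:
  assumes bound: "\<And>x. x \<in> K \<Longrightarrow> integral_elem S x \<Longrightarrow> of_nat p ^ 2 * x \<in> A"
  shows "{x \<in> K. integral_elem S x} = M"
proof
  show "M \<subseteq> {x \<in> K. integral_elem S x}" using M_K M_integral by blast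
  show "{x \<in> K. integral_elem S x} \<subseteq> M"
  proof clarify
    fix x assume x: "x \<in> K" "integral_elem S x"
    have "of_nat p ^ 2 * x \<in> M" using bound[OF x] A_M by blast
    moreover have px: "of_nat p ^ 2 * x / of_nat p = of_nat p * x"
      using p_pos(2) by (simp add: power2_eq_square)
    moreover have "integral_elem S (of_nat p * x)" by (rule integral_mult[OF integral_self[OF of_nat_mem] x(2)])
    ultimately have "of_nat p * x \<in> M" using div_M_of_integral[of "of_nat p ^ 2 * x"] by simp
    moreover have "of_nat p * x / of_nat p = x" using p_pos(2) by simp
    ultimately show "x \<in> M" using div_M_of_integral[of "of_nat p * x"] x(2) by simp
  qed
qed

lemma free_module_M: "free_module (ring_on S) (module_on M)"
  unfolding M_def by (intro free_module_fspan fin indep_wt) (use subset_quotients in blast)+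

end

section \<open>Consequences of the hypotheses\<close>

text \<open>
  If p divided the constant term a, then x^(p-1)/p would satisfy a monic equation of the form
  z^p = u^(p-1) z + t over D.
\<close>

lemma (in p_prime_subring) constant_term_nondiv:
  assumes p: "p \<ge> 3" and h: "h \<in> S" and eq: "(x + h) ^ p = h ^ p + of_nat p * a"
    and D: "field_subring D" "integrally_closed_domain (ring_on D)" "S \<subseteq> D" "x \<in> D"
    and notin: "x ^ (p - 1) / of_nat p \<notin> D"
  shows "a / of_nat p \<notin> S"
proof
  interpret D: field_subring D by fact
  assume a: "a / of_nat p \<in> S"
  define a' where "a' = a / of_nat p"
  have a': "a' \<in> D" "a = of_nat p * a'" using a D(3) p_pos(2) by (auto simp: a'_def)
  obtain r where r: "\<And>k. r k \<in> S"
    "x ^ p = of_nat p * (a - h ^ (p - 1) * x - x ^ 2 * (\<Sum>k<p - 2. r k * x ^ k))"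
    by (rule shifted_root_equation[OF prime_p p h eq]) blast
  define w where "w = (\<Sum>k<p - 2. r k * x ^ k)"
  have w: "w \<in> D" unfolding w_def using r(1) D(3,4) by (intro D.sum_mem D.mult_mem D.power_mem) auto
  define u where "u = - (h ^ (p - 1) + x * w)"
  have hD: "h \<in> D" using h D(3) by blast
  have u: "u \<in> D" unfolding u_def using hD D(4) w by (intro D.uminus_mem D.add_mem D.mult_mem D.power_mem)
  have xp: "x ^ p = of_nat p * (x * u + of_nat p * a')"
    unfolding r(2) w_def[symmetric] a'(2) u_def by (simp add: algebra_simps power2_eq_square)
  have xu: "x * u \<in> D" using D(4) u by blast
  define s where "s = (\<Sum>i<p - 1. (x * u) ^ (p - 1 - Suc i) * (x * u + of_nat p * a') ^ i)"
  have s: "s \<in> D" unfolding s_def using D(4) u a'(1) D.of_nat_mem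
    by (intro D.sum_mem D.mult_mem D.power_mem D.add_mem) auto
  have "(x * u + of_nat p * a') ^ (p - 1) - (x * u) ^ (p - 1) = ((x * u + of_nat p * a') - x * u) * s"
    unfolding s_def by (rule power_diff_sumr2)
  then have expand: "(x * u + of_nat p * a') ^ (p - 1) = x ^ (p - 1) * u ^ (p - 1) + of_nat p * (a' * s)"
    by (simp add: power_mult_distrib algebra_simps)
  define z where "z = x ^ (p - 1) / of_nat p"
  have pz: "x ^ (p - 1) = of_nat p * z" using p_pos(2) by (simp add: z_def)
  have pp: "(of_nat p :: 'k) ^ p = of_nat p ^ (p - 1) * of_nat p" using p_pos(1) by (metis power_minus_mult)
  have "of_nat p ^ p * z ^ p = (x ^ (p - 1)) ^ p" unfolding pz power_mult_distrib ..
  also have "\<dots> = (x ^ p) ^ (p - 1)" by (rule power_commutes_exponents)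
  also have "\<dots> = of_nat p ^ (p - 1) * (of_nat p * z * u ^ (p - 1) + of_nat p * (a' * s))"
    unfolding xp power_mult_distrib expand pz ..
  also have "\<dots> = of_nat p ^ p * (z * u ^ (p - 1) + a' * s)"
    unfolding pp by (simp add: algebra_simps)
  finally have zp: "z ^ p = z * u ^ (p - 1) + a' * s" using p_pos(2) by simp
  define e where "e i = (if i = 0 then a' * s else if i = 1 then u ^ (p - 1) else 0)" for i :: nat
  have "(\<Sum>i<p. e i * z ^ i) = (\<Sum>i\<in>{0, 1}. e i * z ^ i)"
    using p by (intro sum.mono_neutral_right) (auto simp: e_def)
  also have "\<dots> = z ^ p" unfolding zp by (simp add: e_def)
  finally have "z ^ p = (\<Sum>i<p. e i * z ^ i)" ..
  moreover have "e i \<in> D" for i unfolding e_def using a'(1) s u by auto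
  ultimately have "integral_elem D z" unfolding integral_elem_def by blast
  then have "z \<in> D" unfolding z_def
    using p_pos(2) D(4) by (intro integrally_closed_domainD[OF D(1,2)]) auto
  then show False using notin by (simp add: z_def)
qed

text \<open>
  The binomial expansion modulo p^2 keeps the linear term only.
\<close>

lemma (in field_subring) power_expansion_mod_square:
  assumes "u \<in> S" "v \<in> S"
  shows "\<exists>t\<in>S. (u + of_nat p * v) ^ Suc n = u ^ Suc n + of_nat p * of_nat (Suc n) * v * u ^ n + of_nat p ^ 2 * t"
proof (induction n)
  case 0
  then show ?case by (intro bexI[of _ 0]) auto
next
  case (Suc n)
  then obtain t where t: "t \<in> S"
    "(u + of_nat p * v) ^ Suc n = u ^ Suc n + of_nat p * of_nat (Suc n) * v * u ^ n + of_nat p ^ 2 * t" by blast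
  define t' where "t' = t * (u + of_nat p * v) + of_nat (Suc n) * v * v * u ^ n"
  have "t' \<in> S" unfolding t'_def using t(1) assms by (intro add_mem mult_mem of_nat_mem power_mem)
  moreover have "(u + of_nat p * v) ^ Suc (Suc n)
      = u ^ Suc (Suc n) + of_nat p * of_nat (Suc (Suc n)) * v * u ^ Suc n + of_nat p ^ 2 * t'"
    unfolding power_Suc[of "u + of_nat p * v" "Suc n"] t(2) t'_def
    by (simp add: algebra_simps power2_eq_square)
  ultimately show ?case by blast
qed

text \<open>
  Modulo p^2 the product f g^i is the p-th power of h1 h2^i plus p times the combination below.
\<close>

lemma (in p_prime_subring) combination_nondiv_of_product:
  assumes h: "h1 \<in> S" "h2 \<in> S" "a \<in> S" "b \<in> S" and i: "i \<ge> 1"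
    and notin: "(h1 ^ p + of_nat p * a) * (h2 ^ p + of_nat p * b) ^ i \<notin> pow_mod_p2 p S"
  shows "h2 ^ (p * (i - 1)) * (a * h2 ^ p + of_nat i * b * h1 ^ p) / of_nat p \<notin> S"
proof
  assume d: "h2 ^ (p * (i - 1)) * (a * h2 ^ p + of_nat i * b * h1 ^ p) / of_nat p \<in> S"
  obtain n where n: "i = Suc n" using i by (cases i) auto
  define k where "k = (h2 ^ p) ^ n * (a * h2 ^ p + of_nat i * b * h1 ^ p) / of_nat p"
  have k: "k \<in> S" using d by (simp add: k_def n power_mult)
  have pk: "of_nat p * k = (h2 ^ p) ^ n * (a * h2 ^ p + of_nat i * b * h1 ^ p)"
    using p_pos(2) by (simp add: k_def)
  obtain t where t: "t \<in> S" "(h2 ^ p + of_nat p * b) ^ i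
      = (h2 ^ p) ^ i + of_nat p * of_nat i * b * (h2 ^ p) ^ n + of_nat p ^ 2 * t"
    using power_expansion_mod_square[OF power_mem[OF h(2)] h(4), of p p n] unfolding n by (elim bexE)
  define y where "y = k + h1 ^ p * t + a * (of_nat i * b * (h2 ^ p) ^ n + of_nat p * t)"
  have "y \<in> S" unfolding y_def using k t(1) h by (intro add_mem mult_mem of_nat_mem power_mem)
  have "(h1 ^ p + of_nat p * a) * (h2 ^ p + of_nat p * b) ^ i
      = h1 ^ p * (h2 ^ p) ^ i + of_nat p * ((h2 ^ p) ^ n * (a * h2 ^ p + of_nat i * b * h1 ^ p))
        + of_nat p ^ 2 * (y - k)"
  proof -
    have ring: "(H + P * a) * (U * W + P * N * b * W + P ^ 2 * t)
        = H * (U * W) + P * (W * (a * U + N * b * H)) + P ^ 2 * (H * t + a * (N * b * W + P * t))"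
      for H U W N P :: 'k
      by (simp add: algebra_simps power2_eq_square)
    have "(h2 ^ p) ^ i = h2 ^ p * (h2 ^ p) ^ n" by (simp add: n)
    moreover have "y - k = h1 ^ p * t + a * (of_nat i * b * (h2 ^ p) ^ n + of_nat p * t)" by (simp add: y_def)
    ultimately show ?thesis unfolding t(2) by (simp only: ring)
  qed
  also have "\<dots> = h1 ^ p * (h2 ^ p) ^ i + of_nat p ^ 2 * y"
    unfolding pk[symmetric] by (simp add: algebra_simps power2_eq_square)
  also have "h1 ^ p * (h2 ^ p) ^ i = (h1 * h2 ^ i) ^ p"
    by (simp only: power_mult_distrib power_commutes_exponents[of h2 p i])
  finally have "(h1 ^ p + of_nat p * a) * (h2 ^ p + of_nat p * b) ^ i = (h1 * h2 ^ i) ^ p + y * of_nat p ^ 2"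
    by (simp add: mult.commute)
  moreover have "h1 * h2 ^ i \<in> S" using h by blast
  ultimately have "(h1 ^ p + of_nat p * a) * (h2 ^ p + of_nat p * b) ^ i \<in> pow_mod_p2 p S"
    unfolding pow_mod_p2_def using \<open>y \<in> S\<close> by blast
  then show False using notin by blast
qed

section \<open>Extensions generated by two p-th roots\<close>

theorem proposition3p3:
  fixes p d :: nat
    and S L K A R :: "'k::field_char_0 set"
    and f g \<omega> \<mu> :: 'k
  assumes p: "Factorial_Ring.prime p" "p \<ge> 3"
    and S_subring: "subring S ambient"
    and S_noetherian: "noetherian_domain (ring_on S)"
    and S_closed: "integrally_closed_domain (ring_on S)"
    and S_dim: "krull_dim (ring_on S) = enat d"
    and p_prime: "ring_prime\<^bsub>ring_on S\<^esub> (of_nat p)"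
    and S_mod_p_closed: "integrally_closed_domain (ring_on S Quot (PIdl\<^bsub>ring_on S\<^esub> (of_nat p)))"
    and L_def: "L = quotients S"
    and L_closure: "algebraic_closure (ambient :: 'k ring) L"
    and f_mem: "f \<in> pow_mod_p p S"
    and g_mem: "g \<in> pow_mod_p p S"
    and f_cases: "square_free S f \<and> f \<notin> Units (ring_on S) \<or>
                  f \<in> Units (ring_on S) \<and> (\<nexists>x. x \<in> S \<and> x ^ p = f)"
    and g_cases: "square_free S g \<and> g \<notin> Units (ring_on S) \<or>
                  g \<in> Units (ring_on S) \<and> (\<nexists>x. x \<in> S \<and> x ^ p = g)"
    and no_common: "\<nexists>Q. height_one_prime (ring_on S) Q \<and> f \<in> Q \<and> g \<in> Q"
    and \<omega>: "\<omega> ^ p = f"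
    and \<mu>: "\<mu> ^ p = g"
    and K_def: "K = adjoin_field L {\<omega>, \<mu>}"
    and K_degree: "ring.dimension ambient (p ^ 2) L K"
    and A_def: "A = adjoin S {\<omega>, \<mu>}"
    and R_def: "R = integral_closure_in S K"
    and S\<omega>_closed: "integrally_closed_domain (ring_on (adjoin S {\<omega>}))"
    and S\<mu>_closed: "integrally_closed_domain (ring_on (adjoin S {\<mu>}))"
    and fg: "\<forall>i \<in> {1..p - 1}. f * g ^ i \<notin> pow_mod_p2 p S"
  shows "free_module (ring_on S) (module_on R) \<and>
    (\<exists>P. {Q. height_one_prime (ring_on A) Q \<and> of_nat p \<in> Q} = {P} \<and>
         symbolic_power A P (p - 1) = conductor K R A)"
proof -
  let ?I = "{..<p} \<times> {..<p}"
  have fsS: "field_subring S" by (rule field_subring.intro[OF S_subring])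
  have nns: "normal_noetherian_subring S"
    by (intro normal_noetherian_subring.intro normal_noetherian_subring_axioms.intro fsS S_noetherian S_closed)
  interpret S: normal_noetherian_subring S by (rule nns)
  interpret L: field_subfield L unfolding L_def by (rule S.quotients_subfield)
  have SL: "S \<subseteq> L" unfolding L_def by (rule S.subset_quotients)
  have p0: "p > 0" using p(2) by simp
  have pk: "(of_nat p :: 'k) \<noteq> 0" using p0 by simp
  have prime_S: "p_prime_subring S p"
  proof (rule p_prime_subring.intro[OF fsS], rule p_prime_subring_axioms.intro)
    show "Factorial_Ring.prime p" by (rule p(1))
    have pr: "Divisibility.prime (ring_on S) (of_nat p :: 'k)" using p_prime by (simp add: ring_prime_def)
    show "1 / of_nat p \<notin> S"
    proof
      assume u: "1 / of_nat p \<in> S"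
      have "of_nat p \<in> Units (ring_on S)"
        unfolding Units_def using u pk by (auto intro!: bexI[OF _ u])
      then show False using pr by (simp add: Divisibility.prime_def)
    qed
    fix x y assume xy: "x \<in> S" "y \<in> S" "x * y / of_nat p \<in> S"
    have "of_nat p divides\<^bsub>ring_on S\<^esub> (x \<otimes>\<^bsub>ring_on S\<^esub> y)"
      unfolding factor_def using xy(3) pk by (auto intro!: bexI[OF _ xy(3)])
    then have "of_nat p divides\<^bsub>ring_on S\<^esub> x \<or> of_nat p divides\<^bsub>ring_on S\<^esub> y"
      using pr xy(1,2) by (auto simp: Divisibility.prime_def)
    then show "x / of_nat p \<in> S \<or> y / of_nat p \<in> S"
      unfolding factor_def using pk by auto
  qed
  interpret pS: p_prime_subring S p by (rule prime_S)
  obtain h1 a where f: "h1 \<in> S" "a \<in> S" "f = h1 ^ p + a * of_nat p"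
    using f_mem unfolding pow_mod_p_def by blast
  obtain h2 b where g: "h2 \<in> S" "b \<in> S" "g = h2 ^ p + b * of_nat p"
    using g_mem unfolding pow_mod_p_def by blast
  have fS: "f \<in> S" "g \<in> S" using f g by auto
  have f': "f = h1 ^ p + of_nat p * a" and g': "g = h2 ^ p + of_nat p * b"
    using f(3) g(3) by (simp_all add: mult.commute)
  define \<alpha> where "\<alpha> = \<omega> - h1"
  define \<beta> where "\<beta> = \<mu> - h2"
  have \<alpha>_eq: "(\<alpha> + h1) ^ p = h1 ^ p + of_nat p * a" using \<omega> f' by (simp add: \<alpha>_def)
  have \<beta>_eq: "(\<beta> + h2) ^ p = h2 ^ p + of_nat p * b" using \<mu> g' by (simp add: \<beta>_def)
  let ?mon = "\<lambda>(i, j). \<alpha> ^ i * \<beta> ^ j" and ?mon' = "\<lambda>(i, j). \<omega> ^ i * \<mu> ^ j"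

  obtain r where r: "\<And>k. r k \<in> S"
    "\<alpha> ^ p = of_nat p * (a - h1 ^ (p - 1) * \<alpha> - \<alpha> ^ 2 * (\<Sum>k<p - 2. r k * \<alpha> ^ k))"
    by (rule S.shifted_root_equation[OF p(1,2) f(1) \<alpha>_eq]) blast
  obtain t where t: "\<And>i. t i \<in> S" "\<alpha> ^ p = (\<Sum>i<p. t i * \<alpha> ^ i)"
    by (rule S.shifted_root_monic[OF p(2) f(1,2) r]) blast
  obtain r' where r': "\<And>k. r' k \<in> S"
    "\<beta> ^ p = of_nat p * (b - h2 ^ (p - 1) * \<beta> - \<beta> ^ 2 * (\<Sum>k<p - 2. r' k * \<beta> ^ k))"
    by (rule S.shifted_root_equation[OF p(1,2) g(1) \<beta>_eq]) blast
  obtain t' where t': "\<And>i. t' i \<in> S" "\<beta> ^ p = (\<Sum>i<p. t' i * \<beta> ^ i)"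
    by (rule S.shifted_root_monic[OF p(2) g(1,2) r']) blast
  have pure: "x ^ p = (\<Sum>i<p. (if i = 0 then x ^ p else 0) * x ^ i)" for x :: 'k
    using p0 by (simp add: if_distrib[of "\<lambda>x. x * _"] cong: if_cong)
  have tL: "t i \<in> L" "t' i \<in> L" for i using t(1) t'(1) SL by auto
  have fgL: "(if i = 0 then \<omega> ^ p else 0) \<in> L" "(if i = 0 then \<mu> ^ p else 0) \<in> L" for i :: nat
    using fS SL \<omega> \<mu> by auto
  have fgS: "(if i = 0 then \<omega> ^ p else 0) \<in> S" "(if i = 0 then \<mu> ^ p else 0) \<in> S" for i :: nat
    using fS \<omega> \<mu> by auto
  have hL: "h1 \<in> L" "h2 \<in> L" using f(1) g(1) SL by auto
  have K_mon': "K = fspan L ?I ?mon'"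
    unfolding K_def by (rule L.adjoin_field_eq_fspan[OF pure fgL(1) pure fgL(2)])
  have K_mon: "K = fspan L ?I ?mon"
    unfolding K_def L.adjoin_field_translate[OF hL, of \<omega> \<mu>, symmetric] \<alpha>_def[symmetric] \<beta>_def[symmetric]
    by (rule L.adjoin_field_eq_fspan[OF t(2) tL(1) t'(2) tL(2)])
  have A_mon': "A = fspan S ?I ?mon'"
    unfolding A_def by (rule S.adjoin_eq_fspan[OF pure fgS(1) pure fgS(2)])
  have A_mon: "A = fspan S ?I ?mon"
    unfolding A_def S.adjoin_translate[OF f(1) g(1), of \<omega> \<mu>, symmetric] \<alpha>_def[symmetric] \<beta>_def[symmetric]
    by (rule S.adjoin_eq_fspan[OF t(2,1) t'(2,1)])
  have card: "card ?I = p ^ 2" by (simp add: power2_eq_square)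
  have indep: "\<forall>i\<in>?I. e i = 0" if "\<And>i. e i \<in> L" "(\<Sum>i\<in>?I. e i * ?mon i) = 0" for e
    using L.independent_if_card_dimension[of ?I ?mon e] K_degree that unfolding K_mon card by blast
  have indep': "\<forall>i\<in>?I. e i = 0" if "\<And>i. e i \<in> L" "(\<Sum>i\<in>?I. e i * ?mon' i) = 0" for e
    using L.independent_if_card_dimension[of ?I ?mon' e] K_degree that unfolding K_mon' card by blast

  \<comment> \<open>In particular \<alpha>^(p-1) / p and \<beta>^(p-1) / p do not lie in the simple extensions generated by
    \<omega> and \<mu>, which is how their normality enters.\<close>
  have corner: "?mon i / of_nat p \<notin> A" if i: "i \<in> ?I" for i
  proof
    assume m: "?mon i / of_nat p \<in> A"
    define e where "e j = (if j = i then 1 / of_nat p else 0 :: 'k)" for j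
    have "(\<Sum>j\<in>?I. e j * ?mon j) = (\<Sum>j\<in>?I. if j = i then ?mon i / of_nat p else 0)"
      by (intro sum.cong) (auto simp: e_def)
    also have "\<dots> = ?mon i / of_nat p" using i by (simp only: sum.delta finite_SigmaI finite_lessThan if_True)
    finally have "(\<Sum>j\<in>?I. e j * ?mon j) \<in> fspan S ?I ?mon" using m unfolding A_mon by simp
    moreover have "e j \<in> quotients S" for j
      unfolding L_def[symmetric] e_def using L.divide_mem[OF L.one_mem L.of_nat_mem] by simp
    ultimately have "e i \<in> S"
      by (intro S.fspan_coord[of ?mon ?I e i] indep[unfolded L_def] i)
    then show False using pS.p_nonunit by (simp add: e_def)
  qed
  have sub\<omega>: "field_subring (adjoin S {\<omega>})" "adjoin S {\<omega>} \<subseteq> A" "\<alpha> \<in> adjoin S {\<omega>}"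
    and sub\<mu>: "field_subring (adjoin S {\<mu>})" "adjoin S {\<mu>} \<subseteq> A" "\<beta> \<in> adjoin S {\<mu>}"
  proof -
    interpret D: field_subring "adjoin S {\<omega>}" by (rule S.adjoin_subring)
    interpret E: field_subring "adjoin S {\<mu>}" by (rule S.adjoin_subring)
    show "field_subring (adjoin S {\<omega>})" "field_subring (adjoin S {\<mu>})" by (rule S.adjoin_subring)+
    show "\<alpha> \<in> adjoin S {\<omega>}" unfolding \<alpha>_def
      using S.adjoin_subring(2,3)[of "{\<omega>}"] f(1) by (intro D.diff_mem) auto
    show "\<beta> \<in> adjoin S {\<mu>}" unfolding \<beta>_def
      using S.adjoin_subring(2,3)[of "{\<mu>}"] g(1) by (intro E.diff_mem) auto
    show "adjoin S {\<omega>} \<subseteq> A" "adjoin S {\<mu>} \<subseteq> A"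
      unfolding A_def using S.adjoin_subring[of "{\<omega>, \<mu>}"] by (intro S.adjoin_least; simp)+
  qed
  have a_nondiv: "a / of_nat p \<notin> S"
  proof (rule pS.constant_term_nondiv[OF p(2) f(1) \<alpha>_eq sub\<omega>(1) S\<omega>_closed S.adjoin_subring(2) sub\<omega>(3)])
    have "?mon (p - 1, 0) / of_nat p \<notin> A" using p0 by (intro corner) auto
    then show "\<alpha> ^ (p - 1) / of_nat p \<notin> adjoin S {\<omega>}" using sub\<omega>(2) by auto
  qed
  have b_nondiv: "b / of_nat p \<notin> S"
  proof (rule pS.constant_term_nondiv[OF p(2) g(1) \<beta>_eq sub\<mu>(1) S\<mu>_closed S.adjoin_subring(2) sub\<mu>(3)])
    have "?mon (0, p - 1) / of_nat p \<notin> A" using p0 by (intro corner) auto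
    then show "\<beta> ^ (p - 1) / of_nat p \<notin> adjoin S {\<mu>}" using sub\<mu>(2) by auto
  qed
  have combination: "h2 ^ (p * (i - 1)) * (a * h2 ^ p + of_nat i * b * h1 ^ p) / of_nat p \<notin> S"
    if i: "i \<in> {1..p - 1}" for i
    using fg i pS.combination_nondiv_of_product[OF f(1) g(1) f(2) g(2), of i] unfolding f' g' by auto
  \<comment> \<open>The index 2 is available because p is at least 3; for it the combination has a factor h2.\<close>
  have h2_nondiv: "h2 / of_nat p \<notin> S"
  proof
    assume "h2 / of_nat p \<in> S"
    then have "h2 * (h2 ^ (p - 1) * (a * h2 ^ p + of_nat 2 * b * h1 ^ p)) / of_nat p \<in> S"
      by (rule pS.div_mult) (intro S.mult_mem S.add_mem S.power_mem S.of_nat_mem f g)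
    moreover have "h2 * h2 ^ (p - 1) = h2 ^ (p * (2 - 1))" using p0 by (cases p) auto
    ultimately have "h2 ^ (p * (2 - 1)) * (a * h2 ^ p + of_nat 2 * b * h1 ^ p) / of_nat p \<in> S"
      by (metis mult.assoc)
    moreover have "2 \<in> {1..p - 1}" using p(2) unfolding atLeastAtMost_iff by linarith
    ultimately show False using combination by blast
  qed
  have combination_nondiv: "(a * h2 ^ p + of_nat i * b * h1 ^ p) / of_nat p \<notin> S"
    if i: "i \<in> {1..p - 1}" for i
    using combination[OF i] pS.div_mult'[OF S.power_mem[OF g(1), of "p * (i - 1)"]] by blast
  interpret T: two_roots S p \<alpha> \<beta> h1 h2 a b
  proof (intro two_roots.intro two_roots_axioms.intro)
    show "\<forall>i\<in>?I. e i = 0" if "\<And>i. e i \<in> quotients S" "(\<Sum>i\<in>?I. e i * ?mon i) = 0" for e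
      using indep that unfolding L_def by blast
    show "u \<in> S" if "u \<in> quotients S" "integral_elem S u" for u
      using that by (rule S.integral_quotient)
  qed (fact prime_S p(2) f(1) g(1) f(2) g(2) \<alpha>_eq \<beta>_eq a_nondiv b_nondiv h2_nondiv combination_nondiv)+
  have TA: "T.A = A" unfolding A_mon T.A_def ..
  have TK: "T.K = K" unfolding K_mon T.K_def L_def ..

  obtain \<zeta> :: 'k where zeta: "\<zeta> ^ p = 1" "\<zeta> \<noteq> 1"
    using root_of_unity_exists[OF L_closure, of p] p(2) by auto
  \<comment> \<open>The p-th power of a homogeneous component is an integral element of L, hence of S.\<close>
  have bound: "of_nat p ^ 2 * x \<in> A" if x: "x \<in> K" "integral_elem S x" for x
  proof -
    obtain e where e: "\<And>i. e i \<in> L" "x = (\<Sum>i\<in>?I. e i * ?mon' i)"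
      using x(1) unfolding K_mon' by (elim fspanE) blast
    have eS: "of_nat p ^ 2 * e (k, l) \<in> S" if kl: "k < p" "l < p" for k l
    proof -
      have "integral_elem S (of_nat p ^ 2 * e (k, l) * (\<omega> ^ k * \<mu> ^ l))"
      proof (rule homogeneous_component_integral[OF L.field_subring_axioms p(1) zeta, of \<omega> \<mu> e])
        show "\<omega> ^ p \<in> L" "\<mu> ^ p \<in> L" using fS SL \<omega> \<mu> by auto
        show "\<forall>i\<in>?I. d i = 0" if "\<And>i. d i \<in> L" "(\<Sum>(i, j)\<in>?I. d (i, j) * (\<omega> ^ i * \<mu> ^ j)) = 0" for d
          using indep'[of d] that by (simp add: case_prod_unfold)
        show "integral_elem S (\<Sum>(i, j)\<in>?I. e (i, j) * (\<omega> ^ i * \<mu> ^ j))"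
          using x(2) unfolding e(2) by (simp add: case_prod_unfold)
      qed (use e(1) SL fsS kl in auto)
      then have "integral_elem S ((of_nat p ^ 2 * e (k, l) * (\<omega> ^ k * \<mu> ^ l)) ^ p)"
        by (rule S.integral_power)
      moreover have "(of_nat p ^ 2 * e (k, l) * (\<omega> ^ k * \<mu> ^ l)) ^ p = (of_nat p ^ 2 * e (k, l)) ^ p * f ^ k * g ^ l"
        unfolding power_mult_distrib power_commutes_exponents[of \<omega> k p] power_commutes_exponents[of \<mu> l p] \<omega> \<mu>
        by (simp add: mult.assoc)
      ultimately have int: "integral_elem S ((of_nat p ^ 2 * e (k, l)) ^ p * f ^ k * g ^ l)" by (simp only:)
      have q: "of_nat p ^ 2 * e (k, l) \<in> L"
        using e(1) by (intro L.mult_mem L.power_mem L.of_nat_mem)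
      then have "(of_nat p ^ 2 * e (k, l)) ^ p * f ^ k * g ^ l \<in> L"
        using fS SL by (intro L.mult_mem[OF L.mult_mem] L.power_mem[OF q] L.power_mem) auto
      then have mem: "(of_nat p ^ 2 * e (k, l)) ^ p * f ^ k * g ^ l \<in> S"
        using S.integral_quotient int unfolding L_def by blast
      show ?thesis
      proof (rule S.mem_of_radical_multiple_mem[OF q[unfolded L_def] fS(1) _ fS(2) _ no_common kl mem])
        show "square_free S f" if "height_one_prime (ring_on S) Q" "f \<in> Q" for Q
          using f_cases S.height_one_prime_no_units[OF that(1)] that(2) by blast
        show "square_free S g" if "height_one_prime (ring_on S) Q" "g \<in> Q" for Q
          using g_cases S.height_one_prime_no_units[OF that(1)] that(2) by blast
      qed
    qed
    have "of_nat p ^ 2 * x = (\<Sum>i\<in>?I. (of_nat p ^ 2 * e i) * ?mon' i)"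
      unfolding e(2) sum_distrib_left by (simp only: mult.assoc)
    then show ?thesis unfolding A_mon' using eS
      by (intro S.fspanI[of ?I "\<lambda>i. of_nat p ^ 2 * e i"]) auto
  qed
  have R: "R = T.M"
    unfolding R_def integral_closure_in_def integral_over_iff[OF fsS]
    using T.normalization_eq bound unfolding TA TK by blast
  have "free_module (ring_on S) (module_on R)" unfolding R by (rule T.free_module_M)
  moreover have "{Q. height_one_prime (ring_on A) Q \<and> of_nat p \<in> Q} = {T.P}"
    using T.unique_height_one_prime_over_p[OF nns] unfolding TA .
  moreover have "symbolic_power A T.P (p - 1) = conductor K R A"
    using T.symbolic_power_eq T.conductor_eq unfolding TA TK R by simp
  ultimately show ?thesis by blast
qed

end
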